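(* Let $G$ be a finite tree with site energies $x_v$ and edge energies $y_e$. Define the physical coefficients, for each edge $e=(u,v)$ and each $I\in\mathcal B(G)$ with $|I|\ge2$, by $$\alpha_e=\sum_{\substack{r\in\{u,v\}\\ \deg_G(r)=1}}p_r-y_e,\qquad \beta_I=\begin{cases}(-1)^{|I|}p_v,& I\subseteq \mathrm{Inc}_G(v)\text{ for some }v\in V(G),\\ 0,&\text{otherwise.}\end{cases}$$ Then (i) the round facet variables at these coefficients are the partial energies: for every $I\in\mathcal B(G)$, $$\sum_{e\in I}\alpha_e+\sum_{\substack{J\in\mathcal B(G)\\|J|\ge2}}\beta_J\max_{J'\subsetneq J}|J'\cap I|-\sum_{e\in I}y_e=X_I ;$$ and (ii) with $\mathcal I_G^{\mathrm{cube}}(\alpha')$ meromorphically continued to these coefficients, $$\langle G\rangle=\frac{2}{\prod_{v\in V(G)}p_v}\lim_{\alpha'\to0^+}\mathcal I_G^{\mathrm{cube}}(\alpha').$$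
   Context: $\mathrm{Inc}_G(v)$ is the set of edges incident to $v$ and $p_v=x_v+\sum_{e\in\mathrm{Inc}_G(v)}y_e$. For a connected subgraph $K\subseteq G$, $X_K=\sum_{v\in V(K)}p_v-2\sum_{e\in E(K)}y_e$. $\mathcal B(G)$ is the collection of nonempty edge subsets $I\subseteq E(G)$ such that $G[I]$ (edges $I$ with all their endpoints) is connected, and $X_I:=X_{G[I]}$. Correlator: a tube of a tree $K$ is a connected subgraph (single vertices and $K$ itself allowed); two tubes are compatible if one contains the other or they share neither vertices nor edges; a tubing is a set of pairwise compatible tubes. For a connected subgraph $K\subseteq G$, $\Psi_K=\sum_{T}\prod_{H\in T}X_H^{-1}$, the sum over maximal tubings $T$ of $K$, with $X_H$ the partial energies inherited from $G$ (i.e. computed with the $p_v$ of $G$). Then $$\langle G\rangle=\sum_{I\subseteq E(G)}\frac{\prod_{K\in\pi_0(G\setminus I)}2\Psi_K}{\prod_{e\in I}2y_e},$$ where $\pi_0(G\setminus I)$ is the set of connected components after deleting the edges $I$ (keeping all vertices). Stringy integral: for $I\in\mathcal B(G)$ with $|I|\ge 2$, $F_I(w)=\prod_{e\in I}(1+w_e)-\prod_{e\in I}w_e$, and $$\mathcal I_G^{\mathrm{cube}}(\alpha')=(\alpha')^{|E(G)|}\int_{\mathbb R_{>0}^{E(G)}}\prod_{e\in E(G)}\frac{\mathrm dw_e}{w_e}\prod_{e\in E(G)}w_e^{\alpha' y_e}\prod_{e\in E(G)}(1+w_e)^{-\alpha'\alpha_e}\prod_{\substack{I\in\mathcal B(G)\\|I|\ge2}}F_I(w)^{-\alpha'\beta_I}.$$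 It is first defined for independent parameters $\alpha_e,\beta_I>0$ with $(y_e)_e$ in the interior of the polytope $\sum_{e}\alpha_e[0,\mathbf e_e]+\sum_{|I|\ge2}\beta_IQ_I$, where $Q_I=\mathrm{Conv}\{\sum_{e\in J}\mathbf e_e: J\subsetneq I\}$, and then meromorphically continued in $(y,\alpha,\beta)$. (The expression in (i) is the support number of this polytope in the direction $\sum_{e\in I}\mathbf e_e$ minus $\sum_{e\in I}y_e$, extended linearly to arbitrary coefficients.) The energies are taken generic, so that no denominators vanish. *)

theory Defs
  imports "HOL-Analysis.Analysis"
begin

section \<open>Graphs, subgraphs, trees\<close>

text \<open>A graph is a pair of a vertex set and a set of two-element vertex sets.\<close>

type_synonym 'v graph = "'v set \<times> 'v set set"

abbreviation verts :: "'v graph \<Rightarrow> 'v set" where "verts G \<equiv> fst G"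
abbreviation edges :: "'v graph \<Rightarrow> 'v set set" where "edges G \<equiv> snd G"

definition finite_simple_graph :: "'v graph \<Rightarrow> bool" where
  "finite_simple_graph G \<longleftrightarrow>
     finite (verts G) \<and> (\<forall>e\<in>edges G. e \<subseteq> verts G \<and> card e = 2)"

definition connected_graph :: "'v graph \<Rightarrow> bool" where
  "connected_graph G \<longleftrightarrow> verts G \<noteq> {} \<and>
     (\<forall>u\<in>verts G. \<forall>v\<in>verts G. (u, v) \<in> {(a, b). {a, b} \<in> edges G}\<^sup>*)"

definition is_cycle :: "'v graph \<Rightarrow> 'v list \<Rightarrow> bool" where
  "is_cycle G c \<longleftrightarrow> length c \<ge> 3 \<and> distinct c \<and>
     (\<forall>i<length c. {c ! i, c ! (Suc i mod length c)} \<in> edges G)"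

definition finite_tree :: "'v graph \<Rightarrow> bool" where
  "finite_tree G \<longleftrightarrow>
     finite_simple_graph G \<and> connected_graph G \<and> (\<nexists>c. is_cycle G c)"

definition incident :: "'v graph \<Rightarrow> 'v \<Rightarrow> 'v set set" where
  "incident G v = {e \<in> edges G. v \<in> e}"

definition subgraph :: "'v graph \<Rightarrow> 'v graph \<Rightarrow> bool" where
  "subgraph H K \<longleftrightarrow> verts H \<subseteq> verts K \<and> edges H \<subseteq> edges K \<and> \<Union>(edges H) \<subseteq> verts H"

definition connected_subgraphs :: "'v graph \<Rightarrow> 'v graph set" where
  "connected_subgraphs K = {H. subgraph H K \<and> connected_graph H}"

definition components_of_graph :: "'v graph \<Rightarrow> 'v graph set" where
  "components_of_graph G =
     {K \<in> connected_subgraphs G. \<forall>L\<in>connected_subgraphs G. subgraph K L \<longrightarrow> L = K}"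

definition delete_edges :: "'v graph \<Rightarrow> 'v set set \<Rightarrow> 'v graph" where
  "delete_edges G I = (verts G, edges G - I)"

definition edge_induced :: "'v set set \<Rightarrow> 'v graph" where
  "edge_induced I = (\<Union>I, I)"

definition conn_edge_sets :: "'v graph \<Rightarrow> 'v set set set" where
  "conn_edge_sets G = {I. I \<noteq> {} \<and> I \<subseteq> edges G \<and> connected_graph (edge_induced I)}"

definition big_conn_edge_sets :: "'v graph \<Rightarrow> 'v set set set" where
  "big_conn_edge_sets G = {I \<in> conn_edge_sets G. 2 \<le> card I}"


section \<open>Energies and the correlator\<close>

definition vertex_energy ::
  "'v graph \<Rightarrow> ('v \<Rightarrow> complex) \<Rightarrow> ('v set \<Rightarrow> complex) \<Rightarrow> 'v \<Rightarrow> complex" where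
  "vertex_energy G x y v = x v + (\<Sum>e\<in>incident G v. y e)"

definition partial_energy ::
  "'v graph \<Rightarrow> ('v \<Rightarrow> complex) \<Rightarrow> ('v set \<Rightarrow> complex) \<Rightarrow> 'v graph \<Rightarrow> complex" where
  "partial_energy G x y K =
     (\<Sum>v\<in>verts K. vertex_energy G x y v) - 2 * (\<Sum>e\<in>edges K. y e)"

definition compatible_tubes :: "'v graph \<Rightarrow> 'v graph \<Rightarrow> bool" where
  "compatible_tubes A B \<longleftrightarrow> subgraph A B \<or> subgraph B A \<or>
     (verts A \<inter> verts B = {} \<and> edges A \<inter> edges B = {})"

definition tubings :: "'v graph \<Rightarrow> 'v graph set set" where
  "tubings K = {T. T \<subseteq> connected_subgraphs K \<and> (\<forall>A\<in>T. \<forall>B\<in>T. compatible_tubes A B)}"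

definition maximal_tubings :: "'v graph \<Rightarrow> 'v graph set set" where
  "maximal_tubings K = {T \<in> tubings K. \<forall>T'\<in>tubings K. T \<subseteq> T' \<longrightarrow> T' = T}"

text \<open>The energies of the tubes of \<open>K\<close> are computed in the ambient graph \<open>G\<close>.\<close>

definition tubing_sum ::
  "'v graph \<Rightarrow> ('v \<Rightarrow> complex) \<Rightarrow> ('v set \<Rightarrow> complex) \<Rightarrow> 'v graph \<Rightarrow> complex" where
  "tubing_sum G x y K =
     (\<Sum>T\<in>maximal_tubings K. \<Prod>H\<in>T. inverse (partial_energy G x y H))"

definition correlator ::
  "'v graph \<Rightarrow> ('v \<Rightarrow> complex) \<Rightarrow> ('v set \<Rightarrow> complex) \<Rightarrow> complex" where
  "correlator G x y =
     (\<Sum>I\<in>Pow (edges G).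
        (\<Prod>K\<in>components_of_graph (delete_edges G I). 2 * tubing_sum G x y K) /
        (\<Prod>e\<in>I. 2 * y e))"

text \<open>Genericity: none of the denominators \<open>X\<^sub>K\<close> (which include \<open>p\<^sub>v\<close>, for the
  single-vertex subgraphs) and \<open>y\<^sub>e\<close> vanishes.\<close>

definition generic_energies ::
  "'v graph \<Rightarrow> ('v \<Rightarrow> complex) \<Rightarrow> ('v set \<Rightarrow> complex) \<Rightarrow> bool" where
  "generic_energies G x y \<longleftrightarrow>
     (\<forall>e\<in>edges G. y e \<noteq> 0) \<and> (\<forall>K\<in>connected_subgraphs G. partial_energy G x y K \<noteq> 0)"


section \<open>Physical coefficients\<close>

definition phys_alpha ::
  "'v graph \<Rightarrow> ('v \<Rightarrow> complex) \<Rightarrow> ('v set \<Rightarrow> complex) \<Rightarrow> 'v set \<Rightarrow> complex" where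
  "phys_alpha G x y e =
     (\<Sum>r\<in>{r \<in> e. card (incident G r) = 1}. vertex_energy G x y r) - y e"

text \<open>The vertex below is unique as soon as \<open>I\<close> has at least two elements, which
  is the only case in which \<open>\<beta>\<close> is used.\<close>

definition phys_beta ::
  "'v graph \<Rightarrow> ('v \<Rightarrow> complex) \<Rightarrow> ('v set \<Rightarrow> complex) \<Rightarrow> 'v set set \<Rightarrow> complex" where
  "phys_beta G x y I =
     (if \<exists>v\<in>verts G. I \<subseteq> incident G v
      then (-1) ^ card I * vertex_energy G x y (THE v. v \<in> verts G \<and> I \<subseteq> incident G v)
      else 0)"

definition facet_variable ::
  "'v graph \<Rightarrow> ('v set \<Rightarrow> complex) \<Rightarrow> ('v set \<Rightarrow> complex) \<Rightarrow> ('v set set \<Rightarrow> complex) \<Rightarrow>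
   'v set set \<Rightarrow> complex" where
  "facet_variable G y \<alpha> \<beta> I =
     (\<Sum>e\<in>I. \<alpha> e)
     + (\<Sum>J\<in>big_conn_edge_sets G. \<beta> J * of_nat (Max {card (J' \<inter> I) |J'. J' \<subset> J}))
     - (\<Sum>e\<in>I. y e)"


section \<open>The stringy integral in its domain of definition\<close>

definition F_poly :: "'v set set \<Rightarrow> ('v set \<Rightarrow> real) \<Rightarrow> real" where
  "F_poly I w = (\<Prod>e\<in>I. 1 + w e) - (\<Prod>e\<in>I. w e)"

definition stringy_integral ::
  "'v graph \<Rightarrow> real \<Rightarrow> ('v set \<Rightarrow> real) \<Rightarrow> ('v set \<Rightarrow> real) \<Rightarrow> ('v set set \<Rightarrow> real) \<Rightarrow> real" where
  "stringy_integral G a y \<alpha> \<beta> =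
     a ^ card (edges G) *
     (LINT w : (edges G \<rightarrow>\<^sub>E {0<..}) | PiM (edges G) (\<lambda>_. lborel).
        (\<Prod>e\<in>edges G. 1 / w e) *
        (\<Prod>e\<in>edges G. w e powr (a * y e)) *
        (\<Prod>e\<in>edges G. (1 + w e) powr (- (a * \<alpha> e))) *
        (\<Prod>I\<in>big_conn_edge_sets G. F_poly I w powr (- (a * \<beta> I))))"

text \<open>The space \<open>\<real>\<^bsup>E(G)\<^esup>\<close> is the coordinate subspace of \<open>\<real>\<^bsup>'v set\<^esup>\<close> of the vectors that
  vanish outside \<open>E(G)\<close>.\<close>

definition Q_polytope :: "('v::finite) set set \<Rightarrow> (real ^ 'v set) set" where
  "Q_polytope I = convex hull {\<Sum>e\<in>J. axis e 1 |J. J \<subset> I}"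

definition newton_polytope ::
  "('v::finite) graph \<Rightarrow> ('v set \<Rightarrow> real) \<Rightarrow> ('v set set \<Rightarrow> real) \<Rightarrow> (real ^ 'v set) set" where
  "newton_polytope G \<alpha> \<beta> =
     (\<Sum>e\<in>edges G. (*\<^sub>R) (\<alpha> e) ` closed_segment 0 (axis e 1)) +
     (\<Sum>I\<in>big_conn_edge_sets G. (*\<^sub>R) (\<beta> I) ` Q_polytope I)"

text \<open>For positive \<open>\<alpha>\<close> the polytope is full-dimensional in \<open>\<real>\<^bsup>E(G)\<^esup>\<close>, so its interior there
  is its relative interior.\<close>

definition convergence_domain ::
  "('v::finite) graph \<Rightarrow> ('v set \<Rightarrow> real) \<Rightarrow> ('v set \<Rightarrow> real) \<Rightarrow> ('v set set \<Rightarrow> real) \<Rightarrow> bool" where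
  "convergence_domain G y \<alpha> \<beta> \<longleftrightarrow>
     (\<forall>e\<in>edges G. \<alpha> e > 0) \<and> (\<forall>I\<in>big_conn_edge_sets G. \<beta> I > 0) \<and>
     (\<chi> e. if e \<in> edges G then y e else 0) \<in> rel_interior (newton_polytope G \<alpha> \<beta>)"


section \<open>Meromorphic continuation in several complex variables\<close>

definition holomorphic_nd :: "(complex ^ 'n::finite \<Rightarrow> complex) \<Rightarrow> (complex ^ 'n) set \<Rightarrow> bool" where
  "holomorphic_nd f S \<longleftrightarrow>
     (\<forall>z\<in>S. \<exists>D. (f has_derivative D) (at z) \<and> (\<forall>c v. D (c *s v) = c * D v))"

text \<open>A meromorphic function on \<open>\<complex>\<^sup>n\<close> is locally a quotient \<open>g / h\<close>; its values are
  unconstrained where the denominator vanishes, and are meaningful at the points of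
  regularity.\<close>

definition meromorphic_nd :: "(complex ^ 'n::finite \<Rightarrow> complex) \<Rightarrow> bool" where
  "meromorphic_nd M \<longleftrightarrow>
     (\<forall>p. \<exists>U g h. open U \<and> connected U \<and> p \<in> U \<and> holomorphic_nd g U \<and> holomorphic_nd h U \<and>
        (\<exists>z\<in>U. h z \<noteq> 0) \<and> (\<forall>z\<in>U. h z \<noteq> 0 \<longrightarrow> M z = g z / h z))"

definition regular_at :: "(complex ^ 'n::finite \<Rightarrow> complex) \<Rightarrow> complex ^ 'n \<Rightarrow> bool" where
  "regular_at M p \<longleftrightarrow> (\<exists>U. open U \<and> p \<in> U \<and> holomorphic_nd M U)"

text \<open>The parameters \<open>(y, \<alpha>, \<beta>)\<close> as one complex vector. The coordinates of \<open>y\<close> and \<open>\<alpha>\<close>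
  outside \<open>E(G)\<close>, and those of \<open>\<beta>\<close> outside the connected edge sets of size at least two,
  are dummies.\<close>

definition params ::
  "('v::finite set \<Rightarrow> complex) \<Rightarrow> ('v set \<Rightarrow> complex) \<Rightarrow> ('v set set \<Rightarrow> complex) \<Rightarrow>
   complex ^ ('v set + 'v set + 'v set set)" where
  "params y \<alpha> \<beta> =
     (\<chi> k. case k of Inl e \<Rightarrow> y e | Inr (Inl e) \<Rightarrow> \<alpha> e | Inr (Inr I) \<Rightarrow> \<beta> I)"

text \<open>By the identity theorem, the continuation is determined at its points of regularity,
  because the convergence domain contains a nonempty open subset of the real parameter space.\<close>

definition continues_stringy_integral ::
  "('v::finite) graph \<Rightarrow> real \<Rightarrow>
   (complex ^ ('v set + 'v set + 'v set set) \<Rightarrow> complex) \<Rightarrow> bool" where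
  "continues_stringy_integral G a M \<longleftrightarrow>
     meromorphic_nd M \<and>
     (\<forall>y \<alpha> \<beta>. convergence_domain G y \<alpha> \<beta> \<longrightarrow>
        M (params (\<lambda>e. of_real (y e)) (\<lambda>e. of_real (\<alpha> e)) (\<lambda>I. of_real (\<beta> I)))
        = of_real (stringy_integral G a y \<alpha> \<beta>))"

end

theory Submission
  imports Defs "HOL-Complex_Analysis.Complex_Analysis"
begin

text \<open>
  In logarithmic coordinates \<open>w = exp t\<close> the integral is a Laplace transform \<open>N\<close> of the
  parameters: \<open>\<I>(\<alpha>') = \<alpha>'\<^sup>n N(\<alpha>' z)\<close>, with one integrand \<open>exp (\<Sum> z\<^sub>k L\<^sub>k(t))\<close> in which every \<open>L\<^sub>k\<close> is,
  up to a bounded error, piecewise linear. The directions \<open>-e\<^sub>e\<close> and \<open>\<Sum>\<^bsub>e\<in>I\<^esub> e\<^sub>e\<close> (\<open>I \<in> \<B>(G)\<close>) span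
  the domains of linearity, and the linear forms \<open>X\<^sub>r\<close> of \<open>z\<close> attached to them are the \<open>y\<^sub>e\<close> and the
  facet variables; \<open>N\<close> converges where all of them have positive real part.

  Differentiating under translations in the direction \<open>r\<close> expresses \<open>X\<^sub>r N(z)\<close> by values of \<open>N\<close> at
  shifts of \<open>z\<close> that increase \<open>X\<^sub>r\<close> by at least one and decrease no other form. Hence
  \<open>N / \<Prod> \<Gamma>(X\<^sub>r)\<close> is entire, which yields the meromorphic continuation.

  For real \<open>z\<close> in the domain of convergence \<open>\<alpha>'\<^sup>n N(\<alpha>' z)\<close> tends to the integral of the exponential of
  the tropical function. Splitting off the minimum of \<open>t\<close> on a connected component of its
  positive support evaluates that integral by the recursion that maximal tubings satisfy when
  the edge not covered by proper tubes is removed. The product of \<open>N\<close> with all \<open>X\<^sub>r\<close> is holomorphic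
  near the origin, so the identity theorem, applied to its Taylor coefficients along complex lines,
  carries the limit over to generic complex parameters, in particular to the physical ones, where
  inclusion-exclusion over the stars of \<open>G\<close> turns the facet variables into partial energies.
\<close>

section \<open>Holomorphic functions of several variables\<close>

text \<open>As \<open>a\<close> tends to 0, every form \<open>X r (a z)\<close> tends to 0, so the
  limit is taken at the common point of the polar hyperplanes through the origin, where continuity
  in \<open>z\<close> says nothing. After multiplication by all forms, the limit says that a
  holomorphic function vanishes at least to a given order along the ray through \<open>z\<close>,
  with a prescribed next coefficient. This concerns Taylor coefficients only and can be continued in
  \<open>z\<close>. A complex point is reached from real ones along two lines, the first turning on
  the imaginary part and the second moving the real part.

  The prefactor \<open>2 / \<Prod> p\<close> has two sources. Deleting \<open>k\<close> edges from a
  tree leaves \<open>k + 1\<close> components, so all powers of 2 cancel but one. A single vertex is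
  compatible with every tube, hence lies in every maximal tubing and contributes
  \<open>1 / p\<close>; what remains of a maximal tubing is a nested family of connected edge sets,
  and such families also organize the order of the positive coordinates of \<open>t\<close>.\<close>

lemma holomorphic_ndI:
  assumes "\<And>z. z \<in> S \<Longrightarrow> (f has_derivative D z) (at z)"
    and "\<And>z c v. z \<in> S \<Longrightarrow> D z (c *s v) = c * D z v"
  shows "holomorphic_nd f S"
  using assms unfolding holomorphic_nd_def by blast

lemma holomorphic_nd_const [simp]: "holomorphic_nd (\<lambda>_. c) S"
  by (rule holomorphic_ndI[where D="\<lambda>_ _. 0"]) auto

lemma holomorphic_nd_nth [simp]: "holomorphic_nd (\<lambda>z. z $ k) S"
  by (rule holomorphic_ndI[where D="\<lambda>_ v. v $ k"])
    (auto intro!: bounded_linear_imp_has_derivative bounded_linear_vec_nth)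

lemma holomorphic_nd_add:
  assumes "holomorphic_nd f S" "holomorphic_nd g S"
  shows "holomorphic_nd (\<lambda>z. f z + g z) S"
  unfolding holomorphic_nd_def
proof
  fix z assume "z \<in> S"
  then obtain D D' where "(f has_derivative D) (at z)" "(g has_derivative D') (at z)"
    "\<forall>c v. D (c *s v) = c * D v" "\<forall>c v. D' (c *s v) = c * D' v"
    using assms unfolding holomorphic_nd_def by meson
  then show "\<exists>D. ((\<lambda>z. f z + g z) has_derivative D) (at z) \<and> (\<forall>c v. D (c *s v) = c * D v)"
    by (intro exI[of _ "\<lambda>v. D v + D' v"] conjI has_derivative_add) (auto simp: distrib_left)
qed

lemma holomorphic_nd_mult:
  assumes "holomorphic_nd f S" "holomorphic_nd g S"
  shows "holomorphic_nd (\<lambda>z. f z * g z) S"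
  unfolding holomorphic_nd_def
proof
  fix z assume "z \<in> S"
  then obtain D D' where "(f has_derivative D) (at z)" "(g has_derivative D') (at z)"
    "\<forall>c v. D (c *s v) = c * D v" "\<forall>c v. D' (c *s v) = c * D' v"
    using assms unfolding holomorphic_nd_def by meson
  then show "\<exists>D. ((\<lambda>z. f z * g z) has_derivative D) (at z) \<and> (\<forall>c v. D (c *s v) = c * D v)"
    by (intro exI[of _ "\<lambda>v. f z * D' v + D v * g z"] conjI has_derivative_mult) (auto simp: algebra_simps)
qed

lemma holomorphic_nd_sum:
  assumes "\<And>i. i \<in> A \<Longrightarrow> holomorphic_nd (f i) S"
  shows "holomorphic_nd (\<lambda>z. \<Sum>i\<in>A. f i z) S"
  using assms by (induction A rule: infinite_finite_induct) (auto intro: holomorphic_nd_add)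

lemma holomorphic_nd_prod:
  assumes "\<And>i. i \<in> A \<Longrightarrow> holomorphic_nd (f i) S"
  shows "holomorphic_nd (\<lambda>z. \<Prod>i\<in>A. f i z) S"
  using assms by (induction A rule: infinite_finite_induct) (auto intro: holomorphic_nd_mult)

lemma holomorphic_nd_diff:
  assumes "holomorphic_nd f S" "holomorphic_nd g S"
  shows "holomorphic_nd (\<lambda>z. f z - g z) S"
  using holomorphic_nd_add[OF assms(1) holomorphic_nd_mult[OF holomorphic_nd_const[of "-1"] assms(2)]]
  by simp

lemma holomorphic_nd_compose:
  assumes f: "holomorphic_nd f S" and g: "g holomorphic_on T" "open T" "f ` S \<subseteq> T"
  shows "holomorphic_nd (\<lambda>z. g (f z)) S"
  unfolding holomorphic_nd_def
proof
  fix z assume z: "z \<in> S"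
  then obtain D where D: "(f has_derivative D) (at z)" "\<forall>c v. D (c *s v) = c * D v"
    using f unfolding holomorphic_nd_def by meson
  obtain g' where "(g has_field_derivative g') (at (f z))"
    using g z by (meson holomorphic_on_open image_subset_iff)
  then have "(g has_derivative (*) g') (at (f z))" by (simp add: has_field_derivative_def)
  from diff_chain_at[OF D(1) this]
  show "\<exists>D. ((\<lambda>z. g (f z)) has_derivative D) (at z) \<and> (\<forall>c v. D (c *s v) = c * D v)"
    using D(2) by (intro exI[of _ "\<lambda>v. g' * D v"]) (auto simp: o_def)
qed

lemma holomorphic_nd_divide:
  assumes "holomorphic_nd f S" "holomorphic_nd g S" "\<And>z. z \<in> S \<Longrightarrow> g z \<noteq> 0"
  shows "holomorphic_nd (\<lambda>z. f z / g z) S"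
proof -
  have "holomorphic_nd (\<lambda>z. inverse (g z)) S"
    by (rule holomorphic_nd_compose[OF assms(2), where T="-{0}"])
      (use assms(3) in \<open>auto intro!: holomorphic_intros\<close>)
  from holomorphic_nd_mult[OF assms(1) this] show ?thesis by (simp add: divide_inverse)
qed

lemma holomorphic_nd_affine:
  assumes "holomorphic_nd f T" "\<And>z. z \<in> S \<Longrightarrow> c *s z + w \<in> T"
  shows "holomorphic_nd (\<lambda>z. f (c *s z + w)) S"
  unfolding holomorphic_nd_def
proof
  fix z assume "z \<in> S"
  then obtain D where D: "(f has_derivative D) (at (c *s z + w))" "\<forall>c v. D (c *s v) = c * D v"
    using assms unfolding holomorphic_nd_def by meson
  have "bounded_linear ((*s) c :: complex^'a \<Rightarrow> complex^'a)"
    by (rule linear_conv_bounded_linear[THEN iffD1])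
      (simp add: linear_iff vector_add_ldistrib scaleR_vec_def vector_scalar_mult_def vec_eq_iff algebra_simps)
  then have "((\<lambda>z. c *s z + w) has_derivative (*s) c) (at z)"
    by (intro has_derivative_add_const bounded_linear_imp_has_derivative)
  from diff_chain_at[OF this D(1)]
  show "\<exists>D. ((\<lambda>z. f (c *s z + w)) has_derivative D) (at z) \<and> (\<forall>c v. D (c *s v) = c * D v)"
    using D(2) by (intro exI[of _ "\<lambda>v. D (c *s v)"])
      (auto simp: o_def vector_smult_assoc mult.commute)
qed

lemma holomorphic_nd_subset: "holomorphic_nd f S \<Longrightarrow> T \<subseteq> S \<Longrightarrow> holomorphic_nd f T"
  unfolding holomorphic_nd_def by blast

lemma holomorphic_nd_transform:
  assumes "holomorphic_nd f S" "open S" "\<And>z. z \<in> S \<Longrightarrow> f z = g z"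
  shows "holomorphic_nd g S"
  using assms has_derivative_transform_within_open[of f _ _ UNIV S g]
  unfolding holomorphic_nd_def by (metis UNIV_I)

lemma holomorphic_nd_continuous_on: "holomorphic_nd f S \<Longrightarrow> continuous_on S f"
  unfolding holomorphic_nd_def
  by (metis continuous_at_imp_continuous_on has_derivative_continuous)

lemma continuous_on_line [continuous_intros]:
  "continuous_on A f \<Longrightarrow> continuous_on A (\<lambda>l. p + f l *s (q::complex^'n))"
  unfolding vector_scalar_mult_def by (intro continuous_intros)

lemma holomorphic_on_line:
  fixes f :: "complex^'n \<Rightarrow> complex"
  assumes "holomorphic_nd f S" "\<And>l. l \<in> A \<Longrightarrow> p + l *s q \<in> S"
  shows "(\<lambda>l. f (p + l *s q)) holomorphic_on A"
  unfolding holomorphic_on_def field_differentiable_def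
proof
  fix l assume "l \<in> A"
  then obtain D where D: "(f has_derivative D) (at (p + l *s q))" "\<forall>c v. D (c *s v) = c * D v"
    using assms unfolding holomorphic_nd_def by meson
  have "bounded_linear (\<lambda>l::complex. l *s q)"
    by (rule linear_conv_bounded_linear[THEN iffD1])
      (simp add: linear_iff scaleR_vec_def vector_scalar_mult_def vec_eq_iff algebra_simps)
  then have "((\<lambda>l. p + l *s q) has_derivative (\<lambda>l. l *s q)) (at l within A)"
    using has_derivative_add[OF has_derivative_const bounded_linear_imp_has_derivative] by fastforce
  from diff_chain_within[OF this has_derivative_at_withinI[OF D(1)]]
  have "((\<lambda>l. f (p + l *s q)) has_field_derivative (D q)) (at l within A)"
    using D(2) by (simp add: o_def has_field_derivative_def mult.commute fun_eq_iff)
       (metis (no_types, lifting) ext mult.commute)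
  then show "\<exists>f'. ((\<lambda>l. f (p + l *s q)) has_field_derivative f') (at l within A)" by blast
qed

lemma convex_line_preimage:
  fixes S :: "(complex^'n) set"
  assumes "convex S" shows "convex {l. p + l *s q \<in> S}"
proof (rule convexI)
  fix x y u v assume h: "x \<in> {l. p + l *s q \<in> S}" "y \<in> {l. p + l *s q \<in> S}" "0 \<le> u" "0 \<le> v" "u + v = (1::real)"
  have "p $ i = of_real u * p $ i + of_real v * p $ i" for i
    using h(5) by (metis distrib_right mult_1 of_real_1 of_real_add)
  then have "p + (u *\<^sub>R x + v *\<^sub>R y) *s q = u *\<^sub>R (p + x *s q) + v *\<^sub>R (p + y *s q)"
    by (simp add: vec_eq_iff scaleR_conv_of_real[where 'a=complex] algebra_simps)
  with convexD[OF assms _ _ h(3-5), of "p + x *s q" "p + y *s q"] h(1,2)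
  show "u *\<^sub>R x + v *\<^sub>R y \<in> {l. p + l *s q \<in> S}" by simp
qed

lemma open_line_preimage:
  fixes S :: "(complex^'n) set"
  assumes "open S" shows "open {l. p + l *s q \<in> S}"
proof -
  have "continuous_on UNIV (\<lambda>l. p + l *s q)" by (intro continuous_intros)
  from open_vimage[OF assms this] show ?thesis by (simp add: vimage_def)
qed

text \<open>Every point of \<open>S\<close> is joined to a point of \<open>U\<close> by a complex
  line. Convexity of \<open>S\<close> makes the part of that line inside \<open>S\<close> connected,
  so the one-variable identity theorem applies on it.\<close>

lemma holomorphic_nd_identity:
  fixes f g :: "complex^'n \<Rightarrow> complex"
  assumes "holomorphic_nd f S" "holomorphic_nd g S" "open S" "convex S"
    and "open U" "U \<subseteq> S" "U \<noteq> {}" "\<And>z. z \<in> U \<Longrightarrow> f z = g z" "z \<in> S"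
  shows "f z = g z"
proof -
  obtain p where p: "p \<in> U" using assms by blast
  define q where "q = z - p"
  have "f (p + 1 *s q) = g (p + 1 *s q)"
  proof (rule analytic_continuation_open[of "{l. p + l *s q \<in> U}" "{l. p + l *s q \<in> S}"
        "\<lambda>l. f (p + l *s q)" "\<lambda>l. g (p + l *s q)" 1])
    show "{l. p + l *s q \<in> U} \<noteq> {}" using p by (auto intro!: exI[of _ 0])
    show "connected {l. p + l *s q \<in> S}"
      by (intro convex_connected convex_line_preimage assms)
    show "open {l. p + l *s q \<in> U}" "open {l. p + l *s q \<in> S}"
      by (intro open_line_preimage assms)+
    show "(\<lambda>l. f (p + l *s q)) holomorphic_on {l. p + l *s q \<in> S}"
      "(\<lambda>l. g (p + l *s q)) holomorphic_on {l. p + l *s q \<in> S}"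
      by (rule holomorphic_on_line[OF assms(1)], simp, rule holomorphic_on_line[OF assms(2)], simp)
    show "{l. p + l *s q \<in> U} \<subseteq> {l. p + l *s q \<in> S}" using assms by auto
    show "f (p + l *s q) = g (p + l *s q)" if "l \<in> {l. p + l *s q \<in> U}" for l
      using assms(8) that by blast
    show "1 \<in> {l. p + l *s q \<in> S}" using assms by (simp add: q_def)
  qed
  then show ?thesis by (simp add: q_def)
qed

section \<open>Continuation along shifts, and leading orders at the origin\<close>

lemma convex_Re_greater:
  fixes X :: "'r \<Rightarrow> complex^'n \<Rightarrow> complex"
  assumes add: "\<And>r z w. r \<in> R \<Longrightarrow> X r (z + w) = X r z + X r w"
    and scale: "\<And>r c z. r \<in> R \<Longrightarrow> X r (c *s z) = c * X r z"
  shows "convex {z. \<forall>r\<in>R. b r < Re (X r z)}"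
proof (rule convexI)
  fix x y u v assume h: "x \<in> {z. \<forall>r\<in>R. b r < Re (X r z)}" "y \<in> {z. \<forall>r\<in>R. b r < Re (X r z)}"
    "0 \<le> u" "0 \<le> v" "u + v = (1::real)"
  have sc: "c *\<^sub>R z = of_real c *s z" for c and z :: "complex^'n"
    by (simp add: vec_eq_iff scaleR_conv_of_real[where 'a=complex])
  have "b r < u * Re (X r x) + v * Re (X r y)" if "r \<in> R" for r
  proof -
    have "b r = u * b r + v * b r" using h(5) by (metis distrib_right mult_1)
    moreover have "b r < Re (X r x)" "b r < Re (X r y)" using h that by auto
    ultimately show ?thesis
      using h(3-5) by (smt (verit) mult_left_mono mult_less_cancel_left_pos)
  qed
  then show "u *\<^sub>R x + v *\<^sub>R y \<in> {z. \<forall>r\<in>R. b r < Re (X r z)}"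
    by (simp add: sc add scale)
qed

lemma open_Re_greater:
  fixes X :: "'r \<Rightarrow> complex^'n \<Rightarrow> complex"
  assumes "finite R" "\<And>r. r \<in> R \<Longrightarrow> holomorphic_nd (X r) UNIV"
  shows "open {z. \<forall>r\<in>R. b r < Re (X r z)}"
proof -
  have "{z. \<forall>r\<in>R. b r < Re (X r z)} = (\<Inter>r\<in>R. {z. b r < Re (X r z)})" by auto
  moreover have "open {z. b r < Re (X r z)}" if "r \<in> R" for r
    using holomorphic_nd_continuous_on[OF assms(2)[OF that]]
    by (intro open_Collect_less continuous_intros)
  ultimately show ?thesis using assms(1) by auto
qed

text \<open>The equation for \<open>r\<close> expresses \<open>f0\<close> at \<open>z\<close> by its
  values at points where \<open>X r\<close> is larger by at least one and no other form is smaller.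
  Used as a definition, it extends a function by one unit in the direction of \<open>r\<close>. Such
  steps exhaust the space, and convexity of all intermediate regions excludes monodromy.\<close>

lemma entire_continuation:
  fixes X :: "'r \<Rightarrow> complex^'n \<Rightarrow> complex" and f0 :: "complex^'n \<Rightarrow> complex"
    and q :: "'r \<Rightarrow> 'j \<Rightarrow> complex^'n \<Rightarrow> complex"
  assumes R: "finite R"
    and add: "\<And>r z w. r \<in> R \<Longrightarrow> X r (z + w) = X r z + X r w"
    and scale: "\<And>r c z. r \<in> R \<Longrightarrow> X r (c *s z) = c * X r z"
    and hX: "\<And>r. r \<in> R \<Longrightarrow> holomorphic_nd (X r) UNIV"
    and D0_def: "D0 = {z. \<forall>r\<in>R. 0 < Re (X r z)}" and D0: "D0 \<noteq> {}"
    and f0: "holomorphic_nd f0 D0"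
    and q: "\<And>r j. r \<in> R \<Longrightarrow> j \<in> J r \<Longrightarrow> holomorphic_nd (q r j) UNIV"
    and fe: "\<And>r z. r \<in> R \<Longrightarrow> z \<in> D0 \<Longrightarrow> f0 z = (\<Sum>j\<in>J r. q r j z * f0 (z + \<delta> j))"
    and nonneg: "\<And>r j r'. r \<in> R \<Longrightarrow> j \<in> J r \<Longrightarrow> r' \<in> R \<Longrightarrow> 0 \<le> Re (X r' (\<delta> j))"
    and ge1: "\<And>r j. r \<in> R \<Longrightarrow> j \<in> J r \<Longrightarrow> 1 \<le> Re (X r (\<delta> j))"
  shows "\<exists>f. holomorphic_nd f UNIV \<and> (\<forall>z\<in>D0. f z = f0 z)"
proof -
  \<comment> \<open>\<open>v r\<close> counts how many units the half-space of \<open>r\<close> has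
    been pushed back; the induction runs over the total count.\<close>
  define D where "D v = {z. \<forall>r\<in>R. - real (v r) < Re (X r z)}" for v :: "'r \<Rightarrow> nat"
  have openD: "open (D v)" and convexD: "convex (D v)" for v
    unfolding D_def using R hX add scale by (intro open_Re_greater convex_Re_greater, simp_all)+
  have D0_sub: "D0 \<subseteq> D v" for v
    by (force simp: D0_def D_def)
  have openD0: "open D0"
    unfolding D0_def using R hX by (intro open_Re_greater) auto
  have ex: "\<exists>f. holomorphic_nd f (D v) \<and> (\<forall>z\<in>D0. f z = f0 z)" for v
  proof (induction "\<Sum>r\<in>R. v r" arbitrary: v)
    case 0
    then have "D v = D0" using R by (auto simp: D_def D0_def)
    then show ?case using f0 by auto
  next
    case (Suc k)
    then obtain r where r: "r \<in> R" "v r \<noteq> 0" by (metis sum.neutral nat.distinct(1))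
    define v' where "v' = v(r := v r - 1)"
    have "(\<Sum>r\<in>R. v r) = v r + (\<Sum>r\<in>R - {r}. v r)" "(\<Sum>r\<in>R. v' r) = v' r + (\<Sum>r\<in>R - {r}. v' r)"
      using R r by (simp_all add: sum.remove)
    moreover have "(\<Sum>r\<in>R - {r}. v' r) = (\<Sum>r\<in>R - {r}. v r)"
      by (intro sum.cong) (auto simp: v'_def)
    ultimately have "k = (\<Sum>r\<in>R. v' r)" using Suc r by (auto simp: v'_def)
    from Suc(1)[OF this] obtain f where f: "holomorphic_nd f (D v')" "\<And>z. z \<in> D0 \<Longrightarrow> f z = f0 z"
      by auto
    have shift: "z + \<delta> j \<in> D v'" if "z \<in> D v" "j \<in> J r" for z j
      unfolding D_def
    proof clarify
      fix r' assume r': "r' \<in> R"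
      have "- real (v r') < Re (X r' z)" using that r' by (auto simp: D_def)
      then show "- real (v' r') < Re (X r' (z + \<delta> j))"
        unfolding add[OF r'] using nonneg[OF r(1) that(2) r'] ge1[OF r(1) that(2)] r
        by (cases "r' = r") (simp_all add: v'_def of_nat_diff)
    qed
    have shift0: "z + \<delta> j \<in> D0" if "z \<in> D0" "j \<in> J r" for z j
      unfolding D0_def
    proof clarify
      fix r' assume r': "r' \<in> R"
      have "0 < Re (X r' z)" using that r' by (auto simp: D0_def)
      then show "0 < Re (X r' (z + \<delta> j))"
        unfolding add[OF r'] using nonneg[OF r(1) that(2) r'] by simp
    qed
    define g where "g z = (\<Sum>j\<in>J r. q r j z * f (z + \<delta> j))" for z
    have "holomorphic_nd g (D v)"
      unfolding g_def
    proof (intro holomorphic_nd_sum holomorphic_nd_mult)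
      fix j assume j: "j \<in> J r"
      show "holomorphic_nd (q r j) (D v)" using q[OF r(1) j] holomorphic_nd_subset by blast
      show "holomorphic_nd (\<lambda>z. f (z + \<delta> j)) (D v)"
        using holomorphic_nd_affine[OF f(1), of "D v" 1 "\<delta> j"] shift j by simp
    qed
    moreover have "g z = f0 z" if "z \<in> D0" for z
      unfolding g_def fe[OF r(1) that] using f(2) shift0 that by (intro sum.cong) auto
    ultimately show ?case by blast
  qed
  define F where "F K = (SOME f. holomorphic_nd f (D (\<lambda>_. K)) \<and> (\<forall>z\<in>D0. f z = f0 z))" for K
  have F: "holomorphic_nd (F K) (D (\<lambda>_. K))" "z \<in> D0 \<Longrightarrow> F K z = f0 z" for K z
    using someI_ex[OF ex[of "\<lambda>_. K"], folded F_def] by blast+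
  have mono: "D (\<lambda>_. K) \<subseteq> D (\<lambda>_. L)" if "K \<le> L" for K L
    using that by (force simp: D_def)
  have agree: "F K z = F L z" if "K \<le> L" "z \<in> D (\<lambda>_. K)" for K L z
    by (rule holomorphic_nd_identity[OF F(1) holomorphic_nd_subset[OF F(1) mono[OF that(1)]]
          openD convexD openD0 D0_sub D0 _ that(2)]) (simp add: F(2))
  \<comment> \<open>Each point uses the first region that contains it. By \<open>agree\<close>, the
    resulting function coincides with \<open>F K\<close> on all of \<open>D (\<lambda>_. K)\<close>,
    so it is holomorphic there.\<close>
  define N where "N z = (LEAST K. z \<in> D (\<lambda>_. K))" for z
  have cover: "\<exists>K. z \<in> D (\<lambda>_. K)" for z
  proof -
    obtain K :: nat where K: "(\<Sum>r\<in>R. \<bar>Re (X r z)\<bar>) < real K" using reals_Archimedean2 by blast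
    have "\<bar>Re (X r z)\<bar> \<le> (\<Sum>r\<in>R. \<bar>Re (X r z)\<bar>)" if "r \<in> R" for r
      using R that by (intro member_le_sum) auto
    then show ?thesis using K by (intro exI[of _ K]) (force simp: D_def)
  qed
  have N: "z \<in> D (\<lambda>_. N z)" for z
    unfolding N_def by (rule LeastI_ex[OF cover])
  have N_le: "z \<in> D (\<lambda>_. K) \<Longrightarrow> N z \<le> K" for z K
    unfolding N_def by (rule Least_le)
  have eq: "F (N z) z = F K z" if "z \<in> D (\<lambda>_. K)" for z K
    by (rule agree[OF N_le[OF that] N])
  have "holomorphic_nd (\<lambda>z. F (N z) z) (D (\<lambda>_. K))" for K
    by (rule holomorphic_nd_transform[OF F(1) openD]) (simp add: eq)
  then have "holomorphic_nd (\<lambda>z. F (N z) z) UNIV"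
    using cover unfolding holomorphic_nd_def by meson
  then show ?thesis using F(2) by (intro exI[of _ "\<lambda>z. F (N z) z"]) auto
qed

text \<open>Cauchy's inequality on the circle of radius \<open>s / 2\<close> bounds the
  \<open>j\<close>-th term by \<open>C * t ^ j\<close> with \<open>t = 2 * norm a / s\<close>. Since
  \<open>t \<le> 1 / 2\<close>, the geometric tail is at most twice its first term.\<close>

lemma taylor_remainder_le:
  fixes g :: "complex \<Rightarrow> complex"
  assumes "g holomorphic_on ball 0 s" "\<And>a. a \<in> ball 0 s \<Longrightarrow> norm (g a) \<le> C"
    and "0 < s" "norm a \<le> s / 4"
  shows "norm (g a - (\<Sum>j\<le>k. (deriv ^^ j) g 0 / fact j * a ^ j)) \<le> 2 * C * (2 * norm a / s) ^ Suc k"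
proof -
  define c where "c j = (deriv ^^ j) g 0 / fact j" for j
  define t where "t = 2 * norm a / s"
  have C: "0 \<le> C" using assms(2)[of 0] assms(3) norm_ge_zero[of "g 0"] by (auto simp del: norm_ge_zero)
  have t: "0 \<le> t" "t \<le> 1/2" using assms by (auto simp: t_def field_simps)
  have cj: "norm (c j) \<le> C / (s/2) ^ j" for j
  proof -
    have "norm ((deriv ^^ j) g 0) \<le> fact j * C / (s/2) ^ j"
      by (rule Cauchy_inequality)
        (use assms in \<open>auto intro!: holomorphic_on_imp_continuous_on intro: holomorphic_on_subset\<close>)
    moreover have "norm (c j) = norm ((deriv ^^ j) g 0) / fact j"
      by (simp add: c_def norm_divide)
    ultimately have "norm (c j) \<le> (fact j * C / (s/2) ^ j) / fact j"
      by (simp only: divide_right_mono fact_ge_zero)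
    then show ?thesis by simp
  qed
  have le: "norm (c j * a ^ j) \<le> C * t ^ j" for j
  proof -
    have "norm (c j * a ^ j) \<le> C / (s/2) ^ j * norm a ^ j"
      unfolding norm_mult norm_power by (rule mult_right_mono[OF cj]) simp
    also have "\<dots> = C * t ^ j" by (simp add: t_def field_simps)
    finally show ?thesis .
  qed
  have "(\<lambda>j. c j * (a - 0) ^ j) sums g a"
    unfolding c_def by (rule holomorphic_power_series[OF assms(1)]) (use assms in auto)
  then have sums: "(\<lambda>j. c j * a ^ j) sums g a" by simp
  have "(\<lambda>j. c (j + Suc k) * a ^ (j + Suc k)) sums (g a - (\<Sum>j<Suc k. c j * a ^ j))"
    by (rule sums_split_initial_segment[OF sums])
  then have s2: "(\<lambda>j. c (j + Suc k) * a ^ (j + Suc k)) sums (g a - (\<Sum>j\<le>k. c j * a ^ j))"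
    by (simp only: lessThan_Suc_atMost)
  have geo: "(\<lambda>j. C * t ^ Suc k * t ^ j) sums (C * t ^ Suc k * (1 / (1 - t)))"
    using t by (intro sums_mult geometric_sums) auto
  have "norm (g a - (\<Sum>j\<le>k. c j * a ^ j)) \<le> C * t ^ Suc k * (1 / (1 - t))"
    unfolding sums_unique[OF s2] sums_unique[OF geo]
  proof (rule norm_suminf_le)
    show "norm (c (j + Suc k) * a ^ (j + Suc k)) \<le> C * t ^ Suc k * t ^ j" for j
      using le[of "j + Suc k"] by (simp add: power_add mult_ac)
  qed (use geo in \<open>auto simp: sums_iff\<close>)
  also have "\<dots> \<le> C * t ^ Suc k * 2"
    using t C by (intro mult_left_mono) (auto simp: field_simps)
  finally show ?thesis by (simp add: c_def t_def mult_ac)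
qed

text \<open>The \<open>k\<close>-th coefficient is the limit, as \<open>a\<close> tends to 0, of the
  remainder after \<open>k\<close> terms divided by \<open>a ^ k\<close>. By induction that quotient
  is holomorphic in \<open>l\<close>, and the convergence is uniform because \<open>C\<close> does
  not depend on \<open>l\<close>.\<close>

lemma holomorphic_taylor_coefficient:
  fixes F :: "complex \<Rightarrow> complex \<Rightarrow> complex"
  assumes "open A" "0 < s"
    and Fa: "\<And>l. l \<in> A \<Longrightarrow> (\<lambda>a. F a l) holomorphic_on ball 0 s"
    and Fl: "\<And>a. a \<in> ball 0 s \<Longrightarrow> F a holomorphic_on A"
    and C: "\<And>a l. a \<in> ball 0 s \<Longrightarrow> l \<in> A \<Longrightarrow> norm (F a l) \<le> C"
  shows "(\<lambda>l. (deriv ^^ k) (\<lambda>a. F a l) 0 / fact k) holomorphic_on A"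
proof (induction k rule: less_induct)
  case (less k)
  define c where "c j l = (deriv ^^ j) (\<lambda>a. F a l) 0 / fact j" for j l
  \<comment> \<open>The points \<open>s / 4 / Suc n\<close> tend to 0 and stay in the range
    \<open>norm a \<le> s / 4\<close> of \<open>taylor_remainder_le\<close>.\<close>
  define \<phi> where "\<phi> n l = (F (of_real (s / 4 / Suc n)) l - (\<Sum>j<k. c j l * of_real (s / 4 / Suc n) ^ j))
    / of_real (s / 4 / Suc n) ^ k" for n l
  have small: "complex_of_real (s / 4 / Suc n) \<in> ball 0 s" "norm (complex_of_real (s / 4 / Suc n)) \<le> s/4" for n
  proof -
    have e: "norm (complex_of_real (s / 4 / Suc n)) = s / 4 / Suc n"
      using assms(2) by (metis abs_of_pos norm_of_real of_nat_0_less_iff zero_less_Suc zero_less_divide_iff zero_less_numeral)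
    also have *: "s / 4 / Suc n \<le> s / 4 / 1"
      using assms(2) by (intro divide_left_mono) auto
    finally show "norm (complex_of_real (s / 4 / Suc n)) \<le> s/4" by simp
    then show "complex_of_real (s / 4 / Suc n) \<in> ball 0 s" using assms(2) by simp
  qed
  have bound: "norm (\<phi> n l - c k l) \<le> 2 * C * (2 / s) ^ Suc k * (s / 4 / Suc n)" if "l \<in> A" for n l
  proof -
    define a where "a = complex_of_real (s / 4 / Suc n)"
    have a0: "norm a = s / 4 / Suc n" "a \<noteq> 0"
      unfolding a_def norm_of_real of_real_eq_0_iff using assms(2) by simp_all
    have "norm (F a l - (\<Sum>j\<le>k. c j l * a ^ j)) \<le> 2 * C * (2 * norm a / s) ^ Suc k"
      unfolding c_def using assms that small(2)[of n] by (intro taylor_remainder_le) (auto simp: a_def)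
    moreover have "(\<Sum>j\<le>k. c j l * a ^ j) = (\<Sum>j<k. c j l * a ^ j) + c k l * a ^ k"
      unfolding lessThan_Suc_atMost[symmetric] sum.lessThan_Suc ..
    moreover have "\<phi> n l - c k l = (F a l - ((\<Sum>j<k. c j l * a ^ j) + c k l * a ^ k)) / a ^ k"
      unfolding \<phi>_def a_def[symmetric] using a0(2) by (simp add: field_simps)
    ultimately have "norm (\<phi> n l - c k l) \<le> 2 * C * (2 * norm a / s) ^ Suc k / norm a ^ k"
      by (simp only: norm_divide norm_power divide_right_mono zero_le_power norm_ge_zero)
    also have "\<dots> = 2 * C * (2 / s) ^ Suc k * norm a"
      using a0(2) by (simp add: power_divide power_mult_distrib field_simps)
    finally show ?thesis by (simp add: a0)
  qed
  have lim0: "(\<lambda>n. 2 * C * (2 / s) ^ Suc k * (s / 4 / Suc n)) \<longlonglongrightarrow> 0"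
    using tendsto_mult_right_zero[OF LIMSEQ_inverse_real_of_nat, of "2 * C * (2 / s) ^ Suc k * (s / 4)"]
    by (simp only: divide_inverse mult.assoc)
  have "c k holomorphic_on A"
  proof (rule holomorphic_uniform_sequence[OF assms(1), of \<phi>])
    have IH: "c j holomorphic_on A" if "j < k" for j
      using less[OF that] by (simp add: c_def[abs_def])
    have nz: "complex_of_real (s / 4 / Suc n) ^ k \<noteq> 0" for n
      using assms(2) by (intro power_not_zero, unfold of_real_eq_0_iff) simp
    show "\<phi> n holomorphic_on A" for n
      unfolding \<phi>_def
      by (intro holomorphic_on_divide holomorphic_on_diff Fl[OF small(1)] holomorphic_on_sum
          holomorphic_on_mult holomorphic_on_const IH nz) simp
    fix l assume "l \<in> A"
    then obtain d where d: "0 < d" "cball l d \<subseteq> A" using assms(1) open_contains_cball by blast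
    have "uniform_limit (cball l d) \<phi> (c k) sequentially"
    proof (rule uniform_limitI)
      fix e :: real assume "0 < e"
      from order_tendstoD(2)[OF lim0 this]
      show "\<forall>\<^sub>F n in sequentially. \<forall>l\<in>cball l d. dist (\<phi> n l) (c k l) < e"
      proof eventually_elim
        case (elim n)
        then show ?case using bound d(2) unfolding dist_norm by (meson le_less_trans subsetD)
      qed
    qed
    then show "\<exists>d>0. cball l d \<subseteq> A \<and> uniform_limit (cball l d) \<phi> (c k) sequentially"
      using d by blast
  qed
  then show ?case by (simp add: c_def[abs_def])
qed


lemma taylor_coefficients_limit:
  fixes g :: "complex \<Rightarrow> complex"
  assumes g: "g holomorphic_on ball 0 s" "\<And>a. a \<in> ball 0 s \<Longrightarrow> norm (g a) \<le> C" "0 < s"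
    and zero: "\<And>j. j < k \<Longrightarrow> (deriv ^^ j) g 0 = 0"
  shows "((\<lambda>a::real. g (of_real a) / of_real a ^ k) \<longlongrightarrow> (deriv ^^ k) g 0 / fact k) (at_right 0)"
proof (rule Lim_null_comparison[THEN LIM_zero_cancel])
  show "((\<lambda>a. 2 * C * (2 / s) ^ Suc k * a) \<longlongrightarrow> 0) (at_right 0)"
    by (intro tendsto_mult_right_zero tendsto_ident_at)
  have end2: "\<forall>\<^sub>F a in at_right (0::real). 0 < a \<and> a < s / 4"
    using eventually_at_right_real[of 0 "s / 4"] g(3) by simp
  show "\<forall>\<^sub>F a in at_right 0. norm (g (of_real a) / of_real a ^ k - (deriv ^^ k) g 0 / fact k)
      \<le> 2 * C * (2 / s) ^ Suc k * a"
    using end2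
  proof eventually_elim
    case (elim a)
    define b where "b = complex_of_real a"
    have b: "norm b = a" "b \<noteq> 0" using elim by (auto simp: b_def)
    have "(\<Sum>j\<le>k. (deriv ^^ j) g 0 / fact j * b ^ j) = (deriv ^^ k) g 0 / fact k * b ^ k"
      by (subst sum.remove[of _ k]) (auto simp: zero intro!: sum.neutral)
    then have "norm (g b - (deriv ^^ k) g 0 / fact k * b ^ k) \<le> 2 * C * (2 * a / s) ^ Suc k"
      using taylor_remainder_le[OF g, of b k] elim b by simp
    moreover have "g b / b ^ k - (deriv ^^ k) g 0 / fact k = (g b - (deriv ^^ k) g 0 / fact k * b ^ k) / b ^ k"
      using b by (simp add: field_simps)
    ultimately have "norm (g b / b ^ k - (deriv ^^ k) g 0 / fact k) \<le> 2 * C * (2 * a / s) ^ Suc k / a ^ k"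
      using elim by (simp only: b norm_divide norm_power divide_right_mono zero_le_power less_imp_le)
    also have "\<dots> = 2 * C * (2 / s) ^ Suc k * a"
      using elim by (simp add: power_divide power_mult_distrib field_simps)
    finally show ?case by (simp add: b_def)
  qed
qed

text \<open>A finite limit after division by \<open>a ^ k\<close> forces the limit 0 after division
  by a smaller power, and that limit is the next coefficient as soon as all earlier ones
  vanish.\<close>

lemma limit_taylor_coefficients:
  fixes g :: "complex \<Rightarrow> complex"
  assumes g: "g holomorphic_on ball 0 s" "\<And>a. a \<in> ball 0 s \<Longrightarrow> norm (g a) \<le> C" "0 < s"
    and lim: "((\<lambda>a::real. g (of_real a) / of_real a ^ k) \<longlongrightarrow> L) (at_right 0)"
  shows "j < k \<Longrightarrow> (deriv ^^ j) g 0 = 0" "(deriv ^^ k) g 0 / fact k = L"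
proof -
  show *: "(deriv ^^ j) g 0 = 0" if "j < k" for j
    using that
  proof (induction j rule: less_induct)
    case (less j)
    have 1: "((\<lambda>a::real. g (of_real a) / of_real a ^ j) \<longlongrightarrow> (deriv ^^ j) g 0 / fact j) (at_right 0)"
      by (rule taylor_coefficients_limit[OF g]) (use less in auto)
    have "((\<lambda>a::real. g (of_real a) / of_real a ^ k * of_real a ^ (k - j)) \<longlongrightarrow> L * of_real 0 ^ (k - j)) (at_right 0)"
      by (intro tendsto_intros lim)
    then have "((\<lambda>a::real. g (of_real a) / of_real a ^ k * of_real a ^ (k - j)) \<longlongrightarrow> 0) (at_right 0)"
      using less.prems by (simp add: power_0_left)
    moreover have "\<forall>\<^sub>F a in at_right (0::real). g (of_real a) / of_real a ^ k * of_real a ^ (k - j)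
        = g (of_real a) / of_real a ^ j"
      using eventually_at_right_less[of "0::real"]
    proof eventually_elim
      case (elim a)
      have "complex_of_real a ^ k = of_real a ^ j * of_real a ^ (k - j)"
        using less.prems by (simp add: power_add[symmetric])
      then show ?case using elim by simp
    qed
    ultimately have "((\<lambda>a::real. g (of_real a) / of_real a ^ j) \<longlongrightarrow> 0) (at_right 0)"
      by (rule Lim_transform_eventually)
    from tendsto_unique[OF _ 1 this] show ?case by simp
  qed
  from tendsto_unique[OF _ taylor_coefficients_limit[OF g *] lim]
  show "(deriv ^^ k) g 0 / fact k = L" by simp
qed

text \<open>The Taylor coefficients at \<open>a = 0\<close> of \<open>H (a (p + l q))\<close> depend holomorphically on \<open>l\<close>,
  so the identity theorem in \<open>l\<close> propagates the leading order of \<open>H\<close> at the origin.\<close>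

lemma leading_order_along_line:
  fixes H :: "complex^'n \<Rightarrow> complex"
  assumes H: "holomorphic_nd H (ball 0 \<rho>)" "0 < \<rho>"
    and Q: "Q holomorphic_on - Z" and Z: "finite Z" "0 \<notin> Z"
    and "0 < \<epsilon>"
    and lim: "\<And>l::real. \<bar>l\<bar> < \<epsilon> \<Longrightarrow> of_real l \<notin> Z \<Longrightarrow>
      ((\<lambda>a::real. H (of_real a *s (p + of_real l *s q)) / of_real a ^ d) \<longlongrightarrow> Q (of_real l)) (at_right 0)"
    and l: "l \<notin> Z"
  shows "((\<lambda>a::real. H (of_real a *s (p + l *s q)) / of_real a ^ d) \<longlongrightarrow> Q l) (at_right 0)"
proof -
  \<comment> \<open>The disc of radius \<open>r\<close> contains the target \<open>l\<close>,
    \<open>B\<close> bounds \<open>p + l *s q\<close> on it, and \<open>s\<close> keeps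
    \<open>a *s (p + l *s q)\<close> in the closed ball of radius \<open>\<rho> / 2\<close>, where
    \<open>H\<close> is bounded by compactness.\<close>
  define r where "r = norm l + 1"
  define A where "A = ball (0::complex) r - Z"
  define B where "B = 1 + norm p + r * norm q"
  define s where "s = \<rho> / (2 * B)"
  define F where "F a l = H (a *s (p + l *s q))" for a l
  have r: "0 < r" by (simp add: r_def add_nonneg_pos)
  have B: "0 < B" using r by (simp add: B_def add_pos_nonneg)
  have s: "0 < s" using H(2) B by (simp add: s_def)
  have norm_smult: "norm (c *s v) = norm c * norm v" for c and v :: "complex^'n"
    by (simp add: norm_vec_def L2_set_def norm_mult power_mult_distrib sum_distrib_left[symmetric] real_sqrt_mult)
  have mem: "a *s (p + l *s q) \<in> cball 0 (\<rho>/2)" if "a \<in> ball 0 s" "l \<in> ball 0 r" for a l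
  proof -
    have "norm (p + l *s q) \<le> norm p + norm l * norm q"
      by (metis norm_smult norm_triangle_ineq)
    also have "norm l * norm q \<le> r * norm q" using that by (intro mult_right_mono) auto
    finally have *: "norm (p + l *s q) \<le> B" by (simp add: B_def)
    have "norm (a *s (p + l *s q)) \<le> s * B"
      unfolding norm_smult using that * s by (intro mult_mono) auto
    then show ?thesis using B by (simp add: s_def)
  qed
  have sub: "cball 0 (\<rho>/2) \<subseteq> ball (0::complex^'n) \<rho>" using H(2) by auto
  have "compact (H ` cball 0 (\<rho>/2))"
    by (intro compact_continuous_image continuous_on_subset[OF holomorphic_nd_continuous_on[OF H(1)] sub]) auto
  then obtain C where C: "\<And>z. z \<in> cball 0 (\<rho>/2) \<Longrightarrow> norm (H z) \<le> C"
    by (meson bounded_iff compact_imp_bounded imageI)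
  have Fa: "(\<lambda>a. F a l) holomorphic_on ball 0 s" if "l \<in> ball 0 r" for l
    using holomorphic_on_line[OF H(1), of "ball 0 s" 0 "p + l *s q"] mem that sub by (force simp: F_def)
  have Fl: "F a holomorphic_on ball 0 r" if "a \<in> ball 0 s" for a
    using holomorphic_on_line[OF H(1), of "ball 0 r" "a *s p" "a *s q"] mem that sub
    by (force simp: F_def[abs_def] vector_add_ldistrib vector_smult_assoc mult.commute)
  have Fb: "norm (F a l) \<le> C" if "a \<in> ball 0 s" "l \<in> ball 0 r" for a l
    using C mem that by (simp add: F_def)
  define c where "c k l = (deriv ^^ k) (\<lambda>a. F a l) 0 / fact k" for k l
  have chol: "c k holomorphic_on A" for k
    unfolding c_def using holomorphic_taylor_coefficient[of "ball 0 r" s F C k] s Fa Fl Fb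
    by (auto simp: A_def intro: holomorphic_on_subset)
  have openA: "open A" using Z by (simp add: A_def finite_imp_closed open_Diff)
  have conA: "connected A"
    unfolding A_def by (rule connected_open_delete_finite) (auto simp: Z)
  have zeroA: "0 \<in> A" using r Z by (simp add: A_def)
  have lA: "l \<in> A" using l by (simp add: A_def r_def)
  obtain \<epsilon>' where e': "0 < \<epsilon>'" "ball 0 \<epsilon>' \<subseteq> A" using openA zeroA open_contains_ball by blast
  \<comment> \<open>Real parameters suffice for the identity theorem: they accumulate at 0, and the
    disc stays connected when the finite set \<open>Z\<close> is removed.\<close>
  define U where "U = complex_of_real ` {0<..<min \<epsilon> \<epsilon>'}"
  have UA: "U \<subseteq> A" using e' by (auto simp: U_def)
  have Ulim: "0 islimpt U"
    unfolding islimpt_approachable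
  proof clarify
    fix e :: real assume "0 < e"
    define x where "x = min e (min \<epsilon> \<epsilon>') / 2"
    have "0 < x" "x < e" "x < min \<epsilon> \<epsilon>'"
      using \<open>0 < e\<close> e'(1) \<open>0 < \<epsilon>\<close> by (auto simp: x_def min_def)
    then have "complex_of_real x \<in> U" "dist (complex_of_real x) 0 < e" "complex_of_real x \<noteq> 0"
      by (auto simp: U_def)
    then show "\<exists>x'\<in>U. x' \<noteq> 0 \<and> dist x' 0 < e" by blast
  qed
  have vals: "j < d \<Longrightarrow> c j u = 0" "c d u = Q u" if "u \<in> U" for u j
  proof -
    obtain l where l: "u = of_real l" "0 < l" "l < \<epsilon>" using \<open>u \<in> U\<close> by (auto simp: U_def)
    have uA: "u \<in> A" "u \<in> ball 0 r" "u \<notin> Z" using UA that by (auto simp: A_def)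
    have "((\<lambda>a::real. F (of_real a) u / of_real a ^ d) \<longlongrightarrow> Q u) (at_right 0)"
      unfolding F_def l(1) using lim[of l] l uA by auto
    from limit_taylor_coefficients[OF Fa[OF uA(2)] Fb[OF _ uA(2)] s this]
    show "j < d \<Longrightarrow> c j u = 0" "c d u = Q u" by (auto simp: c_def)
  qed
  have "c j l = 0" if "j < d" for j
    by (rule analytic_continuation[OF chol openA conA UA zeroA Ulim _ lA]) (use vals that in auto)
  moreover have "(\<lambda>l. c d l - Q l) l = 0"
    by (rule analytic_continuation[OF _ openA conA UA zeroA Ulim _ lA])
      (use vals chol Q in \<open>auto intro!: holomorphic_intros intro: holomorphic_on_subset simp: A_def\<close>)
  moreover have "l \<in> ball 0 r" by (simp add: r_def)
  ultimately show ?thesis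
    using taylor_coefficients_limit[OF Fa Fb s, of l d] by (simp add: c_def F_def)
qed

section \<open>Laplace transforms\<close>

lemma norm_exp_minus_linear_le:
  fixes u :: complex
  shows "norm (exp u - 1 - u) \<le> norm u ^ 2 * exp (norm u)"
proof -
  have "norm (exp u - (\<Sum>k\<le>1. u ^ k / fact k)) \<le> exp \<bar>Re u\<bar> * norm u ^ Suc 1 / fact 1"
    by (rule Taylor_exp)
  also have "\<dots> \<le> exp (norm u) * norm u ^ 2"
    using abs_Re_le_cmod[of u] by (auto intro!: mult_right_mono simp: power2_eq_square)
  finally show ?thesis by (simp add: mult.commute algebra_simps)
qed

text \<open>The error of the linear approximation has to be dominated by an integrable function. The
  sum \<open>G\<close> of the norms of the integrand at the corners of a cube around
  \<open>z\<close> serves: for each \<open>t\<close> one corner alone exceeds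
  \<open>norm (\<phi> z t)\<close> by the factor \<open>exp (2 * \<eta> * A t)\<close>, which
  absorbs the quadratic error of the exponential.\<close>

lemma holomorphic_nd_laplace:
  fixes L :: "'n::finite \<Rightarrow> 't \<Rightarrow> real"
  assumes L: "\<And>k. L k \<in> borel_measurable M" and D: "open D"
    and int: "\<And>z. z \<in> D \<Longrightarrow> integrable M (\<lambda>t. exp (\<Sum>k\<in>UNIV. z $ k * of_real (L k t)) :: complex)"
  shows "holomorphic_nd (\<lambda>z. \<integral>t. exp (\<Sum>k\<in>UNIV. z $ k * of_real (L k t)) \<partial>M) D"
proof (rule holomorphic_ndI)
  fix z assume z: "z \<in> D"
  define \<phi> where "\<phi> z t = (exp (\<Sum>k\<in>UNIV. z $ k * of_real (L k t)) :: complex)" for z :: "complex^'n" and t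
  define A where "A t = (\<Sum>k\<in>UNIV. \<bar>L k t\<bar>)" for t
  note [measurable] = L
  obtain r where r: "0 < r" "cball z r \<subseteq> D" using D z open_contains_cball by blast
  \<comment> \<open>Of the growth \<open>exp (2 * \<eta> * A t)\<close>, one half pays for
    displacements \<open>h\<close> shorter than \<open>\<eta>\<close>, the other for the factor
    \<open>A t ^ 2\<close>. The corners stay in \<open>cball z r\<close> because their displacement
    has norm at most \<open>CARD('n) * (2 * \<eta>)\<close>.\<close>
  define \<eta> where "\<eta> = r / (2 * CARD('n))"
  have eta: "0 < \<eta>" "real CARD('n) * (2 * \<eta>) = r" using r by (auto simp: \<eta>_def)
  define sign_ind where "sign_ind S = ((\<chi> k. complex_of_real (if k \<in> S then 2 * \<eta> else - (2 * \<eta>))) :: complex^'n)" for S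
  define G where "G t = (\<Sum>S\<in>UNIV. norm (\<phi> (z + sign_ind S) t))" for t
  have "z + sign_ind S \<in> D" for S
  proof -
    have "norm (sign_ind S) \<le> (\<Sum>k\<in>UNIV. norm (sign_ind S $ k))" unfolding norm_vec_def by (rule L2_set_le_sum) auto
    also have "\<dots> = real CARD('n) * (2 * \<eta>)" using eta(1) by (simp add: sign_ind_def if_distrib cong: if_cong)
    finally show ?thesis using r(2) eta(2) by (auto simp: dist_norm)
  qed
  then have Gint: "integrable M G"
    unfolding G_def \<phi>_def by (intro Bochner_Integration.integrable_sum integrable_norm int)
  have norm_phi: "norm (\<phi> w t) = exp (\<Sum>k\<in>UNIV. Re (w $ k) * L k t)" for w t
    by (simp add: \<phi>_def)
  have Gge: "norm (\<phi> z t) * exp (2 * \<eta> * A t) \<le> G t" for t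
  proof -
    \<comment> \<open>The corner that follows the signs of the \<open>L k t\<close> turns each of
      them into its absolute value.\<close>
    define S where "S = {k. 0 \<le> L k t}"
    have "norm (\<phi> (z + sign_ind S) t) = norm (\<phi> z t) * exp (2 * \<eta> * A t)"
      unfolding norm_phi exp_add[symmetric] A_def sum_distrib_left
      by (simp add: sum.distrib[symmetric] sign_ind_def S_def)
        (intro sum.cong refl, auto simp: algebra_simps)
    moreover have "norm (\<phi> (z + sign_ind S) t) \<le> G t"
      unfolding G_def by (rule member_le_sum) auto
    ultimately show ?thesis by simp
  qed
  have A0: "0 \<le> A t" for t by (simp add: A_def sum_nonneg)
  have Ale: "A t ^ 2 \<le> 2 / \<eta>^2 * exp (\<eta> * A t)" for t
  proof -
    have "(\<eta> * A t)^2 / 2 \<le> 1 + \<eta> * A t + (\<eta> * A t)^2 / 2" using A0[of t] eta by simp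
    also have "\<dots> \<le> exp (\<eta> * A t)" using A0[of t] eta by (intro exp_lower_Taylor_quadratic) auto
    finally show ?thesis using eta by (simp add: power_mult_distrib field_simps)
  qed
  have key: "norm (\<phi> z t) * (A t ^ 2 * exp (\<eta> * A t)) \<le> 2 / \<eta>^2 * G t" for t
  proof -
    have "A t ^ 2 * exp (\<eta> * A t) \<le> 2 / \<eta>^2 * exp (\<eta> * A t) * exp (\<eta> * A t)"
      by (intro mult_right_mono Ale) auto
    also have "\<dots> = 2 / \<eta>^2 * exp (2 * \<eta> * A t)" by (simp add: exp_add[symmetric] mult.assoc)
    finally have "norm (\<phi> z t) * (A t ^ 2 * exp (\<eta> * A t)) \<le> norm (\<phi> z t) * (2 / \<eta>^2 * exp (2 * \<eta> * A t))"
      by (intro mult_left_mono) auto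
    also have "\<dots> = 2 / \<eta>^2 * (norm (\<phi> z t) * exp (2 * \<eta> * A t))" by simp
    also have "\<dots> \<le> 2 / \<eta>^2 * G t" using Gge by (intro mult_left_mono) auto
    finally show ?thesis .
  qed
  have intL: "integrable M (\<lambda>t. \<phi> z t * of_real (L k t))" for k
  proof (rule Bochner_Integration.integrable_bound[OF integrable_mult_right[OF Gint, of "1 / (2 * \<eta>)"]])
    show "(\<lambda>t. \<phi> z t * of_real (L k t)) \<in> borel_measurable M" unfolding \<phi>_def by measurable
    show "AE t in M. norm (\<phi> z t * of_real (L k t)) \<le> norm (1 / (2 * \<eta>) * G t)"
    proof (rule AE_I2)
      fix t
      have "\<bar>L k t\<bar> \<le> A t" unfolding A_def by (rule member_le_sum) auto
      also have "2 * \<eta> * A t \<le> exp (2 * \<eta> * A t)" using exp_ge_add_one_self[of "2 * \<eta> * A t"] by linarith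
      then have "A t \<le> 1 / (2 * \<eta>) * exp (2 * \<eta> * A t)" using eta by (simp add: field_simps)
      finally have "norm (\<phi> z t) * \<bar>L k t\<bar> \<le> norm (\<phi> z t) * (1 / (2 * \<eta>) * exp (2 * \<eta> * A t))"
        by (intro mult_left_mono) auto
      also have "\<dots> = 1 / (2 * \<eta>) * (norm (\<phi> z t) * exp (2 * \<eta> * A t))" by simp
      also have "\<dots> \<le> 1 / (2 * \<eta>) * G t" using Gge eta by (intro mult_left_mono) auto
      also have "\<dots> \<le> norm (1 / (2 * \<eta>) * G t)" unfolding real_norm_def by (rule abs_ge_self)
      finally show "norm (\<phi> z t * of_real (L k t)) \<le> norm (1 / (2 * \<eta>) * G t)"
        by (simp add: norm_mult)
    qed
  qed
  define Df where "Df z v = (\<Sum>k\<in>UNIV. v $ k * (\<integral>t. \<phi> z t * of_real (L k t) \<partial>M))" for z and v :: "complex^'n"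
  have "bounded_linear (Df z)"
    unfolding Df_def
    by (intro bounded_linear_sum bounded_linear_mult_const bounded_linear_vec_nth)
  moreover have bd: "norm ((\<integral>t. \<phi> (z + h) t \<partial>M) - (\<integral>t. \<phi> z t \<partial>M) - Df z h)
      \<le> 2 / \<eta>^2 * (\<integral>t. G t \<partial>M) * norm h ^ 2" if h: "norm h < \<eta>" for h
  proof -
    have "1 \<le> real CARD('n)" by (simp add: Suc_leI)
    then have "\<eta> * 1 \<le> \<eta> * (real CARD('n) * 2)" using eta(1) by (intro mult_left_mono) linarith+
    then have "\<eta> \<le> r" using eta(2) by (simp add: mult_ac)
    then have zh: "z + h \<in> D" using r(2) h by (auto simp: dist_norm)
    define u where "u t = (\<Sum>k\<in>UNIV. h $ k * of_real (L k t))" for t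
    have phizh: "\<phi> (z + h) t = \<phi> z t * exp (u t)" for t
      by (simp add: \<phi>_def u_def exp_add[symmetric] sum.distrib[symmetric] algebra_simps)
    have ule: "norm (u t) \<le> norm h * A t" for t
    proof -
      have "norm (u t) \<le> (\<Sum>k\<in>UNIV. norm (h $ k * of_real (L k t)))" unfolding u_def by (rule norm_sum)
      also have "\<dots> \<le> (\<Sum>k\<in>UNIV. norm h * \<bar>L k t\<bar>)"
        by (intro sum_mono) (simp add: norm_mult mult_right_mono Finite_Cartesian_Product.norm_nth_le)
      finally show ?thesis by (simp add: A_def sum_distrib_left)
    qed
    have "Df z h = (\<integral>t. \<phi> z t * u t \<partial>M)"
      unfolding Df_def u_def sum_distrib_left
      using intL by (subst Bochner_Integration.integral_sum) (auto simp: mult_ac intro!: sum.cong integrable_mult_right)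
    moreover have intu: "integrable M (\<lambda>t. \<phi> z t * u t)"
      unfolding u_def sum_distrib_left using intL
      by (intro Bochner_Integration.integrable_sum) (auto simp: mult.left_commute)
    ultimately have "(\<integral>t. \<phi> (z + h) t \<partial>M) - (\<integral>t. \<phi> z t \<partial>M) - Df z h
        = (\<integral>t. \<phi> (z + h) t - \<phi> z t - \<phi> z t * u t \<partial>M)"
      using int[OF z] int[OF zh] by (simp add: \<phi>_def)
    also have "norm \<dots> \<le> (\<integral>t. 2 / \<eta>^2 * norm h ^ 2 * G t \<partial>M)"
    proof (rule order_trans[OF integral_norm_bound integral_mono])
      show "integrable M (\<lambda>t. norm (\<phi> (z + h) t - \<phi> z t - \<phi> z t * u t))"
        using int[OF z] int[OF zh] intu unfolding \<phi>_def by (intro integrable_norm Bochner_Integration.integrable_diff)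
      show "integrable M (\<lambda>t. 2 / \<eta>^2 * norm h ^ 2 * G t)" using Gint by simp
      fix t
      have "norm (\<phi> (z + h) t - \<phi> z t - \<phi> z t * u t) = norm (\<phi> z t) * norm (exp (u t) - 1 - u t)"
        unfolding phizh norm_mult[symmetric] by (simp add: algebra_simps)
      also have "\<dots> \<le> norm (\<phi> z t) * (norm (u t) ^ 2 * exp (norm (u t)))"
        by (intro mult_left_mono norm_exp_minus_linear_le) auto
      also have "\<dots> \<le> norm (\<phi> z t) * ((norm h * A t) ^ 2 * exp (\<eta> * A t))"
      proof (intro mult_left_mono mult_mono power_mono ule)
        have "norm (u t) \<le> \<eta> * A t" using ule[of t] mult_right_mono[OF less_imp_le[OF h] A0[of t]] by linarith
        then show "exp (norm (u t)) \<le> exp (\<eta> * A t)" by simp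
      qed auto
      also have "\<dots> = norm h ^ 2 * (norm (\<phi> z t) * (A t ^ 2 * exp (\<eta> * A t)))"
        by (simp add: power_mult_distrib)
      also have "\<dots> \<le> norm h ^ 2 * (2 / \<eta>^2 * G t)" by (intro mult_left_mono key) auto
      finally show "norm (\<phi> (z + h) t - \<phi> z t - \<phi> z t * u t) \<le> 2 / \<eta>^2 * norm h ^ 2 * G t"
        by (simp add: mult_ac)
    qed
    finally show ?thesis by (simp add: mult_ac)
  qed
  have "(\<lambda>h. norm ((\<integral>t. \<phi> (z + h) t \<partial>M) - (\<integral>t. \<phi> z t \<partial>M) - Df z h) / norm h) \<midarrow>0\<rightarrow> 0"
  proof (rule Lim_null_comparison)
    define K where "K = 2 / \<eta>^2 * (\<integral>t. G t \<partial>M)"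
    show "((\<lambda>h::complex^'n. K * norm h) \<longlongrightarrow> 0) (at 0)" by (auto intro!: tendsto_eq_intros)
    have "\<forall>\<^sub>F h in at (0::complex^'n). h \<in> ball 0 \<eta> \<and> h \<noteq> 0"
      using eta by (auto simp: eventually_at dist_norm intro!: exI[of _ \<eta>])
    then show "\<forall>\<^sub>F h in at 0. norm (norm ((\<integral>t. \<phi> (z + h) t \<partial>M) - (\<integral>t. \<phi> z t \<partial>M) - Df z h) / norm h) \<le> K * norm h"
    proof eventually_elim
      case (elim h)
      then show ?case using bd[of h] by (simp add: K_def field_simps power2_eq_square)
    qed
  qed
  ultimately show "((\<lambda>z. \<integral>t. exp (\<Sum>k\<in>UNIV. z $ k * of_real (L k t)) \<partial>M) has_derivative Df z) (at z)"
    unfolding \<phi>_def[symmetric] has_derivative_at by auto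
next
  show "(\<Sum>k\<in>UNIV. (c *s v) $ k * (\<integral>t. exp (\<Sum>k\<in>UNIV. z $ k * of_real (L k t)) * of_real (L k t) \<partial>M))
    = c * (\<Sum>k\<in>UNIV. v $ k * (\<integral>t. exp (\<Sum>k\<in>UNIV. z $ k * of_real (L k t)) * of_real (L k t) \<partial>M))" for c v and z :: "complex^'n"
    by (simp add: sum_distrib_left mult.assoc)
qed

section \<open>Logarithmic coordinates\<close>

lemma distr_PiM_componentwise:
  assumes I: "finite I" and M: "product_sigma_finite M" and N: "product_sigma_finite N"
    and f: "\<And>i. i \<in> I \<Longrightarrow> f i \<in> measurable (M i) (N i)"
    and distr: "\<And>i. i \<in> I \<Longrightarrow> distr (M i) (N i) (f i) = N i"
  shows "distr (PiM I M) (PiM I N) (\<lambda>t. \<lambda>i\<in>I. f i (t i)) = PiM I N"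
proof (rule product_sigma_finite.PiM_eqI[OF N I])
  have meas: "(\<lambda>t. \<lambda>i\<in>I. f i (t i)) \<in> measurable (PiM I M) (PiM I N)"
    using f by (intro measurable_restrict) (auto intro!: measurable_compose[OF measurable_component_singleton])
  fix A assume A: "\<And>i. i \<in> I \<Longrightarrow> A i \<in> sets (N i)"
  have "(\<lambda>t. \<lambda>i\<in>I. f i (t i)) -` Pi\<^sub>E I A \<inter> space (PiM I M) = Pi\<^sub>E I (\<lambda>i. f i -` A i \<inter> space (M i))"
    by (auto simp: space_PiM PiE_def Pi_def extensional_def)
  then have "emeasure (distr (PiM I M) (PiM I N) (\<lambda>t. \<lambda>i\<in>I. f i (t i))) (Pi\<^sub>E I A)
      = emeasure (PiM I M) (Pi\<^sub>E I (\<lambda>i. f i -` A i \<inter> space (M i)))"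
    using A I by (subst emeasure_distr[OF meas]) (auto intro!: sets_PiM_I_finite)
  also have "\<dots> = (\<Prod>i\<in>I. emeasure (M i) (f i -` A i \<inter> space (M i)))"
    using f A by (intro product_sigma_finite.emeasure_PiM[OF M I]) (auto intro: measurable_sets)
  also have "\<dots> = (\<Prod>i\<in>I. emeasure (distr (M i) (N i) (f i)) (A i))"
    using f A by (intro prod.cong) (auto simp: emeasure_distr)
  finally show "emeasure (distr (PiM I M) (PiM I N) (\<lambda>t. \<lambda>i\<in>I. f i (t i))) (Pi\<^sub>E I A)
      = (\<Prod>i\<in>I. emeasure (N i) (A i))"
    by (simp add: distr)
qed auto

lemma density_PiM:
  assumes I: "finite I" and M: "product_sigma_finite M"
    and N: "product_sigma_finite (\<lambda>i. density (M i) (g i))"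
    and g: "\<And>i. i \<in> I \<Longrightarrow> g i \<in> borel_measurable (M i)"
  shows "density (PiM I M) (\<lambda>t. \<Prod>i\<in>I. g i (t i)) = PiM I (\<lambda>i. density (M i) (g i))"
proof (rule product_sigma_finite.PiM_eqI[OF N I])
  have meas: "(\<lambda>t. \<Prod>i\<in>I. g i (t i)) \<in> borel_measurable (PiM I M)"
    using g by (intro borel_measurable_prod_ennreal) (auto intro!: measurable_compose[OF measurable_component_singleton])
  show "sets (density (PiM I M) (\<lambda>t. \<Prod>i\<in>I. g i (t i))) = sets (PiM I (\<lambda>i. density (M i) (g i)))"
    by (auto intro!: sets_PiM_cong)
  fix A assume A: "\<And>i. i \<in> I \<Longrightarrow> A i \<in> sets (density (M i) (g i))"
  have "emeasure (density (PiM I M) (\<lambda>t. \<Prod>i\<in>I. g i (t i))) (Pi\<^sub>E I A)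
      = (\<integral>\<^sup>+ t. (\<Prod>i\<in>I. g i (t i)) * indicator (Pi\<^sub>E I A) t \<partial>PiM I M)"
    using A I by (intro emeasure_density[OF meas]) (auto intro!: sets_PiM_I_finite)
  also have "\<dots> = (\<integral>\<^sup>+ t. (\<Prod>i\<in>I. g i (t i) * indicator (A i) (t i)) \<partial>PiM I M)"
  proof (intro nn_integral_cong)
    fix t assume "t \<in> space (PiM I M)"
    then have "t \<in> Pi\<^sub>E I A \<longleftrightarrow> (\<forall>i\<in>I. t i \<in> A i)" by (auto simp: space_PiM PiE_def Pi_def)
    moreover have "(\<Prod>i\<in>I. indicator (A i) (t i) :: ennreal) = (if \<forall>i\<in>I. t i \<in> A i then 1 else 0)"
      using I by (auto simp: indicator_def intro!: prod.neutral)
    ultimately show "(\<Prod>i\<in>I. g i (t i)) * indicator (Pi\<^sub>E I A) t = (\<Prod>i\<in>I. g i (t i) * indicator (A i) (t i))"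
      by (simp add: prod.distrib)
  qed
  also have "\<dots> = (\<Prod>i\<in>I. \<integral>\<^sup>+ x. g i x * indicator (A i) x \<partial>M i)"
    using g A by (intro product_sigma_finite.product_nn_integral_prod[OF M I]) auto
  also have "\<dots> = (\<Prod>i\<in>I. emeasure (density (M i) (g i)) (A i))"
    using g A by (intro prod.cong) (auto simp: emeasure_density)
  finally show "emeasure (density (PiM I M) (\<lambda>t. \<Prod>i\<in>I. g i (t i))) (Pi\<^sub>E I A)
    = (\<Prod>i\<in>I. emeasure (density (M i) (g i)) (A i))" .
qed

abbreviation lborelP :: "'i set \<Rightarrow> ('i \<Rightarrow> real) measure" where
  "lborelP I \<equiv> PiM I (\<lambda>_. lborel)"

lemma product_sigma_finite_lborel: "product_sigma_finite (\<lambda>_. lborel :: real measure)"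
  by (simp add: product_sigma_finite_def lborel.sigma_finite_measure_axioms)

lemma distr_lborelP_translate:
  assumes "finite I"
  shows "distr (lborelP I) (lborelP I) (\<lambda>t. \<lambda>i\<in>I. t i + c i) = lborelP I"
proof (rule distr_PiM_componentwise[OF assms product_sigma_finite_lborel product_sigma_finite_lborel])
  show "distr lborel lborel (\<lambda>x. x + c i) = (lborel :: real measure)" for i
  proof -
    have "distr lborel lborel (\<lambda>x. x + c i) = distr lborel borel ((+) (c i))"
      by (rule distr_cong) (auto simp: add.commute)
    then show ?thesis by (simp add: lborel_distr_plus)
  qed
qed auto

text \<open>Substitution on \<open>{- n..n}\<close>, whose image is
  \<open>{exp (- n)..exp n}\<close>, gives the identity with a cutoff; monotone convergence on both
  sides removes it.\<close>

lemma distr_lborel_exp: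
  "distr lborel borel exp = density lborel (\<lambda>w. ennreal (indicator {0<..} w / w))"
proof (rule measure_eqI)
  show "sets (distr lborel borel (exp :: real \<Rightarrow> real)) = sets (density lborel (\<lambda>w. ennreal (indicator {0<..} w / w)))"
    by simp
  fix A :: "real set" assume "A \<in> sets (distr lborel borel (exp :: real \<Rightarrow> real))"
  then have A [measurable]: "A \<in> sets borel" by simp
  define f where "f w = indicator A w * (indicator {0<..} w / w)" for w :: real
  have f0: "0 \<le> f w" for w by (simp add: f_def indicator_def)
  have fm [measurable]: "f \<in> borel_measurable borel" unfolding f_def by measurable
  have part: "(\<integral>\<^sup>+x. f x * indicator {exp (- real n)..exp (real n)} x \<partial>lborel)
      = (\<integral>\<^sup>+x. indicator A (exp x) * indicator {- real n..real n} x \<partial>lborel)" for n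
  proof -
    have "(\<integral>\<^sup>+x. f x * indicator {exp (- real n)..exp (real n)} x \<partial>lborel)
      = (\<integral>\<^sup>+x. f (exp x) * exp x * indicator {- real n..real n} x \<partial>lborel)"
    proof (rule nn_integral_substitution)
      show "set_borel_measurable borel {exp (- real n)..exp (real n)} f"
        unfolding set_borel_measurable_def by measurable
    qed (auto intro!: derivative_eq_intros continuous_intros)
    also have "\<dots> = (\<integral>\<^sup>+x. indicator A (exp x) * indicator {- real n..real n} x \<partial>lborel)"
      by (intro nn_integral_cong) (auto simp: f_def indicator_def)
    finally show ?thesis .
  qed
  have "emeasure (distr lborel borel exp) A = (\<integral>\<^sup>+x. indicator A (exp x) \<partial>lborel)"
  proof -
    have expm: "(exp :: real \<Rightarrow> real) \<in> measurable lborel borel" by measurable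
    have "exp -` A \<in> sets (lborel :: real measure)"
      using measurable_sets[OF expm A] by (simp only: space_lborel space_borel Int_UNIV_right)
    then have 1: "(\<integral>\<^sup>+x. indicator (exp -` A) x \<partial>lborel) = emeasure lborel (exp -` A)"
      by (rule nn_integral_indicator)
    have 2: "emeasure (distr lborel borel exp) A = emeasure lborel (exp -` A)"
      unfolding emeasure_distr[OF expm A] by (simp only: space_lborel space_borel Int_UNIV_right)
    show ?thesis
      unfolding 2 1[symmetric] by (intro nn_integral_cong) (simp add: indicator_def)
  qed
  also have "\<dots> = (\<integral>\<^sup>+x. (SUP n::nat. indicator A (exp x) * indicator {- real n..real n} x) \<partial>lborel)"
  proof (intro nn_integral_cong)
    fix x :: real
    obtain n :: nat where "\<bar>x\<bar> \<le> real n" using real_arch_simple by blast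
    then have "(indicator A (exp x) :: ennreal) = indicator A (exp x) * indicator {- real n..real n} x"
      by (auto simp: indicator_def)
    also have "\<dots> \<le> (SUP n::nat. indicator A (exp x) * indicator {- real n..real n} x)"
      by (rule SUP_upper[OF UNIV_I])
    finally have "(indicator A (exp x) :: ennreal) \<le> (SUP n::nat. indicator A (exp x) * indicator {- real n..real n} x)" .
    moreover have "(SUP n::nat. indicator A (exp x) * indicator {- real n..real n} x) \<le> (indicator A (exp x) :: ennreal)"
      by (intro SUP_least) (auto simp: indicator_def)
    ultimately show "(indicator A (exp x) :: ennreal) = (SUP n::nat. indicator A (exp x) * indicator {- real n..real n} x)"
      by (rule antisym)
  qed
  also have "\<dots> = (SUP n::nat. \<integral>\<^sup>+x. indicator A (exp x) * indicator {- real n..real n} x \<partial>lborel)"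
    by (rule nn_integral_monotone_convergence_SUP) (auto simp: incseq_def le_fun_def indicator_def)
  also have "\<dots> = (SUP n::nat. \<integral>\<^sup>+x. f x * indicator {exp (- real n)..exp (real n)} x \<partial>lborel)"
    by (simp only: part)
  also have "\<dots> = (\<integral>\<^sup>+x. (SUP n::nat. ennreal (f x * indicator {exp (- real n)..exp (real n)} x)) \<partial>lborel)"
  proof (rule nn_integral_monotone_convergence_SUP[symmetric])
    show "incseq (\<lambda>n x. ennreal (f x * indicator {exp (- real n)..exp (real n)} x))"
    proof (intro incseq_SucI le_funI ennreal_leI)
      fix n and x :: real
      have "exp (- real (Suc n)) \<le> exp (- real n)" "exp (real n) \<le> exp (real (Suc n))" by simp_all
      then have "x \<in> {exp (- real n)..exp (real n)} \<Longrightarrow> x \<in> {exp (- real (Suc n))..exp (real (Suc n))}"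
        unfolding atLeastAtMost_iff by linarith
      then show "f x * indicator {exp (- real n)..exp (real n)} x
          \<le> f x * indicator {exp (- real (Suc n))..exp (real (Suc n))} x"
        using f0[of x] by (auto simp: indicator_def)
    qed
  qed auto
  also have "\<dots> = (\<integral>\<^sup>+x. ennreal (indicator {0<..} x / x) * indicator A x \<partial>lborel)"
  proof (intro nn_integral_cong)
    fix x :: real
    have "(SUP n::nat. ennreal (f x * indicator {exp (- real n)..exp (real n)} x)) = ennreal (f x)"
    proof (rule antisym)
      show "(SUP n::nat. ennreal (f x * indicator {exp (- real n)..exp (real n)} x)) \<le> ennreal (f x)"
        using f0 by (intro SUP_least) (auto simp: indicator_def)
      show "ennreal (f x) \<le> (SUP n::nat. ennreal (f x * indicator {exp (- real n)..exp (real n)} x))"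
      proof (cases "0 < x")
        case True
        obtain n :: nat where "\<bar>ln x\<bar> \<le> real n" using real_arch_simple by blast
        then have "exp (- real n) \<le> exp (ln x)" "exp (ln x) \<le> exp (real n)" by auto
        then have "ennreal (f x) = ennreal (f x * indicator {exp (- real n)..exp (real n)} x)"
          using True by (simp add: indicator_def)
        also have "\<dots> \<le> (SUP n::nat. ennreal (f x * indicator {exp (- real n)..exp (real n)} x))"
          by (rule SUP_upper[OF UNIV_I])
        finally show ?thesis .
      qed (simp add: f_def)
    qed
    then show "(SUP n::nat. ennreal (f x * indicator {exp (- real n)..exp (real n)} x))
        = ennreal (indicator {0<..} x / x) * indicator A x"
      by (simp add: f_def indicator_def)
  qed
  also have "\<dots> = emeasure (density lborel (\<lambda>w. ennreal (indicator {0<..} w / w))) A"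
    by (subst emeasure_density) auto
  finally show "emeasure (distr lborel borel exp) A = emeasure (density lborel (\<lambda>w. ennreal (indicator {0<..} w / w))) A" .
qed

text \<open>The factors \<open>1 / w\<close> are the density of the image of Lebesgue measure under
  the exponential. Both sides are integrals of \<open>h\<close> against that one measure, so they
  agree also when \<open>h\<close> is not integrable.\<close>

lemma integral_lborelP_exp:
  fixes h :: "('i \<Rightarrow> real) \<Rightarrow> real"
  assumes I: "finite I" and h: "h \<in> borel_measurable (lborelP I)"
  shows "(\<integral>w. (\<Prod>i\<in>I. indicator {0<..} (w i) / w i) * h w \<partial>lborelP I)
    = (\<integral>t. h (\<lambda>i\<in>I. exp (t i)) \<partial>lborelP I)"
proof -
  define N where "N = density lborel (\<lambda>w::real. ennreal (indicator {0<..} w / w))"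
  have "sigma_finite_measure N"
    unfolding N_def by (subst sigma_finite_measure.sigma_finite_iff_density_finite'[OF sigma_finite_lborel]) auto
  then interpret N: product_sigma_finite "\<lambda>_. N" by (simp add: product_sigma_finite_def)
  have setsN: "sets N = sets borel" by (simp add: N_def)
  have dN: "density (lborelP I) (\<lambda>w. \<Prod>i\<in>I. ennreal (indicator {0<..} (w i) / w i)) = PiM I (\<lambda>_. N)"
    unfolding N_def
    by (rule density_PiM[OF I product_sigma_finite_lborel])
      (use N.product_sigma_finite_axioms in \<open>auto simp: N_def\<close>)
  have sets_eq: "sets (PiM I (\<lambda>_. N)) = sets (lborelP I)"
    by (intro sets_PiM_cong) (auto simp: N_def)
  have "distr (lborelP I) (PiM I (\<lambda>_. N)) (\<lambda>t. \<lambda>i\<in>I. exp (t i)) = PiM I (\<lambda>_. N)"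
  proof (rule distr_PiM_componentwise[OF I product_sigma_finite_lborel N.product_sigma_finite_axioms])
    show "distr lborel N exp = N"
      using distr_lborel_exp by (simp add: N_def cong: distr_cong)
  qed (simp add: N_def)
  moreover have "(\<lambda>t. \<lambda>i\<in>I. exp (t i)) \<in> measurable (lborelP I) (PiM I (\<lambda>_. N))"
    by (intro measurable_restrict) (auto simp: N_def intro!: measurable_compose[OF measurable_component_singleton])
  moreover have hN: "h \<in> borel_measurable (PiM I (\<lambda>_. N))"
    using h measurable_cong_sets[OF sets_eq refl] by blast
  ultimately have "(\<integral>t. h (\<lambda>i\<in>I. exp (t i)) \<partial>lborelP I) = (\<integral>w. h w \<partial>PiM I (\<lambda>_. N))"
    by (metis integral_distr)
  also have "PiM I (\<lambda>_. N) = density (lborelP I) (\<lambda>w. ennreal (\<Prod>i\<in>I. indicator {0<..} (w i) / w i))"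
    unfolding dN[symmetric] by (intro arg_cong[where f="density _"] ext) (subst prod_ennreal, auto simp: indicator_def)
  also have "(\<integral>w. h w \<partial>\<dots>) = (\<integral>w. (\<Prod>i\<in>I. indicator {0<..} (w i) / w i) *\<^sub>R h w \<partial>lborelP I)"
  proof (rule integral_density[OF h])
    show "(\<lambda>w. \<Prod>i\<in>I. indicator {0<..} (w i) / w i) \<in> borel_measurable (lborelP I)"
      by (intro borel_measurable_prod borel_measurable_divide)
        (auto intro!: measurable_compose[OF measurable_component_singleton])
    show "AE w in lborelP I. 0 \<le> (\<Prod>i\<in>I. indicator {0<..} (w i) / w i)"
      by (auto intro!: AE_I2 prod_nonneg simp: indicator_def)
  qed
  finally show ?thesis unfolding real_scaleR_def by (rule sym)
qed

section \<open>Euler integrals of monomials over powers of polynomials\<close>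

lemma norm_exp_minus_1_le:
  fixes u :: complex
  shows "norm (exp u - 1) \<le> norm u * exp (norm u)"
proof -
  have "norm (exp u - (\<Sum>k\<le>0. u ^ k / fact k)) \<le> exp \<bar>Re u\<bar> * norm u ^ Suc 0 / fact 0"
    by (rule Taylor_exp)
  also have "\<dots> \<le> exp (norm u) * norm u"
    using abs_Re_le_cmod[of u] by (auto intro!: mult_right_mono)
  finally show ?thesis by (simp add: mult.commute)
qed

text \<open>Polynomials are given by their supports: all coefficients are 1 and all monomials
  squarefree, so \<open>K \<in> Mon b\<close> is the set of variables of a monomial.\<close>

locale monomial_integral =
  fixes E :: "'e::finite set" and B :: "'b::finite set" and Mon :: "'b \<Rightarrow> 'e set set"
  assumes Mon_ne: "b \<in> B \<Longrightarrow> Mon b \<noteq> {}" and Mon_sub: "b \<in> B \<Longrightarrow> K \<in> Mon b \<Longrightarrow> K \<subseteq> E"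
begin

definition pol :: "'b \<Rightarrow> ('e \<Rightarrow> real) \<Rightarrow> real" where
  "pol b t = (\<Sum>K\<in>Mon b. exp (\<Sum>e\<in>K. t e))"

text \<open>The value 0 off \<open>E\<close> and \<open>B\<close> lets sums run over the whole index
  type while the dummy coordinates of the parameter vector drop out. The minus sign reflects that
  the polynomials occur with negative exponents.\<close>

definition L :: "'e + 'b \<Rightarrow> ('e \<Rightarrow> real) \<Rightarrow> real" where
  "L k t = (case k of Inl e \<Rightarrow> if e \<in> E then t e else 0 | Inr b \<Rightarrow> if b \<in> B then - ln (pol b t) else 0)"

definition phi :: "complex ^ ('e + 'b) \<Rightarrow> ('e \<Rightarrow> real) \<Rightarrow> complex" where
  "phi z t = exp (\<Sum>k\<in>UNIV. z $ k * of_real (L k t))"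

definition N :: "complex ^ ('e + 'b) \<Rightarrow> complex" where
  "N z = (\<integral>t. phi z t \<partial>lborelP E)"

text \<open>\<open>tpol b\<close> is the tropicalization of \<open>pol b\<close>, and \<open>trop\<close> that of the integrand, up to sign. As a
  function of the direction it also is the linear form attached to a ray.\<close>

definition tpol :: "'b \<Rightarrow> ('e \<Rightarrow> real) \<Rightarrow> real" where
  "tpol b t = Max ((\<lambda>K. \<Sum>e\<in>K. t e) ` Mon b)"

definition trop :: "('e + 'b \<Rightarrow> real) \<Rightarrow> ('e \<Rightarrow> real) \<Rightarrow> real" where
  "trop c t = (\<Sum>b\<in>B. c (Inr b) * tpol b t) - (\<Sum>e\<in>E. c (Inl e) * t e)"

definition X :: "('e \<Rightarrow> real) \<Rightarrow> complex ^ ('e + 'b) \<Rightarrow> complex" where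
  "X r z = (\<Sum>b\<in>B. z $ Inr b * of_real (tpol b r)) - (\<Sum>e\<in>E. z $ Inl e * of_real (r e))"

lemma sum_plus_UNIV: "(\<Sum>k\<in>(UNIV :: ('e + 'b) set). f k) = (\<Sum>e\<in>UNIV. f (Inl e)) + (\<Sum>b\<in>UNIV. f (Inr b))"
  unfolding UNIV_Plus_UNIV[symmetric] by (subst sum.Plus) simp_all

lemma sum_L:
  fixes c :: "'e + 'b \<Rightarrow> 'a::real_algebra_1"
  shows "(\<Sum>k\<in>UNIV. c k * of_real (L k t))
    = (\<Sum>e\<in>E. c (Inl e) * of_real (t e)) - (\<Sum>b\<in>B. c (Inr b) * of_real (ln (pol b t)))"
proof -
  have "(\<Sum>e\<in>UNIV. c (Inl e) * of_real (L (Inl e) t)) = (\<Sum>e\<in>E. c (Inl e) * of_real (t e))"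
    by (rule sum.mono_neutral_cong_right) (auto simp: L_def)
  moreover have "(\<Sum>b\<in>UNIV. c (Inr b) * of_real (L (Inr b) t)) = (\<Sum>b\<in>B. - (c (Inr b) * of_real (ln (pol b t))))"
    by (rule sum.mono_neutral_cong_right) (auto simp: L_def)
  ultimately show ?thesis by (simp add: sum_plus_UNIV sum_negf)
qed

lemma Re_X: "Re (X r z) = trop (\<lambda>k. Re (z $ k)) r"
  by (simp add: X_def trop_def)

lemma X_add: "X r (z + w) = X r z + X r w"
  by (simp add: X_def algebra_simps sum.distrib)

lemma X_scale: "X r (c *s z) = c * X r z"
  by (simp add: X_def algebra_simps sum_distrib_left)

lemma holomorphic_nd_X: "holomorphic_nd (X r) S"
  unfolding X_def by (intro holomorphic_nd_diff holomorphic_nd_sum holomorphic_nd_mult) auto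

lemma pol_pos: "b \<in> B \<Longrightarrow> 0 < pol b t"
  unfolding pol_def by (intro sum_pos Mon_ne) auto

lemma tpol_ge: "K \<in> Mon b \<Longrightarrow> (\<Sum>e\<in>K. t e) \<le> tpol b t"
  unfolding tpol_def by (intro Max_ge) auto

lemma tpol_attained: "b \<in> B \<Longrightarrow> \<exists>K\<in>Mon b. tpol b t = (\<Sum>e\<in>K. t e)"
  using Max_in[of "(\<lambda>K. \<Sum>e\<in>K. t e) ` Mon b"] Mon_ne unfolding tpol_def by fastforce

text \<open>A sum of \<open>card (Mon b)\<close> positive terms lies between its largest term, which
  is \<open>exp (tpol b t)\<close>, and that many copies of it.\<close>

lemma ln_pol_bounds:
  assumes "b \<in> B"
  shows "tpol b t \<le> ln (pol b t)" "ln (pol b t) \<le> tpol b t + ln (card (Mon b))"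
proof -
  have card: "0 < card (Mon b)" using Mon_ne[OF assms] by (simp add: card_gt_0_iff)
  obtain K where K: "K \<in> Mon b" "tpol b t = (\<Sum>e\<in>K. t e)" using tpol_attained[OF assms] by blast
  have "exp (tpol b t) \<le> pol b t"
    unfolding pol_def K(2) using K(1) by (intro member_le_sum) auto
  then show "tpol b t \<le> ln (pol b t)"
    using pol_pos[OF assms, of t] by (simp add: ln_ge_iff)
  have "pol b t \<le> (\<Sum>K\<in>Mon b. exp (tpol b t))"
    unfolding pol_def by (intro sum_mono) (simp add: tpol_ge)
  then have "ln (pol b t) \<le> ln (card (Mon b) * exp (tpol b t))"
    using pol_pos[OF assms, of t] by (subst ln_le_cancel_iff) (auto intro!: mult_pos_pos card)
  also have "\<dots> = tpol b t + ln (card (Mon b))" using card Mon_ne[OF assms] by (simp add: ln_mult)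
  finally show "ln (pol b t) \<le> tpol b t + ln (card (Mon b))" .
qed

text \<open>A bound, uniform in \<open>t\<close>, for the distance between the logarithm of the
  integrand and \<open>- trop\<close>. It scales linearly with \<open>c\<close>, so it disappears
  when the parameters are scaled to 0.\<close>

definition trop_err :: "('e + 'b \<Rightarrow> real) \<Rightarrow> real" where
  "trop_err c = (\<Sum>b\<in>B. \<bar>c (Inr b)\<bar> * ln (card (Mon b)))"

lemma sum_L_trop: "\<bar>(\<Sum>k\<in>UNIV. c k * L k t) + trop c t\<bar> \<le> trop_err c"
proof -
  have "(\<Sum>k\<in>UNIV. c k * L k t) + trop c t = (\<Sum>b\<in>B. c (Inr b) * (tpol b t - ln (pol b t)))"
    using sum_L[of c t] by (simp add: trop_def algebra_simps sum_subtractf)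
  also have "\<bar>\<dots>\<bar> \<le> (\<Sum>b\<in>B. \<bar>c (Inr b) * (tpol b t - ln (pol b t))\<bar>)" by (rule sum_abs)
  also have "\<dots> \<le> trop_err c"
    unfolding trop_err_def abs_mult
  proof (intro sum_mono mult_left_mono)
    fix b assume "b \<in> B"
    from ln_pol_bounds[OF this, of t] show "\<bar>tpol b t - ln (pol b t)\<bar> \<le> ln (card (Mon b))" by linarith
  qed auto
  finally show ?thesis .
qed

lemma norm_phi: "norm (phi z t) = exp (\<Sum>k\<in>UNIV. Re (z $ k) * L k t)"
  by (simp add: phi_def)

section \<open>Measurability\<close>

lemma sum_measurable_PiM [measurable]:
  assumes "K \<subseteq> E" shows "(\<lambda>t. \<Sum>e\<in>K. t e :: real) \<in> borel_measurable (lborelP E)"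
proof (rule borel_measurable_sum)
  fix e assume "e \<in> K"
  then show "(\<lambda>t. t e :: real) \<in> borel_measurable (lborelP E)"
    using measurable_component_singleton[of e E "\<lambda>_. lborel"] assms by auto
qed

lemma pol_measurable: "b \<in> B \<Longrightarrow> pol b \<in> borel_measurable (lborelP E)"
  unfolding pol_def[abs_def] using Mon_sub
  by (intro borel_measurable_sum measurable_compose[OF sum_measurable_PiM borel_measurable_exp]) auto

lemma tpol_measurable: "b \<in> B \<Longrightarrow> tpol b \<in> borel_measurable (lborelP E)"
  unfolding tpol_def[abs_def] using Mon_sub
  by (intro borel_measurable_Max sum_measurable_PiM) auto

lemma component_measurable: "e \<in> E \<Longrightarrow> (\<lambda>t. t e :: real) \<in> borel_measurable (lborelP E)"
  using sum_measurable_PiM[of "{e}"] by simp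

lemma trop_measurable: "trop c \<in> borel_measurable (lborelP E)"
  unfolding trop_def[abs_def]
  by (intro borel_measurable_diff borel_measurable_sum borel_measurable_times borel_measurable_const
      tpol_measurable component_measurable)

lemma L_measurable: "L k \<in> borel_measurable (lborelP E)"
proof (cases k)
  case (Inl e)
  then show ?thesis by (cases "e \<in> E") (simp_all add: L_def[abs_def] component_measurable)
next
  case (Inr b)
  then show ?thesis
    using measurable_compose[OF pol_measurable borel_measurable_ln[OF measurable_ident]]
    by (cases "b \<in> B") (simp_all add: L_def[abs_def] borel_measurable_ln pol_measurable)
qed

lemma phi_measurable: "phi z \<in> borel_measurable (lborelP E)"
proof -
  note [measurable] = L_measurable
  show ?thesis unfolding phi_def[abs_def] by measurable
qed

text \<open>Adding this vector to the parameters multiplies the integrand by the share of the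
  monomial \<open>K\<close> in \<open>pol b\<close>: the exponents of the variables in
  \<open>K\<close> go up by one, and so does that of \<open>1 / pol b\<close>.\<close>

definition mono_shift :: "'b \<times> 'e set \<Rightarrow> complex ^ ('e + 'b)" where
  "mono_shift j = (\<chi> k. case k of Inl e \<Rightarrow> if e \<in> snd j then 1 else 0 | Inr b \<Rightarrow> if b = fst j then 1 else 0)"

lemma phi_mono_shift:
  assumes "b \<in> B" "K \<in> Mon b"
  shows "phi (z + mono_shift (b, K)) t = phi z t * of_real (exp (\<Sum>e\<in>K. t e) / pol b t)"
proof -
  have "(\<Sum>k\<in>UNIV. mono_shift (b, K) $ k * of_real (L k t))
      = (\<Sum>e\<in>E. (if e \<in> K then 1 else 0) * complex_of_real (t e))
        - (\<Sum>b'\<in>B. (if b' = b then 1 else 0) * complex_of_real (ln (pol b' t)))"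
    unfolding sum_L by (simp add: mono_shift_def)
  also have "(\<Sum>b'\<in>B. (if b' = b then 1 else 0) * complex_of_real (ln (pol b' t))) = of_real (ln (pol b t))"
    using assms by (subst sum.remove[of _ b]) (auto intro!: sum.neutral)
  also have "(\<Sum>e\<in>E. (if e \<in> K then 1 else 0) * complex_of_real (t e)) = of_real (\<Sum>e\<in>K. t e)"
    using Mon_sub[OF assms] unfolding of_real_sum
    by (intro sum.mono_neutral_cong_right) auto
  finally have "exp (\<Sum>k\<in>UNIV. mono_shift (b, K) $ k * of_real (L k t))
      = complex_of_real (exp ((\<Sum>e\<in>K. t e) - ln (pol b t)))"
    by (simp flip: exp_of_real)
  also have "exp ((\<Sum>e\<in>K. t e) - ln (pol b t)) = exp (\<Sum>e\<in>K. t e) / pol b t"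
    using pol_pos[OF assms(1), of t] by (simp add: exp_diff)
  finally show ?thesis
    by (simp add: phi_def distrib_right sum.distrib exp_add)
qed

lemma X_mono_shift:
  assumes "b \<in> B" "K \<in> Mon b"
  shows "X r (mono_shift (b, K)) = of_real (tpol b r - (\<Sum>e\<in>K. r e))"
proof -
  have "(\<Sum>b'\<in>B. mono_shift (b, K) $ Inr b' * complex_of_real (tpol b' r)) = of_real (tpol b r)"
    using assms by (subst sum.remove[of _ b]) (auto simp: mono_shift_def intro!: sum.neutral)
  moreover have "(\<Sum>e\<in>E. mono_shift (b, K) $ Inl e * complex_of_real (r e)) = of_real (\<Sum>e\<in>K. r e)"
    using Mon_sub[OF assms] unfolding of_real_sum
    by (intro sum.mono_neutral_cong_right) (auto simp: mono_shift_def)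
  ultimately show ?thesis by (simp add: X_def)
qed

section \<open>Differentiation under translations of \<open>t\<close>\<close>

definition translate :: "('e \<Rightarrow> real) \<Rightarrow> real \<Rightarrow> ('e \<Rightarrow> real) \<Rightarrow> 'e \<Rightarrow> real" where
  "translate r s t = (\<lambda>e\<in>E. t e + s * r e)"

lemma sum_trans: "K \<subseteq> E \<Longrightarrow> (\<Sum>e\<in>K. translate r s t e) = (\<Sum>e\<in>K. t e) + s * (\<Sum>e\<in>K. r e)"
  by (auto simp: translate_def sum.distrib[symmetric] sum_distrib_left intro!: sum.cong)

lemma pol_trans: "b \<in> B \<Longrightarrow> pol b (translate r s t) = (\<Sum>K\<in>Mon b. exp ((\<Sum>e\<in>K. t e) + s * (\<Sum>e\<in>K. r e)))"
  unfolding pol_def using Mon_sub by (intro sum.cong) (auto simp: sum_trans)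

text \<open>Derivative of \<open>L k\<close> along \<open>r\<close>. For a polynomial it is minus
  the mean of the slopes \<open>\<Sum>e\<in>K. r e\<close>, weighted by the shares of the
  monomials.\<close>

definition dL :: "'e + 'b \<Rightarrow> ('e \<Rightarrow> real) \<Rightarrow> ('e \<Rightarrow> real) \<Rightarrow> real" where
  "dL k r t = (case k of Inl e \<Rightarrow> if e \<in> E then r e else 0
    | Inr b \<Rightarrow> if b \<in> B then - (\<Sum>K\<in>Mon b. (\<Sum>e\<in>K. r e) * (exp (\<Sum>e\<in>K. t e) / pol b t)) else 0)"

lemma L_trans_deriv: "((\<lambda>s. L k (translate r s t)) has_real_derivative dL k r t) (at 0)"
proof (cases k)
  case (Inl e)
  then show ?thesis by (auto simp: L_def dL_def translate_def intro!: derivative_eq_intros)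
next
  case (Inr b)
  show ?thesis
  proof (cases "b \<in> B")
    case True
    have p0: "(\<Sum>K\<in>Mon b. exp ((\<Sum>e\<in>K. t e) + 0 * (\<Sum>e\<in>K. r e))) = pol b t" by (simp add: pol_def)
    have "((\<lambda>s. - ln (\<Sum>K\<in>Mon b. exp ((\<Sum>e\<in>K. t e) + s * (\<Sum>e\<in>K. r e)))) has_real_derivative
       - (\<Sum>K\<in>Mon b. (\<Sum>e\<in>K. r e) * exp (\<Sum>e\<in>K. t e)) / pol b t) (at 0)"
      using pol_pos[OF True, of t] p0
      by (auto intro!: derivative_eq_intros sum.cong simp: mult.commute divide_inverse)
    then show ?thesis using True Inr
      by (simp add: L_def dL_def pol_trans sum_divide_distrib)
  qed (simp add: Inr L_def dL_def)
qed

text \<open>A translation changes every monomial by a factor between \<open>exp (- m)\<close> and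
  \<open>exp m\<close>, hence also their sum. That the bound is independent of \<open>t\<close> is
  what dominated convergence needs below.\<close>

lemma L_trans_le: "\<bar>L k (translate r s t) - L k t\<bar> \<le> \<bar>s\<bar> * (\<Sum>e\<in>E. \<bar>r e\<bar>)"
proof (cases k)
  case (Inl e)
  have "e \<in> E \<Longrightarrow> \<bar>r e\<bar> \<le> (\<Sum>e\<in>E. \<bar>r e\<bar>)" by (rule member_le_sum) auto
  then show ?thesis using Inl by (auto simp: L_def translate_def abs_mult sum_nonneg intro!: mult_left_mono)
next
  case (Inr b)
  show ?thesis
  proof (cases "b \<in> B")
    case True
    define m where "m = \<bar>s\<bar> * (\<Sum>e\<in>E. \<bar>r e\<bar>)"
    have le: "\<bar>s * (\<Sum>e\<in>K. r e)\<bar> \<le> m" if "K \<in> Mon b" for K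
    proof -
      have "\<bar>\<Sum>e\<in>K. r e\<bar> \<le> (\<Sum>e\<in>K. \<bar>r e\<bar>)" by (rule sum_abs)
      also have "\<dots> \<le> (\<Sum>e\<in>E. \<bar>r e\<bar>)" using Mon_sub[OF True that] by (intro sum_mono2) auto
      finally show ?thesis by (simp add: m_def abs_mult mult_left_mono)
    qed
    have "pol b (translate r s t) \<le> (\<Sum>K\<in>Mon b. exp m * exp (\<Sum>e\<in>K. t e))"
      unfolding pol_trans[OF True] exp_add[symmetric]
    proof (rule sum_mono)
      fix K assume "K \<in> Mon b" from le[OF this]
      show "exp ((\<Sum>e\<in>K. t e) + s * (\<Sum>e\<in>K. r e)) \<le> exp (m + (\<Sum>e\<in>K. t e))" by simp
    qed
    then have 1: "pol b (translate r s t) \<le> exp m * pol b t" by (simp add: pol_def sum_distrib_left)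
    have "(\<Sum>K\<in>Mon b. exp (- m) * exp (\<Sum>e\<in>K. t e)) \<le> pol b (translate r s t)"
      unfolding pol_trans[OF True] exp_add[symmetric]
    proof (rule sum_mono)
      fix K assume "K \<in> Mon b" from le[OF this]
      show "exp (- m + (\<Sum>e\<in>K. t e)) \<le> exp ((\<Sum>e\<in>K. t e) + s * (\<Sum>e\<in>K. r e))" by simp
    qed
    then have 2: "exp (- m) * pol b t \<le> pol b (translate r s t)" by (simp add: pol_def sum_distrib_left)
    have p: "0 < pol b t" "0 < pol b (translate r s t)" using True pol_pos by auto
    have "ln (pol b (translate r s t)) \<le> ln (exp m * pol b t)" using 1 p by simp
    moreover have "ln (exp (- m) * pol b t) \<le> ln (pol b (translate r s t))" using 2 p by simp
    ultimately have "\<bar>ln (pol b (translate r s t)) - ln (pol b t)\<bar> \<le> m" using p by (simp add: ln_mult)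
    then show ?thesis using True Inr by (simp add: L_def m_def abs_minus_commute)
  qed (simp add: Inr L_def sum_nonneg)
qed

text \<open>Lebesgue measure is translation invariant, so each difference quotient
  \<open>Q n\<close> of \<open>phi\<close> has integral zero. By \<open>L_trans_le\<close> the
  quotients are dominated by a multiple of \<open>norm (phi z t)\<close>, and the limit inherits
  integrability and the value 0.\<close>

lemma integral_derivative_zero:
  assumes int: "integrable (lborelP E) (phi z)"
  shows "integrable (lborelP E) (\<lambda>t. phi z t * (\<Sum>k\<in>UNIV. z $ k * of_real (dL k r t)))"
    and "(\<integral>t. phi z t * (\<Sum>k\<in>UNIV. z $ k * of_real (dL k r t)) \<partial>lborelP E) = 0"
proof -
  \<comment> \<open>A Lipschitz constant for the exponent of \<open>phi\<close> along
    \<open>r\<close>.\<close>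
  define \<rho> where "\<rho> = (\<Sum>k\<in>UNIV. norm (z $ k)) * (\<Sum>e\<in>E. \<bar>r e\<bar>)"
  define s where "s n = 1 / real (Suc n)" for n
  define u where "u n t = (\<Sum>k\<in>UNIV. z $ k * of_real (L k (translate r (s n) t) - L k t))" for n t
  define V where "V t = (\<Sum>k\<in>UNIV. z $ k * complex_of_real (dL k r t))" for t
  define Q where "Q n t = (phi z (translate r (s n) t) - phi z t) / of_real (s n)" for n t
  have s: "0 < s n" "s n \<le> 1" for n by (auto simp: s_def)
  have s0: "s \<longlonglongrightarrow> 0" unfolding s_def using LIMSEQ_inverse_real_of_nat by (simp add: divide_inverse)
  have rho: "0 \<le> \<rho>" by (simp add: \<rho>_def sum_nonneg)
  have phi_trans: "phi z (translate r (s n) t) = phi z t * exp (u n t)" for n t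
    by (simp add: phi_def u_def exp_add[symmetric] sum.distrib[symmetric] algebra_simps)
  have u_le: "norm (u n t) \<le> \<rho> * s n" for n t
  proof -
    have "norm (u n t) \<le> (\<Sum>k\<in>UNIV. norm (z $ k * complex_of_real (L k (translate r (s n) t) - L k t)))"
      unfolding u_def by (rule norm_sum)
    also have "\<dots> \<le> (\<Sum>k\<in>UNIV. norm (z $ k) * (s n * (\<Sum>e\<in>E. \<bar>r e\<bar>)))"
    proof (rule sum_mono)
      fix k
      show "norm (z $ k * complex_of_real (L k (translate r (s n) t) - L k t)) \<le> norm (z $ k) * (s n * (\<Sum>e\<in>E. \<bar>r e\<bar>))"
        unfolding norm_mult norm_of_real using L_trans_le[of k r "s n" t] s[of n]
        by (intro mult_left_mono) auto
    qed
    finally show ?thesis unfolding \<rho>_def sum_distrib_right[symmetric] by (simp add: mult_ac)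
  qed
  have s_lim: "filterlim s (at 0) sequentially"
    using s s0 by (intro filterlim_atI) (auto simp: less_imp_neq[symmetric])
  have u_lim: "(\<lambda>n. u n t / of_real (s n)) \<longlonglongrightarrow> V t" for t
  proof -
    have "(\<lambda>n. (L k (translate r (s n) t) - L k t) / s n) \<longlonglongrightarrow> dL k r t" for k
    proof -
      have t0: "L k (translate r 0 t) = L k t"
        using L_trans_le[of k r 0 t] by simp
      have "((\<lambda>h. (L k (translate r h t) - L k t) / h) \<longlongrightarrow> dL k r t) (at 0)"
        using L_trans_deriv[of k r t, unfolded DERIV_def] by (simp add: t0)
      from filterlim_compose[OF this s_lim] show ?thesis .
    qed
    then have "(\<lambda>n. \<Sum>k\<in>UNIV. z $ k * of_real ((L k (translate r (s n) t) - L k t) / s n)) \<longlonglongrightarrow> V t"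
      unfolding V_def by (intro tendsto_intros)
    then show ?thesis by (simp add: u_def sum_divide_distrib)
  qed
  have e_lim: "(\<lambda>n. (exp (u n t) - 1) / of_real (s n)) \<longlonglongrightarrow> V t" for t
  proof -
    have "(\<lambda>n. (exp (u n t) - 1 - u n t) / of_real (s n)) \<longlonglongrightarrow> 0"
    proof (rule Lim_null_comparison)
      show "(\<lambda>n. \<rho>^2 * exp \<rho> * s n) \<longlonglongrightarrow> 0" by (intro tendsto_mult_right_zero s0)
      show "\<forall>\<^sub>F n in sequentially. norm ((exp (u n t) - 1 - u n t) / of_real (s n)) \<le> \<rho>^2 * exp \<rho> * s n"
      proof (intro always_eventually allI)
        fix n
        have "norm (u n t) \<le> \<rho>" using u_le[of n t] mult_left_mono[OF s(2)[of n] rho] by simp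
        then have "norm (exp (u n t) - 1 - u n t) \<le> (\<rho> * s n)^2 * exp \<rho>"
          by (intro order_trans[OF norm_exp_minus_linear_le] mult_mono power_mono u_le) auto
        then show "norm ((exp (u n t) - 1 - u n t) / of_real (s n)) \<le> \<rho>^2 * exp \<rho> * s n"
          using s(1)[of n] by (simp add: norm_divide field_simps power2_eq_square)
      qed
    qed
    from tendsto_add[OF this u_lim[of t]] show ?thesis by (simp add: diff_divide_distrib)
  qed
  have Qlim: "(\<lambda>n. Q n t) \<longlonglongrightarrow> phi z t * V t" for t
  proof -
    have "Q n t = phi z t * ((exp (u n t) - 1) / of_real (s n))" for n
      by (simp add: Q_def phi_trans algebra_simps)
    then show ?thesis using tendsto_mult_left[OF e_lim] by presburger
  qed
  have Qle: "norm (Q n t) \<le> \<rho> * exp \<rho> * norm (phi z t)" for n t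
  proof -
    have "norm (u n t) \<le> \<rho>" using u_le[of n t] mult_left_mono[OF s(2)[of n] rho] by simp
    then have "norm (exp (u n t) - 1) \<le> (\<rho> * s n) * exp \<rho>"
      using rho s(1)[of n]
      by (intro order_trans[OF norm_exp_minus_1_le] mult_mono u_le) auto
    then have "norm (phi z t) * norm (exp (u n t) - 1) / s n \<le> norm (phi z t) * ((\<rho> * s n) * exp \<rho>) / s n"
      using s(1)[of n] by (intro divide_right_mono mult_left_mono) auto
    moreover have "norm (Q n t) = norm (phi z t) * norm (exp (u n t) - 1) / s n"
    proof -
      have "phi z (translate r (s n) t) - phi z t = phi z t * (exp (u n t) - 1)"
        by (simp add: phi_trans algebra_simps)
      then show ?thesis using s(1)[of n] by (simp add: Q_def norm_divide norm_mult)
    qed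
    ultimately show ?thesis using s(1)[of n] by (simp add: mult_ac)
  qed
  have trans_meas: "translate r c \<in> measurable (lborelP E) (lborelP E)" for c
    unfolding translate_def by (intro measurable_restrict) (auto intro!: component_measurable borel_measurable_add)
  have distr: "distr (lborelP E) (lborelP E) (translate r c) = lborelP E" for c
    unfolding translate_def by (rule distr_lborelP_translate) simp
  have int_trans: "integrable (lborelP E) (\<lambda>t. phi z (translate r c t))"
    and eq_trans: "(\<integral>t. phi z (translate r c t) \<partial>lborelP E) = (\<integral>t. phi z t \<partial>lborelP E)" for c
    using integrable_distr[OF trans_meas, where f="phi z"] integral_distr[OF trans_meas phi_measurable, of c z] int
    by (simp_all add: distr)
  have Qint: "(\<integral>t. Q n t \<partial>lborelP E) = 0" for n
    unfolding Q_def using int_trans int eq_trans by simp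
  have Qm: "Q n \<in> borel_measurable (lborelP E)" for n
    unfolding Q_def[abs_def] using measurable_compose[OF trans_meas phi_measurable] phi_measurable
    by (intro borel_measurable_divide borel_measurable_diff) auto
  have Vm: "(\<lambda>t. phi z t * V t) \<in> borel_measurable (lborelP E)"
    by (rule borel_measurable_LIMSEQ_metric[OF Qm]) (rule Qlim)
  have dom: "integrable (lborelP E) (\<lambda>t. \<rho> * exp \<rho> * norm (phi z t))"
    using int by (intro integrable_mult_right integrable_norm)
  have "integrable (lborelP E) (\<lambda>t. phi z t * V t)"
    by (rule integrable_dominated_convergence[OF Vm Qm dom]) (auto intro!: AE_I2 Qlim Qle)
  then show "integrable (lborelP E) (\<lambda>t. phi z t * (\<Sum>k\<in>UNIV. z $ k * of_real (dL k r t)))"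
    by (simp add: V_def)
  have "(\<lambda>n. \<integral>t. Q n t \<partial>lborelP E) \<longlonglongrightarrow> (\<integral>t. phi z t * V t \<partial>lborelP E)"
    by (rule integral_dominated_convergence[OF Vm Qm dom]) (auto intro!: AE_I2 Qlim Qle)
  then show "(\<integral>t. phi z t * (\<Sum>k\<in>UNIV. z $ k * of_real (dL k r t)) \<partial>lborelP E) = 0"
    by (simp add: Qint V_def LIMSEQ_const_iff)
qed

text \<open>The shares \<open>v (b, K)\<close> of the monomials of \<open>pol b\<close> add up to 1.
  Adding \<open>X r z\<close> to the derivative of the exponent therefore replaces each slope
  \<open>\<Sum>e\<in>K. r e\<close> by its distance to the maximal slope \<open>tpol b r\<close>,
  and each share is absorbed into a \<open>mono_shift\<close>. Monomials of maximal slope drop out;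
  the shifts by the others raise \<open>X r\<close>.\<close>

lemma functional_equation:
  assumes int: "integrable (lborelP E) (phi z)"
  shows "X r z * N z = (\<Sum>j\<in>Sigma B Mon.
     z $ Inr (fst j) * of_real (tpol (fst j) r - (\<Sum>e\<in>snd j. r e)) * N (z + mono_shift j))"
proof -
  define v where "v j t = exp (\<Sum>e\<in>snd j. t e) / pol (fst j) t" for j :: "'b \<times> 'e set" and t
  have v1: "(\<Sum>K\<in>Mon b. v (b, K) t) = 1" if "b \<in> B" for b t
    using pol_pos[OF that, of t] by (simp add: v_def sum_divide_distrib[symmetric] pol_def[symmetric])
  have vle: "0 \<le> v j t" "v j t \<le> 1" if "j \<in> Sigma B Mon" for j t
  proof -
    have b: "fst j \<in> B" "snd j \<in> Mon (fst j)" using that by auto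
    show "0 \<le> v j t" using pol_pos[OF b(1), of t] by (simp add: v_def)
    have "exp (\<Sum>e\<in>snd j. t e) \<le> pol (fst j) t"
      unfolding pol_def using b(2) by (intro member_le_sum) auto
    then show "v j t \<le> 1" using pol_pos[OF b(1), of t] by (simp add: v_def)
  qed
  have phis: "phi (z + mono_shift j) t = phi z t * of_real (v j t)" if "j \<in> Sigma B Mon" for j t
    using phi_mono_shift[of "fst j" "snd j" z t] that by (auto simp: v_def)
  have ints: "integrable (lborelP E) (phi (z + mono_shift j))" if "j \<in> Sigma B Mon" for j
  proof (rule Bochner_Integration.integrable_bound[OF int phi_measurable])
    show "AE t in lborelP E. norm (phi (z + mono_shift j) t) \<le> norm (phi z t)"
      using vle[OF that] by (auto intro!: AE_I2 mult_left_le simp: phis[OF that] norm_mult)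
  qed
  have ptw: "X r z * phi z t + phi z t * (\<Sum>k\<in>UNIV. z $ k * of_real (dL k r t))
     = (\<Sum>j\<in>Sigma B Mon. z $ Inr (fst j) * of_real (tpol (fst j) r - (\<Sum>e\<in>snd j. r e)) * phi (z + mono_shift j) t)" for t
  proof -
    have "(\<Sum>k\<in>UNIV. z $ k * of_real (dL k r t)) = (\<Sum>e\<in>E. z $ Inl e * of_real (r e))
      + (\<Sum>b\<in>B. z $ Inr b * of_real (- (\<Sum>K\<in>Mon b. (\<Sum>e\<in>K. r e) * v (b, K) t)))"
      unfolding sum_plus_UNIV
      by (intro arg_cong2[where f="(+)"] sum.mono_neutral_cong_right) (auto simp: dL_def v_def)
    then have "X r z + (\<Sum>k\<in>UNIV. z $ k * of_real (dL k r t))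
      = (\<Sum>b\<in>B. z $ Inr b * of_real (tpol b r - (\<Sum>K\<in>Mon b. (\<Sum>e\<in>K. r e) * v (b, K) t)))"
      by (simp add: X_def sum.distrib[symmetric] algebra_simps sum_subtractf)
    also have "\<dots> = (\<Sum>b\<in>B. z $ Inr b * of_real (\<Sum>K\<in>Mon b. (tpol b r - (\<Sum>e\<in>K. r e)) * v (b, K) t))"
    proof (intro sum.cong refl arg_cong2[where f="(*)"] arg_cong[where f=of_real])
      fix b assume "b \<in> B"
      show "tpol b r - (\<Sum>K\<in>Mon b. (\<Sum>e\<in>K. r e) * v (b, K) t) = (\<Sum>K\<in>Mon b. (tpol b r - (\<Sum>e\<in>K. r e)) * v (b, K) t)"
        using v1[OF \<open>b \<in> B\<close>, of t]
        by (simp add: left_diff_distrib sum_subtractf sum_distrib_left[symmetric])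
    qed
    also have "\<dots> = (\<Sum>j\<in>Sigma B Mon. z $ Inr (fst j) * of_real (tpol (fst j) r - (\<Sum>e\<in>snd j. r e)) * of_real (v j t))"
      by (simp add: of_real_sum sum_distrib_left sum.Sigma split_def mult.assoc)
    finally have *: "X r z + (\<Sum>k\<in>UNIV. z $ k * of_real (dL k r t)) = \<dots>" .
    have "X r z * phi z t + phi z t * (\<Sum>k\<in>UNIV. z $ k * of_real (dL k r t))
        = phi z t * (X r z + (\<Sum>k\<in>UNIV. z $ k * of_real (dL k r t)))"
      by (simp add: algebra_simps)
    then show ?thesis unfolding * sum_distrib_left by (simp add: phis mult_ac)
  qed
  have "X r z * N z = (\<integral>t. X r z * phi z t + phi z t * (\<Sum>k\<in>UNIV. z $ k * of_real (dL k r t)) \<partial>lborelP E)"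
    using integral_derivative_zero[OF int, of r] int by (simp add: N_def)
  also have "\<dots> = (\<Sum>j\<in>Sigma B Mon. z $ Inr (fst j) * of_real (tpol (fst j) r - (\<Sum>e\<in>snd j. r e)) * N (z + mono_shift j))"
    unfolding ptw N_def using ints
    by (subst Bochner_Integration.integral_sum) auto
  finally show ?thesis .
qed

end

section \<open>Meromorphic continuation\<close>

text \<open>Integral coordinates of the rays make all shifts of the forms integers, as the Gamma
  recurrence requires. \<open>convergent\<close> asks for positive values of \<open>trop c\<close>
  on the rays and puts no sign condition on single coefficients.\<close>

locale monomial_rays = monomial_integral E B Mon
  for E :: "'e::finite set" and B :: "'b::finite set" and Mon :: "'b \<Rightarrow> 'e set set" +
  fixes R :: "('e \<Rightarrow> real) set"
  assumes finite_R: "finite R" and Ints_R: "r \<in> R \<Longrightarrow> r e \<in> \<int>"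
    and convergent: "(\<And>r. r \<in> R \<Longrightarrow> 0 < trop c r) \<Longrightarrow> (\<integral>\<^sup>+t. ennreal (exp (- trop c t)) \<partial>lborelP E) < \<infinity>"
    and nonempty: "\<exists>c. \<forall>r\<in>R. 0 < trop c r"
begin

definition D0 :: "(complex ^ ('e + 'b)) set" where
  "D0 = {z. \<forall>r\<in>R. 0 < Re (X r z)}"

definition of_real_vec :: "('e + 'b \<Rightarrow> real) \<Rightarrow> complex ^ ('e + 'b)" where
  "of_real_vec c = (\<chi> k. complex_of_real (c k))"

definition V :: "('e + 'b \<Rightarrow> real) \<Rightarrow> real" where
  "V c = enn2real (\<integral>\<^sup>+t. ennreal (exp (- trop c t)) \<partial>lborelP E)"

lemma X_rv: "X r (of_real_vec c) = of_real (trop c r)"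
  by (simp add: X_def of_real_vec_def trop_def)

lemma rv_in_D0: "of_real_vec c \<in> D0 \<longleftrightarrow> (\<forall>r\<in>R. 0 < trop c r)"
  by (simp add: D0_def X_rv)

lemma open_D0: "open D0"
  unfolding D0_def by (intro open_Re_greater finite_R holomorphic_nd_X)

lemma trop_integrable:
  assumes "\<And>r. r \<in> R \<Longrightarrow> 0 < trop c r"
  shows "integrable (lborelP E) (\<lambda>t. exp (- trop c t))"
    and "(\<integral>t. exp (- trop c t) \<partial>lborelP E) = V c"
proof -
  have m: "(\<lambda>t. exp (- trop c t)) \<in> borel_measurable (lborelP E)"
    using trop_measurable[of c] by (intro measurable_compose[OF _ borel_measurable_exp] borel_measurable_uminus)
  show "integrable (lborelP E) (\<lambda>t. exp (- trop c t))"
    using convergent[OF assms] by (intro integrableI_bounded m) simp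
  show "(\<integral>t. exp (- trop c t) \<partial>lborelP E) = V c"
    unfolding V_def by (intro integral_eq_nn_integral m) auto
qed

lemma phi_integrable:
  assumes "z \<in> D0" shows "integrable (lborelP E) (phi z)"
proof -
  define c where "c k = Re (z $ k)" for k
  have "\<And>r. r \<in> R \<Longrightarrow> 0 < trop c r" using assms by (simp add: D0_def Re_X c_def[abs_def])
  from integrable_mult_right[OF trop_integrable(1)[OF this], of "exp (trop_err c)"]
  show ?thesis
  proof (rule Bochner_Integration.integrable_bound[OF _ phi_measurable])
    show "AE t in lborelP E. norm (phi z t) \<le> norm (exp (trop_err c) * exp (- trop c t))"
    proof (rule AE_I2)
      fix t
      show "norm (phi z t) \<le> norm (exp (trop_err c) * exp (- trop c t))"
        using sum_L_trop[of c t] by (simp add: norm_phi c_def[symmetric] exp_add[symmetric])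
    qed
  qed
qed

lemma holomorphic_nd_N: "holomorphic_nd N D0"
  using holomorphic_nd_laplace[of L "lborelP E" D0, OF L_measurable open_D0] phi_integrable
  unfolding N_def[abs_def] phi_def[abs_def] by blast

text \<open>The error of the tropical approximation is uniform in \<open>t\<close> and leaves the
  integral as a factor.\<close>

lemma N_rv_bounds:
  assumes "\<And>r. r \<in> R \<Longrightarrow> 0 < trop c r"
  shows "N (of_real_vec c) = of_real (Re (N (of_real_vec c)))"
    "exp (- trop_err c) * V c \<le> Re (N (of_real_vec c))" "Re (N (of_real_vec c)) \<le> exp (trop_err c) * V c"
proof -
  define f where "f t = exp (\<Sum>k\<in>UNIV. c k * L k t)" for t
  have phi: "phi (of_real_vec c) t = of_real (f t)" for t
    by (simp add: phi_def of_real_vec_def f_def flip: exp_of_real)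
  have int: "integrable (lborelP E) f"
    using phi_integrable[of "of_real_vec c"] assms by (simp add: rv_in_D0 phi[abs_def] complex_of_real_integrable_eq)
  have N: "N (of_real_vec c) = of_real (\<integral>t. f t \<partial>lborelP E)"
    unfolding N_def phi by simp
  show "N (of_real_vec c) = of_real (Re (N (of_real_vec c)))" by (simp add: N)
  have "(\<integral>t. exp (- trop_err c) * exp (- trop c t) \<partial>lborelP E) \<le> (\<integral>t. f t \<partial>lborelP E)"
  proof (rule integral_mono)
    show "exp (- trop_err c) * exp (- trop c t) \<le> f t" for t
      using sum_L_trop[of c t] by (simp add: f_def exp_add[symmetric])
  qed (use trop_integrable[OF assms] int in auto)
  then show "exp (- trop_err c) * V c \<le> Re (N (of_real_vec c))"
    using trop_integrable[OF assms] by (simp add: N)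
  have "(\<integral>t. f t \<partial>lborelP E) \<le> (\<integral>t. exp (trop_err c) * exp (- trop c t) \<partial>lborelP E)"
  proof (rule integral_mono)
    show "f t \<le> exp (trop_err c) * exp (- trop c t)" for t
      using sum_L_trop[of c t] by (simp add: f_def exp_add[symmetric])
  qed (use trop_integrable[OF assms] int in auto)
  then show "Re (N (of_real_vec c)) \<le> exp (trop_err c) * V c"
    using trop_integrable[OF assms] by (simp add: N)
qed

text \<open>The amount by which \<open>mono_shift j\<close> raises \<open>X r\<close> (see
  \<open>X_shift\<close>), taken as a natural number so that it can be the length of a Pochhammer
  product.\<close>

definition gap :: "('e \<Rightarrow> real) \<Rightarrow> 'b \<times> 'e set \<Rightarrow> nat" where
  "gap r j = nat \<lfloor>tpol (fst j) r - (\<Sum>e\<in>snd j. r e)\<rfloor>"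

lemma gap_eq:
  assumes "r \<in> R" "j \<in> Sigma B Mon"
  shows "tpol (fst j) r - (\<Sum>e\<in>snd j. r e) = real (gap r j)"
proof -
  obtain K where "tpol (fst j) r = (\<Sum>e\<in>K. r e)" using tpol_attained[of "fst j" r] assms(2) by auto
  then have "tpol (fst j) r - (\<Sum>e\<in>snd j. r e) \<in> \<int>" using Ints_R[OF assms(1)] by (auto intro!: Ints_diff Ints_sum)
  moreover have "0 \<le> tpol (fst j) r - (\<Sum>e\<in>snd j. r e)" using tpol_ge[of "snd j" "fst j" r] assms(2) by auto
  ultimately show ?thesis unfolding gap_def by (auto elim!: Ints_cases)
qed

lemma X_shift: "r \<in> R \<Longrightarrow> j \<in> Sigma B Mon \<Longrightarrow> X r (mono_shift j) = of_nat (gap r j)"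
  using X_mono_shift[of "fst j" "snd j" r] gap_eq[of r j] by (auto simp del: of_real_diff)

text \<open>Multiplying by reciprocal Gamma factors turns the functional equations into ones with
  polynomial coefficients, hence without poles.\<close>

lemma entire_quotient:
  "\<exists>F. holomorphic_nd F UNIV \<and> (\<forall>z\<in>D0. F z = N z * (\<Prod>r\<in>R. rGamma (X r z)))"
proof (rule entire_continuation[where X=X and R=R and J="\<lambda>r. {j \<in> Sigma B Mon. gap r j \<noteq> 0}"
      and \<delta>=mono_shift and q="\<lambda>r j z. z $ Inr (fst j) * of_nat (gap r j) *
        (\<Prod>i<gap r j - 1. X r z + 1 + of_nat i) * (\<Prod>r'\<in>R - {r}. \<Prod>i<gap r' j. X r' z + of_nat i)"])
  show "D0 = {z. \<forall>r\<in>R. 0 < Re (X r z)}" by (simp add: D0_def)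
  show "D0 \<noteq> {}" using nonempty rv_in_D0 by blast
  show "holomorphic_nd (\<lambda>z. N z * (\<Prod>r\<in>R. rGamma (X r z))) D0"
    by (intro holomorphic_nd_mult holomorphic_nd_N holomorphic_nd_prod
        holomorphic_nd_compose[OF holomorphic_nd_X holomorphic_rGamma[of UNIV]]) auto
  fix r z assume r: "r \<in> R" and z: "z \<in> D0"
  have X0: "X r z \<noteq> 0" using r z by (force simp: D0_def)
  define G where "G z = (\<Prod>r\<in>R. rGamma (X r z))" for z
  \<comment> \<open>Each Gamma factor changes by a Pochhammer product of length
    \<open>gap r' j\<close>. In the one for \<open>r\<close> the first factor \<open>X r z\<close>
    is split off, to cancel the left-hand side of the functional equation, and
    \<open>gap r j - 1\<close> factors remain. Terms with \<open>gap r j = 0\<close> may be left out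
    because their coefficient vanishes.\<close>
  have Gj: "G z = X r z * ((\<Prod>i<gap r j - 1. X r z + 1 + of_nat i) *
      (\<Prod>r'\<in>R - {r}. \<Prod>i<gap r' j. X r' z + of_nat i)) * G (z + mono_shift j)"
    if j: "j \<in> Sigma B Mon" "gap r j \<noteq> 0" for j
  proof -
    have "G z = (\<Prod>r'\<in>R. pochhammer (X r' z) (gap r' j) * rGamma (X r' (z + mono_shift j)))"
      unfolding G_def by (intro prod.cong refl) (simp add: X_add X_shift j flip: pochhammer_rGamma)
    also have "\<dots> = (\<Prod>r'\<in>R. pochhammer (X r' z) (gap r' j)) * G (z + mono_shift j)"
      by (simp add: prod.distrib G_def)
    also have "(\<Prod>r'\<in>R. pochhammer (X r' z) (gap r' j))
      = pochhammer (X r z) (gap r j) * (\<Prod>r'\<in>R - {r}. pochhammer (X r' z) (gap r' j))"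
      using finite_R r by (rule prod.remove)
    also have "pochhammer (X r z) (gap r j) = X r z * pochhammer (X r z + 1) (gap r j - 1)"
      using j(2) by (cases "gap r j") (simp_all add: pochhammer_rec)
    finally show ?thesis by (simp add: pochhammer_prod mult_ac atLeast0LessThan)
  qed
  have "X r z * (N z * G z) = (\<Sum>j\<in>Sigma B Mon. z $ Inr (fst j) * of_nat (gap r j) * N (z + mono_shift j)) * G z"
    using functional_equation[OF phi_integrable[OF z], of r] gap_eq[OF r] by (simp add: mult.assoc[symmetric] cong: sum.cong)
  also have "\<dots> = (\<Sum>j\<in>{j \<in> Sigma B Mon. gap r j \<noteq> 0}. z $ Inr (fst j) * of_nat (gap r j) * N (z + mono_shift j) * G z)"
    unfolding sum_distrib_right by (rule sum.mono_neutral_right) auto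
  also have "\<dots> = (\<Sum>j\<in>{j \<in> Sigma B Mon. gap r j \<noteq> 0}. X r z * (z $ Inr (fst j) * of_nat (gap r j) *
        (\<Prod>i<gap r j - 1. X r z + 1 + of_nat i) * (\<Prod>r'\<in>R - {r}. \<Prod>i<gap r' j. X r' z + of_nat i) *
        (N (z + mono_shift j) * G (z + mono_shift j))))"
  proof (intro sum.cong refl)
    fix j assume "j \<in> {j \<in> Sigma B Mon. gap r j \<noteq> 0}"
    then have j: "j \<in> Sigma B Mon" "gap r j \<noteq> 0" by auto
    show "z $ Inr (fst j) * of_nat (gap r j) * N (z + mono_shift j) * G z =
      X r z * (z $ Inr (fst j) * of_nat (gap r j) *
        (\<Prod>i<gap r j - 1. X r z + 1 + of_nat i) * (\<Prod>r'\<in>R - {r}. \<Prod>i<gap r' j. X r' z + of_nat i) *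
        (N (z + mono_shift j) * G (z + mono_shift j)))"
      unfolding Gj[OF j] by (simp only: mult_ac)
  qed
  finally show "N z * (\<Prod>r\<in>R. rGamma (X r z)) = (\<Sum>j\<in>{j \<in> Sigma B Mon. gap r j \<noteq> 0}. z $ Inr (fst j) * of_nat (gap r j) *
        (\<Prod>i<gap r j - 1. X r z + 1 + of_nat i) * (\<Prod>r'\<in>R - {r}. \<Prod>i<gap r' j. X r' z + of_nat i) *
        (N (z + mono_shift j) * (\<Prod>r\<in>R. rGamma (X r (z + mono_shift j)))))"
    unfolding sum_distrib_left[symmetric] using X0 by (simp add: G_def)
qed (auto simp: finite_R X_add X_scale X_shift holomorphic_nd_X
    intro!: holomorphic_nd_mult holomorphic_nd_prod holomorphic_nd_add)

definition Ent :: "complex ^ ('e + 'b) \<Rightarrow> complex" where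
  "Ent = (SOME F. holomorphic_nd F UNIV \<and> (\<forall>z\<in>D0. F z = N z * (\<Prod>r\<in>R. rGamma (X r z))))"

lemma Ent: "holomorphic_nd Ent UNIV" "z \<in> D0 \<Longrightarrow> Ent z = N z * (\<Prod>r\<in>R. rGamma (X r z))"
  using someI_ex[OF entire_quotient, folded Ent_def] by blast+

text \<open>Division by zero gives 0 where the denominator vanishes; \<open>meromorphic_nd\<close>
  leaves the values there free.\<close>

definition Nc :: "complex ^ ('e + 'b) \<Rightarrow> complex" where
  "Nc z = Ent z / (\<Prod>r\<in>R. rGamma (X r z))"

lemma rGamma_nonzero_D0:
  assumes "z \<in> D0" shows "(\<Prod>r\<in>R. rGamma (X r z)) \<noteq> 0"
proof -
  have "X r z \<notin> \<int>\<^sub>\<le>\<^sub>0" if "r \<in> R" for r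
    using assms that by (auto simp: D0_def elim!: nonpos_Ints_cases)
  then show ?thesis using finite_R by (simp add: rGamma_eq_zero_iff)
qed

lemma Nc_eq_N: "z \<in> D0 \<Longrightarrow> Nc z = N z"
  using rGamma_nonzero_D0 by (simp add: Nc_def Ent)

lemma holomorphic_nd_scaled_parts:
  "holomorphic_nd (\<lambda>z. c * Ent (a *s z)) UNIV" "holomorphic_nd (\<lambda>z. \<Prod>r\<in>R. rGamma (X r (a *s z))) UNIV"
proof -
  show "holomorphic_nd (\<lambda>z. c * Ent (a *s z)) UNIV"
    using holomorphic_nd_affine[OF Ent(1), of UNIV a 0] by (intro holomorphic_nd_mult) auto
  show "holomorphic_nd (\<lambda>z. \<Prod>r\<in>R. rGamma (X r (a *s z))) UNIV"
    unfolding X_scale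
    by (intro holomorphic_nd_prod holomorphic_nd_compose[OF _ holomorphic_rGamma[of UNIV]]
        holomorphic_nd_mult holomorphic_nd_X) auto
qed

lemma meromorphic_nd_Nc:
  assumes "a \<noteq> 0" shows "meromorphic_nd (\<lambda>z. c * Nc (a *s z))"
proof -
  obtain c0 where "of_real_vec c0 \<in> D0" using nonempty rv_in_D0 by blast
  then have "(\<Prod>r\<in>R. rGamma (X r (a *s ((1 / a) *s of_real_vec c0)))) \<noteq> 0"
    using rGamma_nonzero_D0 assms by (simp add: vector_smult_assoc)
  then have nz: "\<exists>z\<in>UNIV. (\<Prod>r\<in>R. rGamma (X r (a *s z))) \<noteq> 0" by blast
  show ?thesis
    unfolding meromorphic_nd_def
  proof (intro allI exI conjI)
    show "\<forall>z\<in>UNIV. (\<Prod>r\<in>R. rGamma (X r (a *s z))) \<noteq> 0 \<longrightarrow>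
      c * Nc (a *s z) = (c * Ent (a *s z)) / (\<Prod>r\<in>R. rGamma (X r (a *s z)))"
      by (simp add: Nc_def)
  qed (use nz holomorphic_nd_scaled_parts in auto)
qed

text \<open>The denominator vanishes only where some \<open>a * X r p\<close> is an integer
  \<open>\<le> 0\<close>. For small \<open>a > 0\<close> its modulus is below 1, and the hypothesis
  excludes 0 itself.\<close>

lemma regular_at_Nc:
  assumes "\<And>r. r \<in> R \<Longrightarrow> X r p \<noteq> 0"
  shows "\<forall>\<^sub>F a in at_right (0::real). regular_at (\<lambda>z. c a * Nc (of_real a *s z)) p"
proof -
  have "\<forall>\<^sub>F a in at_right (0::real). norm (of_real a * X r p) < 1" for r
  proof (rule order_tendstoD)
    show "((\<lambda>a::real. norm (of_real a * X r p)) \<longlongrightarrow> norm (of_real 0 * X r p)) (at_right 0)"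
      by (intro tendsto_intros)
  qed simp
  then have "\<forall>\<^sub>F a in at_right (0::real). \<forall>r\<in>R. norm (of_real a * X r p) < 1"
    using finite_R by (simp add: eventually_ball_finite)
  then show ?thesis using eventually_at_right_less[of "0::real"]
  proof eventually_elim
    case (elim a)
    define h where "h z = (\<Prod>r\<in>R. rGamma (X r (complex_of_real a *s z)))" for z
    have h: "holomorphic_nd h UNIV" unfolding h_def by (rule holomorphic_nd_scaled_parts)
    have "of_real a * X r p \<notin> \<int>\<^sub>\<le>\<^sub>0" if r: "r \<in> R" for r
    proof
      assume "of_real a * X r p \<in> \<int>\<^sub>\<le>\<^sub>0"
      then obtain n :: int where n: "of_real a * X r p = of_int n" by (auto elim!: nonpos_Ints_cases)
      have "norm (of_real a * X r p) < 1" using elim r by auto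
      then have "n = 0" unfolding n by simp
      then show False using n assms[OF r] elim by simp
    qed
    then have "h p \<noteq> 0" using finite_R by (simp add: h_def X_scale rGamma_eq_zero_iff)
    moreover have "open {z. h z \<noteq> 0}"
      using holomorphic_nd_continuous_on[OF h] by (intro open_Collect_neq continuous_intros)
    moreover have "holomorphic_nd (\<lambda>z. c a * Nc (of_real a *s z)) {z. h z \<noteq> 0}"
      using holomorphic_nd_divide[OF holomorphic_nd_subset[OF holomorphic_nd_scaled_parts(1)]
          holomorphic_nd_subset[OF h], of "{z. h z \<noteq> 0}" "c a" "of_real a"]
      by (simp add: Nc_def h_def)
    ultimately show ?case unfolding regular_at_def by blast
  qed
qed

text \<open>Among the polar hyperplanes of the Gamma factors only those with
  \<open>X r z = 0\<close> pass through the origin; \<open>rGamma w = w * rGamma (w + 1)\<close>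
  splits them off, and the denominator that is left equals 1 at the origin.\<close>

definition Hol0 :: "complex ^ ('e + 'b) \<Rightarrow> complex" where
  "Hol0 z = Ent z / (\<Prod>r\<in>R. rGamma (X r z + 1))"

lemma Nc_eq_Hol0: "(\<And>r. r \<in> R \<Longrightarrow> X r z \<noteq> 0) \<Longrightarrow> Nc z = Hol0 z / (\<Prod>r\<in>R. X r z)"
proof -
  have "(\<Prod>r\<in>R. rGamma (X r z)) = (\<Prod>r\<in>R. X r z) * (\<Prod>r\<in>R. rGamma (X r z + 1))"
    unfolding prod.distrib[symmetric] by (intro prod.cong refl) (simp add: rGamma_plus1)
  then show ?thesis by (simp add: Nc_def Hol0_def)
qed

lemma holomorphic_Hol0: "\<exists>\<rho>>0. holomorphic_nd Hol0 (ball 0 \<rho>)"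
proof -
  define h where "h z = (\<Prod>r\<in>R. rGamma (X r z + 1))" for z
  have h: "holomorphic_nd h UNIV"
    unfolding h_def
    by (intro holomorphic_nd_prod holomorphic_nd_compose[OF _ holomorphic_rGamma[of UNIV]]
        holomorphic_nd_add holomorphic_nd_X) auto
  have "X r 0 = 0" for r using X_scale[of r 0 0] by simp
  then have "h 0 \<noteq> 0" by (simp add: h_def)
  moreover have "open {z. h z \<noteq> 0}"
    using holomorphic_nd_continuous_on[OF h] by (intro open_Collect_neq continuous_intros)
  ultimately obtain \<rho> where "0 < \<rho>" "ball 0 \<rho> \<subseteq> {z. h z \<noteq> 0}"
    using open_contains_ball by blast
  then have "holomorphic_nd (\<lambda>z. Ent z / h z) (ball 0 \<rho>)"
    using Ent(1) h by (intro holomorphic_nd_divide) (auto intro: holomorphic_nd_subset)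
  then show ?thesis using \<open>0 < \<rho>\<close> by (auto simp: Hol0_def[abs_def] h_def[abs_def])
qed

text \<open>At real points of \<open>D0\<close> the bounds of \<open>N_rv_bounds\<close> close up
  under scaling. In general both sides are multiplied by all \<open>X r\<close>: then
  \<open>Hol0\<close> is holomorphic near the origin, \<open>Q\<close> is its candidate term of
  degree \<open>d = card R - n\<close>, and \<open>leading_order_along_line\<close> carries the
  property \<open>good\<close> away from the real points.\<close>

lemma limit_Nc:
  fixes Rat :: "complex ^ ('e + 'b) \<Rightarrow> complex"
  assumes hol: "holomorphic_nd Rat {z. \<forall>r\<in>R. X r z \<noteq> 0}"
    and V: "\<And>c. (\<And>r. r \<in> R \<Longrightarrow> 0 < trop c r) \<Longrightarrow> of_real (V c) = Rat (of_real_vec c)"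
    and hom: "\<And>a z. a \<noteq> 0 \<Longrightarrow> Rat (a *s z) = Rat z / a ^ n" and n: "n \<le> card R"
    and p: "\<And>r. r \<in> R \<Longrightarrow> X r p \<noteq> 0"
  shows "((\<lambda>a::real. of_real a ^ n * Nc (of_real a *s p)) \<longlongrightarrow> Rat p) (at_right 0)"
proof -
  define d where "d = card R - n"
  define Q where "Q z = Rat z * (\<Prod>r\<in>R. X r z)" for z
  define good where "good z \<longleftrightarrow> ((\<lambda>a::real. Hol0 (of_real a *s z) / of_real a ^ d) \<longlongrightarrow> Q z) (at_right 0)" for z
  have rel: "of_real a ^ n * Nc (of_real a *s z) = (Hol0 (of_real a *s z) / of_real a ^ d) / (\<Prod>r\<in>R. X r z)"
    if "\<And>r. r \<in> R \<Longrightarrow> X r z \<noteq> 0" "0 < a" for a :: real and z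
  proof -
    have "(\<Prod>r\<in>R. X r (of_real a *s z)) = of_real a ^ card R * (\<Prod>r\<in>R. X r z)"
      by (simp add: X_scale prod.distrib)
    moreover have "of_real a ^ card R = complex_of_real a ^ n * of_real a ^ d"
      using n by (simp add: d_def power_add[symmetric])
    ultimately show ?thesis
      using that Nc_eq_Hol0[of "of_real a *s z"] by (simp add: X_scale)
  qed
  have good_iff: "good z \<longleftrightarrow> ((\<lambda>a::real. of_real a ^ n * Nc (of_real a *s z)) \<longlongrightarrow> Rat z) (at_right 0)"
    if z: "\<And>r. r \<in> R \<Longrightarrow> X r z \<noteq> 0" for z
  proof -
    have nz: "(\<Prod>r\<in>R. X r z) \<noteq> 0" using z finite_R by simp
    have end2: "\<forall>\<^sub>F a in at_right (0::real). of_real a ^ n * Nc (of_real a *s z) = (Hol0 (of_real a *s z) / of_real a ^ d) / (\<Prod>r\<in>R. X r z)"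
      using eventually_at_right_less[of "0::real"] by eventually_elim (rule rel[OF z])
    have "((\<lambda>a::real. of_real a ^ n * Nc (of_real a *s z)) \<longlongrightarrow> Rat z) (at_right 0)
      \<longleftrightarrow> ((\<lambda>a::real. (Hol0 (of_real a *s z) / of_real a ^ d) / (\<Prod>r\<in>R. X r z)) \<longlongrightarrow> Q z / (\<Prod>r\<in>R. X r z)) (at_right 0)"
      using nz by (subst tendsto_cong[OF end2]) (simp add: Q_def)
    also have "\<dots> \<longleftrightarrow> good z"
    proof
      assume "((\<lambda>a::real. (Hol0 (of_real a *s z) / of_real a ^ d) / (\<Prod>r\<in>R. X r z)) \<longlongrightarrow> Q z / (\<Prod>r\<in>R. X r z)) (at_right 0)"
      from tendsto_mult[OF this tendsto_const[of "\<Prod>r\<in>R. X r z"]] show "good z"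
        using nz by (simp add: good_def)
    next
      assume "good z"
      then show "((\<lambda>a::real. (Hol0 (of_real a *s z) / of_real a ^ d) / (\<Prod>r\<in>R. X r z)) \<longlongrightarrow> Q z / (\<Prod>r\<in>R. X r z)) (at_right 0)"
        unfolding good_def by (intro tendsto_divide tendsto_const nz)
    qed
    finally show ?thesis by simp
  qed
  have real_good: "good (of_real_vec c)" if c: "\<And>r. r \<in> R \<Longrightarrow> 0 < trop c r" for c
  proof -
    have ca: "0 < trop (\<lambda>k. a * c k) r" if "0 < a" "r \<in> R" for a r
    proof -
      have "trop (\<lambda>k. a * c k) r = a * trop c r"
        by (simp add: trop_def sum_distrib_left right_diff_distrib mult.assoc)
      then show ?thesis using that c by simp
    qed
    have rva: "of_real a *s of_real_vec c = of_real_vec (\<lambda>k. a * c k)" for a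
      by (simp add: of_real_vec_def vec_eq_iff)
    have Va: "a ^ n * V (\<lambda>k. a * c k) = V c" if "0 < a" for a
    proof -
      have "complex_of_real (V (\<lambda>k. a * c k)) = of_real (V c) / of_real a ^ n"
        using V[of "\<lambda>k. a * c k"] ca[OF that] V[of c] c hom[of "of_real a" "of_real_vec c"] that by (simp add: rva)
      then have "V (\<lambda>k. a * c k) = V c / a ^ n" by (metis of_real_divide of_real_eq_iff of_real_power)
      then show ?thesis using that by simp
    qed
    have Csta: "trop_err (\<lambda>k. a * c k) = a * trop_err c" if "0 < a" for a
      using that by (simp add: trop_err_def abs_mult sum_distrib_left mult.assoc)
    define g where "g a = a ^ n * Re (N (of_real_vec (\<lambda>k. a * c k)))" for a
    have "(g \<longlongrightarrow> V c) (at_right 0)"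
    proof (rule tendsto_sandwich)
      show "((\<lambda>a. exp (- (a * trop_err c)) * V c) \<longlongrightarrow> V c) (at_right 0)"
        by (rule tendsto_eq_intros refl | simp)+
      show "((\<lambda>a. exp (a * trop_err c) * V c) \<longlongrightarrow> V c) (at_right 0)"
        by (rule tendsto_eq_intros refl | simp)+
      show "\<forall>\<^sub>F a in at_right 0. exp (- (a * trop_err c)) * V c \<le> g a"
        using eventually_at_right_less[of "0::real"]
      proof eventually_elim
        case (elim a)
        have "a ^ n * (exp (- (a * trop_err c)) * V (\<lambda>k. a * c k)) \<le> g a"
          unfolding g_def using N_rv_bounds(2)[OF ca[OF elim]] elim by (intro mult_left_mono) (auto simp: Csta)
        then show ?case using Va[OF elim] by (metis mult.left_commute)
      qed
      show "\<forall>\<^sub>F a in at_right 0. g a \<le> exp (a * trop_err c) * V c"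
        using eventually_at_right_less[of "0::real"]
      proof eventually_elim
        case (elim a)
        have "g a \<le> a ^ n * (exp (a * trop_err c) * V (\<lambda>k. a * c k))"
          unfolding g_def using N_rv_bounds(3)[OF ca[OF elim]] elim by (intro mult_left_mono) (auto simp: Csta)
        then show ?case using Va[OF elim] by (metis mult.left_commute)
      qed
    qed
    then have "((\<lambda>a. complex_of_real (g a)) \<longlongrightarrow> of_real (V c)) (at_right 0)" by (rule tendsto_of_real)
    then have "((\<lambda>a. complex_of_real (g a)) \<longlongrightarrow> Rat (of_real_vec c)) (at_right 0)"
      using V[of c] c by simp
    moreover have "\<forall>\<^sub>F a in at_right 0. complex_of_real (g a) = of_real a ^ n * Nc (of_real a *s of_real_vec c)"
      using eventually_at_right_less[of "0::real"]
    proof eventually_elim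
      case (elim a)
      have 1: "Nc (of_real_vec (\<lambda>k. a * c k)) = N (of_real_vec (\<lambda>k. a * c k))"
        using ca[OF elim] by (intro Nc_eq_N) (simp add: rv_in_D0)
      have 2: "N (of_real_vec (\<lambda>k. a * c k)) = of_real (Re (N (of_real_vec (\<lambda>k. a * c k))))"
        by (rule N_rv_bounds(1)) (rule ca[OF elim])
      show ?case
        by (simp only: g_def rva 1 of_real_mult of_real_power 2[symmetric])
    qed
    ultimately have "((\<lambda>a. of_real a ^ n * Nc (of_real a *s of_real_vec c)) \<longlongrightarrow> Rat (of_real_vec c)) (at_right 0)"
      by (rule Lim_transform_eventually)
    moreover have "X r (of_real_vec c) \<noteq> 0" if "r \<in> R" for r using c[OF that] by (simp add: X_rv)
    ultimately show ?thesis by (simp add: good_iff)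
  qed
  obtain \<rho> where \<rho>: "0 < \<rho>" "holomorphic_nd Hol0 (ball 0 \<rho>)" using holomorphic_Hol0 by blast
  \<comment> \<open>Only points with real parameter \<open>l\<close> close to 0 have to be known
    beforehand; they lie in \<open>D0\<close> because it is open.\<close>
  have line: "good (p + l *s q)"
    if p: "p \<in> D0" and real: "\<And>l::real. p + of_real l *s q \<in> D0 \<Longrightarrow> good (p + of_real l *s q)"
      and l: "\<And>r. r \<in> R \<Longrightarrow> X r (p + l *s q) \<noteq> 0" for p q l
  proof -
    define Z where "Z = {l. \<exists>r\<in>R. X r (p + l *s q) = 0}"
    have Xp: "X r p \<noteq> 0" if "r \<in> R" for r using p that by (force simp: D0_def)
    \<comment> \<open>Each form is affine in \<open>l\<close> and nonzero at \<open>l = 0\<close>,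
      hence has at most one zero on the line.\<close>
    have "Z \<subseteq> (\<lambda>r. - X r p / X r q) ` R"
    proof
      fix l assume "l \<in> Z"
      then obtain r where r: "r \<in> R" "X r p + l * X r q = 0" by (auto simp: Z_def X_add X_scale)
      then have "X r q \<noteq> 0" using Xp by force
      then have "l = - X r p / X r q" using r(2) by (simp add: field_simps add_eq_0_iff)
      then show "l \<in> (\<lambda>r. - X r p / X r q) ` R" using r by blast
    qed
    then have Z: "finite Z" "0 \<notin> Z"
      using finite_R Xp by (meson finite_imageI finite_subset, auto simp: Z_def)
    have "open {l. p + l *s q \<in> D0}" by (intro open_line_preimage open_D0)
    moreover have "0 \<in> {l. p + l *s q \<in> D0}" using p by simp
    ultimately obtain \<epsilon> where \<epsilon>: "0 < \<epsilon>" "ball 0 \<epsilon> \<subseteq> {l. p + l *s q \<in> D0}"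
      by (rule openE)
    have QH: "(\<lambda>l. Q (p + l *s q)) holomorphic_on - Z"
      unfolding Q_def
      by (rule holomorphic_on_line[of _ "{z. \<forall>r\<in>R. X r z \<noteq> 0}"],
          intro holomorphic_nd_mult hol holomorphic_nd_prod holomorphic_nd_X) (auto simp: Z_def)
    have "good (p + of_real l *s q)" if "\<bar>l\<bar> < \<epsilon>" for l :: real
    proof (rule real)
      have "complex_of_real l \<in> ball 0 \<epsilon>" using that by simp
      then show "p + of_real l *s q \<in> D0" using \<epsilon>(2) by blast
    qed
    then show ?thesis
      using leading_order_along_line[OF \<rho>(2,1) QH Z \<epsilon>(1), of p q d l] l
      by (auto simp: good_def Z_def)
  qed
  obtain c0 where c0: "\<And>r. r \<in> R \<Longrightarrow> 0 < trop c0 r" using nonempty by blast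
  define v where "v = of_real_vec (\<lambda>k. Im (p $ k))"
  define q where "q = of_real_vec (\<lambda>k. Re (p $ k) - c0 k)"
  have Re_rv: "Re (X r (of_real_vec c + \<i> *s of_real_vec c')) = trop c r" for r c c'
    by (simp add: X_add X_scale X_rv)
  \<comment> \<open>First line: a real direction \<open>v\<close> from a real base point, evaluated
    at \<open>l = \<i>\<close>, supplies the imaginary part of \<open>p\<close>.\<close>
  have good1: "good (of_real_vec c + \<i> *s v)" if c: "\<And>r. r \<in> R \<Longrightarrow> 0 < trop c r" for c
  proof (rule line)
    show "of_real_vec c \<in> D0" using c by (simp add: rv_in_D0)
    show "X r (of_real_vec c + \<i> *s v) \<noteq> 0" if "r \<in> R" for r
      using Re_rv[of r c] c[OF that] unfolding v_def by (metis less_irrefl zero_complex.simps(1))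
    fix l :: real assume l: "of_real_vec c + of_real l *s v \<in> D0"
    have "of_real_vec c + of_real l *s v = of_real_vec (\<lambda>k. c k + l * Im (p $ k))"
      by (simp add: of_real_vec_def v_def vec_eq_iff)
    with l real_good[of "\<lambda>k. c k + l * Im (p $ k)"] show "good (of_real_vec c + of_real l *s v)"
      by (simp add: rv_in_D0)
  qed
  have pe: "p = (of_real_vec c0 + \<i> *s v) + 1 *s q"
    by (simp add: of_real_vec_def v_def q_def vec_eq_iff complex_eq_iff)
  \<comment> \<open>Second line: with the imaginary part fixed, the real part moves from
    \<open>c0\<close> to that of \<open>p\<close>, reached at \<open>l = 1\<close>. Its points with
    real \<open>l\<close> inside \<open>D0\<close> are covered by \<open>good1\<close>, since
    \<open>D0\<close> restricts real parts only.\<close>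
  have "good ((of_real_vec c0 + \<i> *s v) + 1 *s q)"
  proof (rule line)
    show "of_real_vec c0 + \<i> *s v \<in> D0" using c0 Re_rv by (simp add: D0_def v_def)
    show "X r (of_real_vec c0 + \<i> *s v + 1 *s q) \<noteq> 0" if "r \<in> R" for r unfolding pe[symmetric] by (rule p[OF that])
    fix l :: real assume l: "of_real_vec c0 + \<i> *s v + of_real l *s q \<in> D0"
    have eq: "of_real_vec c0 + \<i> *s v + of_real l *s q = of_real_vec (\<lambda>k. c0 k + l * (Re (p $ k) - c0 k)) + \<i> *s v"
      by (simp add: of_real_vec_def v_def q_def vec_eq_iff algebra_simps)
    show "good (of_real_vec c0 + \<i> *s v + of_real l *s q)"
      unfolding eq using l unfolding eq by (intro good1) (auto simp: D0_def v_def Re_rv)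
  qed
  then have "good p" by (simp only: pe[symmetric])
  then show ?thesis using good_iff[OF p] by blast
qed

end

section \<open>Connected edge sets and tropical polynomials\<close>

definition adj :: "'v set set \<Rightarrow> ('v \<times> 'v) set" where
  "adj S = {(a, b). {a, b} \<in> S}"

lemma sym_adj: "sym (adj S)"
  by (auto simp: adj_def sym_def insert_commute)

lemma adj_rtrancl_sym: "(a, b) \<in> (adj S)\<^sup>* \<Longrightarrow> (b, a) \<in> (adj S)\<^sup>*"
  by (rule symD[OF sym_rtrancl[OF sym_adj]])

lemma adj_rtrancl_mono: "S \<subseteq> T \<Longrightarrow> (a, b) \<in> (adj S)\<^sup>* \<Longrightarrow> (a, b) \<in> (adj T)\<^sup>*"
  using rtrancl_mono[of "adj S" "adj T"] by (auto simp: adj_def)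

lemma connected_graph_adj:
  "connected_graph K \<longleftrightarrow> verts K \<noteq> {} \<and> (\<forall>u\<in>verts K. \<forall>v\<in>verts K. (u, v) \<in> (adj (edges K))\<^sup>*)"
  by (simp add: connected_graph_def adj_def)

lemma adj_rtrancl_Union:
  assumes "(a, b) \<in> (adj S)\<^sup>*" "a \<in> A" "\<Union>S \<subseteq> A" shows "b \<in> A"
  using assms by (induction rule: rtrancl_induct) (auto simp: adj_def)

locale simple_graph =
  fixes G :: "'v::finite graph"
  assumes simple: "finite_simple_graph G"
begin

lemma edge_doubleton: "e \<in> edges G \<Longrightarrow> \<exists>a b. a \<noteq> b \<and> e = {a, b}"
  using simple unfolding finite_simple_graph_def card_2_iff by metis

lemma edge_nonempty: "e \<in> edges G \<Longrightarrow> e \<noteq> {}"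
  using edge_doubleton by blast

lemma edge_verts: "e \<in> edges G \<Longrightarrow> e \<subseteq> verts G"
  using simple by (auto simp: finite_simple_graph_def)

lemma conn_edge_setsD:
  assumes "I \<in> conn_edge_sets G"
  shows "I \<noteq> {}" "I \<subseteq> edges G" "a \<in> \<Union>I \<Longrightarrow> b \<in> \<Union>I \<Longrightarrow> (a, b) \<in> (adj I)\<^sup>*"
  using assms by (auto simp: conn_edge_sets_def connected_graph_adj edge_induced_def)

lemma conn_edge_setsI:
  assumes "I \<noteq> {}" "I \<subseteq> edges G" "\<And>a b. a \<in> \<Union>I \<Longrightarrow> b \<in> \<Union>I \<Longrightarrow> (a, b) \<in> (adj I)\<^sup>*"
  shows "I \<in> conn_edge_sets G"
proof -
  obtain e where "e \<in> I" using assms(1) by blast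
  then have "\<Union>I \<noteq> {}" using edge_nonempty assms(2) by blast
  then show ?thesis
    unfolding conn_edge_sets_def connected_graph_adj edge_induced_def mem_Collect_eq fst_conv snd_conv
    using assms by blast
qed

lemma conn_through:
  assumes "I \<noteq> {}" "I \<subseteq> edges G" "\<And>a. a \<in> \<Union>I \<Longrightarrow> (a, w) \<in> (adj I)\<^sup>*"
  shows "I \<in> conn_edge_sets G"
proof (rule conn_edge_setsI[OF assms(1,2)])
  fix a b assume "a \<in> \<Union>I" "b \<in> \<Union>I"
  from assms(3)[OF this(1)] adj_rtrancl_sym[OF assms(3)[OF this(2)]]
  show "(a, b) \<in> (adj I)\<^sup>*" by (rule rtrancl_trans)
qed

lemma conn_star:
  assumes "I \<noteq> {}" "I \<subseteq> incident G v" shows "I \<in> conn_edge_sets G"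
proof (rule conn_through[where w=v])
  fix a assume "a \<in> \<Union>I"
  then obtain e where e: "e \<in> I" "a \<in> e" by blast
  then have "e \<in> edges G" using assms by (auto simp: incident_def)
  from edge_doubleton[OF this] obtain c d where cd: "e = {c, d}" by blast
  have "v \<in> e" using e assms by (auto simp: incident_def)
  then have "a = v \<or> {a, v} = e" using cd e by auto
  then show "(a, v) \<in> (adj I)\<^sup>*" using e by (auto simp: adj_def)
qed (use assms in \<open>auto simp: incident_def\<close>)

lemma conn_singleton: "e \<in> edges G \<Longrightarrow> {e} \<in> conn_edge_sets G"
proof -
  assume e: "e \<in> edges G"
  then obtain v where "v \<in> e" using edge_nonempty by blast
  then show ?thesis using e by (intro conn_star[of _ v]) (auto simp: incident_def)
qed

lemma conn_union:
  assumes I: "I \<in> conn_edge_sets G" and J: "J \<in> conn_edge_sets G" and w: "w \<in> \<Union>I" "w \<in> \<Union>J"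
  shows "I \<union> J \<in> conn_edge_sets G"
proof (rule conn_through[where w=w])
  fix a assume "a \<in> \<Union>(I \<union> J)"
  then show "(a, w) \<in> (adj (I \<union> J))\<^sup>*"
    using conn_edge_setsD(3)[OF I, of a w] conn_edge_setsD(3)[OF J, of a w] w
    by (auto intro: adj_rtrancl_mono[of I] adj_rtrancl_mono[of J])
qed (use conn_edge_setsD[OF I] conn_edge_setsD[OF J] in auto)

text \<open>Maximality refers to shared vertices rather than shared edges, because edge sets that
  meet in one vertex already have a connected union.\<close>

definition is_comp :: "'v set set \<Rightarrow> 'v set set \<Rightarrow> bool" where
  "is_comp S C \<longleftrightarrow> C \<in> conn_edge_sets G \<and> C \<subseteq> S \<and>
     (\<forall>J\<in>conn_edge_sets G. J \<subseteq> S \<longrightarrow> \<Union>J \<inter> \<Union>C \<noteq> {} \<longrightarrow> J \<subseteq> C)"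

definition comp :: "'v set set \<Rightarrow> 'v set set" where
  "comp S = (SOME C. is_comp S C)"

text \<open>By \<open>conn_union\<close>, an inclusion-maximal connected subset absorbs every
  connected subset it touches.\<close>

lemma is_comp_comp:
  assumes "S \<noteq> {}" "S \<subseteq> edges G" shows "is_comp S (comp S)"
  unfolding comp_def
proof (rule someI_ex)
  obtain e where e: "e \<in> S" using assms by blast
  define F where "F = {C. C \<in> conn_edge_sets G \<and> C \<subseteq> S}"
  have "{e} \<in> F" using e assms conn_singleton by (auto simp: F_def)
  then obtain C where C: "C \<in> F" "\<And>D. D \<in> F \<Longrightarrow> C \<subseteq> D \<Longrightarrow> D = C"
    using finite_has_maximal2[of F "{e}"] by (metis finite)
  have "is_comp S C"
    unfolding is_comp_def
  proof (intro conjI ballI impI)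
    fix J assume J: "J \<in> conn_edge_sets G" "J \<subseteq> S" "\<Union>J \<inter> \<Union>C \<noteq> {}"
    then have "C \<union> J \<in> F" using C(1) conn_union[of C J] by (auto simp: F_def)
    then show "J \<subseteq> C" using C(2)[of "C \<union> J"] by blast
  qed (use C in \<open>auto simp: F_def\<close>)
  then show "\<exists>C. is_comp S C" by blast
qed

lemma is_comp_disjoint:
  assumes "is_comp S C" "J \<in> conn_edge_sets G" "J \<subseteq> S" "\<not> J \<subseteq> C" shows "J \<inter> C = {}"
proof (rule ccontr)
  assume "J \<inter> C \<noteq> {}"
  then obtain e where e: "e \<in> J" "e \<in> C" by blast
  then have "e \<noteq> {}" using edge_nonempty conn_edge_setsD(2)[OF assms(2)] by blast
  then have "\<Union>J \<inter> \<Union>C \<noteq> {}" using e by auto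
  then show False using assms by (auto simp: is_comp_def)
qed

text \<open>The sum over maximal nested sets of the products of \<open>1 / W\<close>, unfolded along one component of
  \<open>S\<close> at a time, whence no product over components.\<close>

primrec nested_sum_aux :: "nat \<Rightarrow> ('v set set \<Rightarrow> 'a::field) \<Rightarrow> 'v set set \<Rightarrow> 'a" where
  "nested_sum_aux 0 W S = 1"
| "nested_sum_aux (Suc n) W S = inverse (W (comp S)) * (\<Sum>e\<in>comp S. nested_sum_aux n W (S - {e}))"

definition nested_sum :: "('v set set \<Rightarrow> 'a::field) \<Rightarrow> 'v set set \<Rightarrow> 'a" where
  "nested_sum W S = nested_sum_aux (card S) W S"

lemma nested_sum_empty [simp]: "nested_sum W {} = 1"
  by (simp add: nested_sum_def)

lemma nested_sum_rec:
  assumes "S \<noteq> {}" "S \<subseteq> edges G"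
  shows "nested_sum W S = inverse (W (comp S)) * (\<Sum>e\<in>comp S. nested_sum W (S - {e}))"
proof -
  obtain n where n: "card S = Suc n" using assms by (metis card_0_eq finite not0_implies_Suc)
  have "card (S - {e}) = n" if "e \<in> comp S" for e
    using is_comp_comp[OF assms] that n by (auto simp: is_comp_def card_Diff_singleton)
  then show ?thesis by (simp add: nested_sum_def n)
qed

lemma nested_sum_induct [consumes 1, case_names empty step]:
  assumes "S \<subseteq> edges G" and "P {}"
    and "\<And>S. S \<noteq> {} \<Longrightarrow> S \<subseteq> edges G \<Longrightarrow> (\<And>e. e \<in> comp S \<Longrightarrow> P (S - {e})) \<Longrightarrow> P S"
  shows "P S"
  using assms(1)
proof (induction "card S" arbitrary: S)
  case 0
  then show ?case using assms(2) by simp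
next
  case (Suc n)
  have S: "S \<noteq> {}" using Suc(2) by auto
  show ?case
  proof (rule assms(3)[OF S Suc(3)])
    fix e assume "e \<in> comp S"
    then have "e \<in> S" using is_comp_comp[OF S Suc(3)] by (auto simp: is_comp_def)
    then have "n = card (S - {e})" using Suc(2) by (simp add: card_Diff_singleton)
    moreover have "S - {e} \<subseteq> edges G" using Suc(3) by blast
    ultimately show "P (S - {e})" by (rule Suc(1))
  qed
qed

text \<open>\<open>Inl e\<close> stands for \<open>1 + w\<^sub>e\<close> and \<open>Inr I\<close> for \<open>F\<^sub>I\<close>; a monomial is the set of its variables.\<close>

definition polys :: "('v set + 'v set set) set" where
  "polys = Inl ` edges G \<union> Inr ` big_conn_edge_sets G"

text \<open>\<open>F_I\<close> is the expanded product of the \<open>1 + w_e\<close> without its top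
  monomial, whence the proper subsets.\<close>

definition Monom :: "'v set + 'v set set \<Rightarrow> 'v set set set" where
  "Monom b = (case b of Inl e \<Rightarrow> Pow {e} | Inr I \<Rightarrow> {K. K \<subset> I})"

sublocale monomial_integral "edges G" polys Monom
proof
  fix b assume b: "b \<in> polys"
  show "Monom b \<noteq> {}"
  proof (cases b)
    case (Inr I)
    then have "I \<noteq> {}" using b by (auto simp: polys_def big_conn_edge_sets_def conn_edge_sets_def)
    then show ?thesis using Inr by (auto simp: Monom_def)
  qed (auto simp: Monom_def)
  show "K \<in> Monom b \<Longrightarrow> K \<subseteq> edges G" for K
    using b by (auto simp: Monom_def polys_def big_conn_edge_sets_def conn_edge_sets_def split: sum.splits)
qed

section \<open>Tropical polynomials and their dependence on positive parts\<close>

lemma tpol_Inl: "tpol (Inl e) t = max 0 (t e)"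
  by (simp add: tpol_def Monom_def Pow_insert max.commute)

text \<open>A subset collects most by taking exactly the positive entries of \<open>t\<close>, but a
  proper one has to give up some edge. The cheapest choice costs the minimum of the positive parts,
  which is 0 if some entry is not positive.\<close>

lemma tpol_Inr:
  assumes "I \<noteq> {}"
  shows "tpol (Inr I) t = (\<Sum>f\<in>I. max 0 (t f)) - Min ((\<lambda>f. max 0 (t f)) ` I)"
  unfolding tpol_def
proof (rule Max_eqI)
  define m where "m = Min ((\<lambda>f. max 0 (t f)) ` I)"
  have "m \<in> (\<lambda>f. max 0 (t f)) ` I" unfolding m_def using assms by (intro Min_in) auto
  then obtain f where f: "f \<in> I" "m = max 0 (t f)" by blast
  have m_le: "m \<le> max 0 (t g)" if "g \<in> I" for g unfolding m_def using that by (intro Min_le) auto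
  show "finite ((\<lambda>K. \<Sum>e\<in>K. t e) ` Monom (Inr I))" by simp
  show "(\<Sum>f\<in>I. max 0 (t f)) - m \<in> (\<lambda>K. \<Sum>e\<in>K. t e) ` Monom (Inr I)"
  proof (cases "0 < t f")
    case True
    have "(\<Sum>f\<in>I. max 0 (t f)) = m + (\<Sum>e\<in>I - {f}. max 0 (t e))"
      using f by (subst sum.remove[of _ f]) auto
    also have "(\<Sum>e\<in>I - {f}. max 0 (t e)) = (\<Sum>e\<in>I - {f}. t e)"
    proof (intro sum.cong refl)
      fix g assume "g \<in> I - {f}"
      then show "max 0 (t g) = t g" using m_le[of g] True f by auto
    qed
    finally have "(\<Sum>f\<in>I. max 0 (t f)) - m = (\<Sum>e\<in>I - {f}. t e)" by simp
    then show ?thesis using f by (auto simp: Monom_def)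
  next
    case False
    then have "m = 0" using f by simp
    moreover have "(\<Sum>f\<in>I. max 0 (t f)) = (\<Sum>e\<in>{e\<in>I. 0 < t e}. t e)"
      by (rule sum.mono_neutral_cong_right) auto
    moreover have "{e\<in>I. 0 < t e} \<subset> I" using f False by auto
    ultimately show ?thesis by (auto simp: Monom_def)
  qed
  fix x assume "x \<in> (\<lambda>K. \<Sum>e\<in>K. t e) ` Monom (Inr I)"
  then obtain K where K: "K \<subset> I" "x = (\<Sum>e\<in>K. t e)" by (auto simp: Monom_def)
  then obtain g where g: "g \<in> I" "g \<notin> K" by blast
  have "x \<le> (\<Sum>e\<in>K. max 0 (t e))" unfolding K by (intro sum_mono) auto
  also have "\<dots> \<le> (\<Sum>e\<in>I - {g}. max 0 (t e))" using K g by (intro sum_mono2) auto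
  also have "\<dots> = (\<Sum>e\<in>I. max 0 (t e)) - max 0 (t g)" using g by (subst (2) sum.remove[of _ g]) auto
  also have "\<dots> \<le> (\<Sum>f\<in>I. max 0 (t f)) - m" using m_le[OF g(1)] by simp
  finally show "x \<le> (\<Sum>f\<in>I. max 0 (t f)) - m" .
qed

definition ind :: "'v set set \<Rightarrow> 'v set \<Rightarrow> real" where
  "ind I f = (if f \<in> I then 1 else 0)"

definition negE :: "'v set \<Rightarrow> 'v set \<Rightarrow> real" where
  "negE e f = (if f = e then - 1 else 0)"

lemma Inr_polysD: "Inr I \<in> polys \<Longrightarrow> I \<in> conn_edge_sets G \<and> I \<noteq> {} \<and> I \<subseteq> edges G"
  by (auto simp: polys_def big_conn_edge_sets_def conn_edge_sets_def)

text \<open>Consequently a negative coordinate enters \<open>trop\<close> only through its linear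
  term, which makes the integration over such coordinates elementary.\<close>

lemma tpol_cong_pos:
  assumes "b \<in> polys" "\<And>f. f \<in> edges G \<Longrightarrow> max 0 (t f) = max 0 (t' f)"
  shows "tpol b t = tpol b t'"
proof (cases b)
  case (Inl e)
  then show ?thesis using assms by (auto simp: tpol_Inl polys_def)
next
  case (Inr I)
  then have I: "I \<noteq> {}" "I \<subseteq> edges G" using Inr_polysD assms(1) by auto
  have "(\<Sum>f\<in>I. max 0 (t f)) = (\<Sum>f\<in>I. max 0 (t' f))" "(\<lambda>f. max 0 (t f)) ` I = (\<lambda>f. max 0 (t' f)) ` I"
    using assms I by (auto intro!: sum.cong image_cong)
  then show ?thesis using Inr I by (simp add: tpol_Inr)
qed

lemma tpol_zero: "b \<in> polys \<Longrightarrow> tpol b (\<lambda>_. 0) = 0"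
proof (cases b)
  case (Inr I)
  assume "b \<in> polys"
  then have "I \<noteq> {}" using Inr Inr_polysD by auto
  then show ?thesis using Inr by (simp add: tpol_Inr image_constant_conv)
qed (simp add: tpol_Inl)

lemma tpol_nonpos: "b \<in> polys \<Longrightarrow> (\<And>f. f \<in> edges G \<Longrightarrow> t f \<le> 0) \<Longrightarrow> tpol b t = 0"
proof -
  assume b: "b \<in> polys" and t: "\<And>f. f \<in> edges G \<Longrightarrow> t f \<le> 0"
  have "tpol b t = tpol b (\<lambda>_. 0)" by (rule tpol_cong_pos[OF b]) (use t in \<open>auto simp: max_def intro: antisym\<close>)
  then show ?thesis using tpol_zero[OF b] by simp
qed

lemma tpol_ind:
  assumes "J \<noteq> {}" shows "tpol (Inr J) (ind C) = real (card (J \<inter> C)) - (if J \<subseteq> C then 1 else 0)"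
proof -
  have "(\<Sum>f\<in>J. max 0 (ind C f)) = card (J \<inter> C)"
  proof -
    have "max 0 (ind C f) = (if f \<in> C then 1 else 0)" for f by (simp add: ind_def)
    then show ?thesis by (simp add: sum.If_cases Int_def)
  qed
  moreover have "Min ((\<lambda>f. max 0 (ind C f)) ` J) = (if J \<subseteq> C then 1 else 0)"
    using assms by (intro Min_eqI) (auto simp: ind_def)
  ultimately show ?thesis using assms by (simp add: tpol_Inr)
qed

text \<open>A connected \<open>J\<close> contained in the positive support of \<open>t\<close> lies in \<open>C\<close> or misses it, so the sum
  and the minimum of the positive parts over \<open>J\<close> both split.\<close>

lemma tpol_component:
  assumes b: "b \<in> polys" and C: "is_comp {f \<in> edges G. 0 < t f} C" and s: "0 \<le> s" "\<And>f. f \<in> C \<Longrightarrow> s \<le> t f"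
  shows "tpol b t = s * tpol b (ind C) + tpol b (\<lambda>f. if f \<in> C then t f - s else t f)"
proof -
  define t' where "t' f = (if f \<in> C then t f - s else t f)" for f
  have pw: "max 0 (t f) = s * ind C f + max 0 (t' f)" for f
    using s(1) s(2)[of f] by (cases "f \<in> C") (auto simp: t'_def ind_def)
  show ?thesis
  proof (cases b)
    case (Inl e)
    then show ?thesis using pw[of e] by (auto simp: tpol_Inl t'_def ind_def)
  next
    case (Inr J)
    then have J: "J \<in> conn_edge_sets G" "J \<noteq> {}" "J \<subseteq> edges G" using Inr_polysD b by auto
    have sum: "(\<Sum>f\<in>J. max 0 (t f)) = s * (\<Sum>f\<in>J. max 0 (ind C f)) + (\<Sum>f\<in>J. max 0 (t' f))"
      unfolding pw sum.distrib sum_distrib_left by (auto simp: ind_def intro!: sum.cong)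
    define d :: real where "d = (if J \<subseteq> C then 1 else 0)"
    have Mi: "Min ((\<lambda>f. max 0 (ind C f)) ` J) = d"
      using J by (intro Min_eqI) (auto simp: ind_def d_def)
    have "Min ((\<lambda>f. max 0 (t f)) ` J) = s * d + Min ((\<lambda>f. max 0 (t' f)) ` J)"
    proof (cases "J \<subseteq> C")
      case True
      have "Min ((\<lambda>f. max 0 (t f)) ` J) = Min ((\<lambda>x. s + x) ` ((\<lambda>f. max 0 (t' f)) ` J))"
        unfolding image_image using True by (intro arg_cong[where f=Min] image_cong refl) (auto simp: pw ind_def)
      also have "\<dots> = s + Min ((\<lambda>f. max 0 (t' f)) ` J)"
        using J by (intro mono_Min_commute[symmetric]) (auto simp: mono_def)
      finally show ?thesis using True by (simp add: d_def)
    next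
      case False
      show ?thesis
      proof (cases "\<exists>f\<in>J. t f \<le> 0")
        case True
        then obtain f where f: "f \<in> J" "t f \<le> 0" by blast
        have "f \<notin> C" using C f by (auto simp: is_comp_def)
        then have f': "t' f = t f" by (simp add: t'_def)
        have "Min ((\<lambda>f. max 0 (t f)) ` J) = 0" "Min ((\<lambda>f. max 0 (t' f)) ` J) = 0"
          using f f' by (auto intro!: Min_eqI image_eqI[of _ _ f] simp: max_def)
        then show ?thesis using False by (simp add: d_def)
      next
        case neg: False
        then have "J \<subseteq> {f \<in> edges G. 0 < t f}" using J by force
        from is_comp_disjoint[OF C J(1) this False]
        have "(\<lambda>f. max 0 (t f)) ` J = (\<lambda>f. max 0 (t' f)) ` J"
          by (intro image_cong refl) (auto simp: t'_def)
        then show ?thesis using False by (simp add: d_def)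
      qed
    qed
    with sum Mi J show ?thesis unfolding Inr by (simp add: tpol_Inr t'_def[symmetric] algebra_simps)
  qed
qed

lemma trop_component:
  assumes C: "is_comp {f \<in> edges G. 0 < t f} C" and s: "0 \<le> s" "\<And>f. f \<in> C \<Longrightarrow> s \<le> t f"
  shows "trop c t = s * trop c (ind C) + trop c (\<lambda>f. if f \<in> C then t f - s else t f)"
proof -
  have "(\<Sum>b\<in>polys. c (Inr b) * tpol b t) = s * (\<Sum>b\<in>polys. c (Inr b) * tpol b (ind C))
     + (\<Sum>b\<in>polys. c (Inr b) * tpol b (\<lambda>f. if f \<in> C then t f - s else t f))"
    unfolding sum_distrib_left sum.distrib[symmetric]
    by (intro sum.cong refl) (subst tpol_component[OF _ C s], auto simp: algebra_simps)
  moreover have "(\<Sum>e\<in>edges G. c (Inl e) * t e) = s * (\<Sum>e\<in>edges G. c (Inl e) * ind C e)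
     + (\<Sum>e\<in>edges G. c (Inl e) * (if e \<in> C then t e - s else t e))"
    unfolding sum_distrib_left sum.distrib[symmetric]
    by (intro sum.cong refl) (auto simp: ind_def algebra_simps)
  ultimately show ?thesis by (simp add: trop_def algebra_simps)
qed

lemma trop_cong: "(\<And>f. f \<in> edges G \<Longrightarrow> t f = t' f) \<Longrightarrow> trop c t = trop c t'"
  unfolding trop_def by (intro arg_cong2[where f="(-)"] sum.cong refl arg_cong2[where f="(*)"] tpol_cong_pos) auto

lemma trop_nonpos:
  "(\<And>f. f \<in> edges G \<Longrightarrow> t f \<le> 0) \<Longrightarrow> trop c t = - (\<Sum>e\<in>edges G. c (Inl e) * t e)"
  by (simp add: trop_def tpol_nonpos)

lemma trop_negE: "e \<in> edges G \<Longrightarrow> trop c (negE e) = c (Inl e)"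
proof -
  assume "e \<in> edges G"
  moreover have "(\<Sum>f\<in>edges G. c (Inl f) * negE e f) = (\<Sum>f\<in>edges G. if f = e then - c (Inl e) else 0)"
    by (intro sum.cong) (auto simp: negE_def)
  ultimately show ?thesis by (subst trop_nonpos) (auto simp: negE_def)
qed

lemma trop_update_nonpos:
  assumes "e \<in> edges G" "s \<le> 0"
  shows "trop c (t(e := s)) = trop c (t(e := 0)) - c (Inl e) * s"
proof -
  have "(\<Sum>b\<in>polys. c (Inr b) * tpol b (t(e := s))) = (\<Sum>b\<in>polys. c (Inr b) * tpol b (t(e := 0)))"
    using assms by (intro sum.cong refl arg_cong2[where f="(*)"] tpol_cong_pos) auto
  moreover have "(\<Sum>f\<in>edges G. c (Inl f) * (t(e := u)) f) = c (Inl e) * u + (\<Sum>f\<in>edges G - {e}. c (Inl f) * t f)" for u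
    using assms by (subst sum.remove[of _ e]) (auto intro!: sum.cong)
  ultimately show ?thesis by (simp only: trop_def)
qed

end

section \<open>The tropical integral\<close>

lemma nn_integral_exp_pos:
  fixes X :: real
  assumes "0 < X"
  shows "(\<integral>\<^sup>+s. indicator {0<..} s * ennreal (exp (- (s * X))) \<partial>lborel) = ennreal (1 / X)"
proof -
  have "(\<integral>\<^sup>+s. ennreal (exp (- (s * X))) * indicator {0..} s \<partial>lborel) = ennreal (0 - - exp (- (0 * X)) / X)"
  proof (rule nn_integral_FTC_atLeast)
    show "((\<lambda>s. - exp (- (s * X)) / X) has_real_derivative exp (- (s * X))) (at s)" for s
      using assms by (auto intro!: derivative_eq_intros)
    have "filterlim (\<lambda>s. X * s) at_top at_top"
      by (rule filterlim_tendsto_pos_mult_at_top[OF tendsto_const assms filterlim_ident])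
    then have "filterlim (\<lambda>s. - (s * X)) at_bot at_top"
      unfolding filterlim_uminus_at_top by (simp only: mult.commute)
    then have "((\<lambda>s. exp (- (s * X))) \<longlongrightarrow> 0) at_top"
      by (rule filterlim_compose[OF exp_at_bot])
    then show "((\<lambda>s. - exp (- (s * X)) / X) \<longlongrightarrow> 0) at_top"
      using tendsto_divide[OF tendsto_minus tendsto_const, of "\<lambda>s. exp (- (s * X))" 0 at_top X] assms by simp
  qed auto
  moreover have "(\<integral>\<^sup>+s. indicator {0<..} s * ennreal (exp (- (s * X))) \<partial>lborel)
      = (\<integral>\<^sup>+s. ennreal (exp (- (s * X))) * indicator {0..} s \<partial>lborel)"
    using AE_lborel_singleton[of "0::real"]
    by (intro nn_integral_cong_AE, eventually_elim) (auto simp: indicator_def)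
  ultimately show ?thesis by simp
qed

lemma nn_integral_exp_neg:
  fixes X :: real
  assumes "0 < X"
  shows "(\<integral>\<^sup>+s. indicator {..<0} s * ennreal (exp (s * X)) \<partial>lborel) = ennreal (1 / X)"
proof -
  have "(\<integral>\<^sup>+s. indicator {..<0} s * ennreal (exp (s * X)) \<partial>lborel)
      = ennreal \<bar>- 1\<bar> * (\<integral>\<^sup>+s. indicator {..<0} (0 + - 1 * s) * ennreal (exp ((0 + - 1 * s) * X)) \<partial>lborel)"
    by (rule nn_integral_real_affine) auto
  also have "\<dots> = (\<integral>\<^sup>+s. indicator {0<..} s * ennreal (exp (- (s * X))) \<partial>lborel)"
    by (simp, intro nn_integral_cong) (auto simp: indicator_def)
  finally show ?thesis using nn_integral_exp_pos[OF assms] by simp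
qed

lemma nn_integral_lborelP_insert_rev:
  assumes "finite I" "e \<in> I" "f \<in> borel_measurable (lborelP I)"
  shows "(\<integral>\<^sup>+t. f t \<partial>lborelP I) = (\<integral>\<^sup>+s. \<integral>\<^sup>+t. f (t(e := s)) \<partial>lborelP (I - {e}) \<partial>lborel)"
  using product_sigma_finite.product_nn_integral_insert_rev[OF product_sigma_finite_lborel, of "I - {e}" e f] assms
  by (simp add: insert_absorb)

text \<open>Fubini in the coordinate \<open>e\<close>: with the others fixed, the equation selects
  the single value \<open>h t\<close>, and a point has measure zero.\<close>

lemma AE_lborelP_neq:
  fixes h :: "('i \<Rightarrow> real) \<Rightarrow> real"
  assumes I: "finite I" "e \<in> I" and h: "h \<in> borel_measurable (lborelP I)"
    and indep: "\<And>t s. h (t(e := s)) = h t"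
  shows "AE t in lborelP I. t e \<noteq> h t"
proof -
  have em: "(\<lambda>t. t e) \<in> borel_measurable (lborelP I)"
    using measurable_component_singleton[OF I(2), of "\<lambda>_. lborel :: real measure"] by simp
  have A: "{t \<in> space (lborelP I). t e = h t} \<in> sets (lborelP I)"
    using borel_measurable_eq[OF em h] by simp
  have "emeasure (lborelP I) {t \<in> space (lborelP I). t e = h t}
      = (\<integral>\<^sup>+t. indicator {t \<in> space (lborelP I). t e = h t} t \<partial>lborelP I)"
    using A by simp
  also have "\<dots> = (\<integral>\<^sup>+t. \<integral>\<^sup>+s. indicator {t \<in> space (lborelP I). t e = h t} (t(e := s)) \<partial>lborel \<partial>lborelP (I - {e}))"
    using product_sigma_finite.product_nn_integral_insert[OF product_sigma_finite_lborel, of "I - {e}" e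
        "indicator {t \<in> space (lborelP I). t e = h t}"] borel_measurable_indicator[OF A] I
    by (simp add: insert_absorb)
  also have "\<dots> = (\<integral>\<^sup>+t. 0 \<partial>lborelP (I - {e}))"
  proof (intro nn_integral_cong)
    fix t
    have "(\<integral>\<^sup>+s. indicator {t \<in> space (lborelP I). t e = h t} (t(e := s)) \<partial>lborel) \<le> (\<integral>\<^sup>+s. indicator {h t} s \<partial>lborel)"
      by (intro nn_integral_mono) (auto simp: indicator_def indep)
    also have "\<dots> = 0" by simp
    finally show "(\<integral>\<^sup>+s. indicator {t \<in> space (lborelP I). t e = h t} (t(e := s)) \<partial>lborel) = 0" by simp
  qed
  finally have "emeasure (lborelP I) {t \<in> space (lborelP I). t e = h t} = 0" by simp
  then show ?thesis using A by (intro AE_I[of _ _ "{t \<in> space (lborelP I). t e = h t}"]) auto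
qed

context simple_graph
begin

definition sign_ind :: "'v set set \<Rightarrow> 'v set \<Rightarrow> real \<Rightarrow> ennreal" where
  "sign_ind S f x = indicator (if f \<in> S then {0<..} else {..<0}) x"

definition orthant_ind :: "'v set set \<Rightarrow> ('v set \<Rightarrow> real) \<Rightarrow> ennreal" where
  "orthant_ind S t = (\<Prod>f\<in>edges G. sign_ind S f (t f))"

definition min_ind :: "'v set set \<Rightarrow> 'v set \<Rightarrow> ('v set \<Rightarrow> real) \<Rightarrow> ennreal" where
  "min_ind C e t = (\<Prod>f\<in>C - {e}. indicator {0<..} (t f - t e))"

definition exp_trop :: "('v set + ('v set + 'v set set) \<Rightarrow> real) \<Rightarrow> ('v set \<Rightarrow> real) \<Rightarrow> ennreal" where
  "exp_trop c t = ennreal (exp (- trop c t))"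

text \<open>Contribution of the \<open>t\<close> whose set of positive coordinates is
  \<open>S\<close>; the points with a coordinate equal to 0 form a null set.\<close>

definition orthant_int :: "('v set + ('v set + 'v set set) \<Rightarrow> real) \<Rightarrow> 'v set set \<Rightarrow> ennreal" where
  "orthant_int c S = (\<integral>\<^sup>+t. orthant_ind S t * exp_trop c t \<partial>lborelP (edges G))"

lemma prod_indicator: "finite A \<Longrightarrow> (\<Prod>i\<in>A. indicator (B i) (x i) :: ennreal) = (if \<forall>i\<in>A. x i \<in> B i then 1 else 0)"
  by (auto simp: indicator_def intro!: prod.neutral)

lemma orthant_ind_alt: "orthant_ind S t = (if \<forall>f\<in>edges G. if f \<in> S then 0 < t f else t f < 0 then 1 else 0)"
proof -
  have "x \<in> (if b then {0<..} else {..<0}) \<longleftrightarrow> (if b then 0 < x else x < 0)" for b and x :: real by simp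
  then show ?thesis unfolding orthant_ind_def sign_ind_def by (simp only: prod_indicator finite)
qed

lemma min_ind_alt: "min_ind C e t = (if \<forall>f\<in>C - {e}. t e < t f then 1 else 0)"
  unfolding min_ind_def by (simp add: prod_indicator)

lemma exp_trop_measurable: "exp_trop c \<in> borel_measurable (lborelP (edges G))"
  unfolding exp_trop_def[abs_def] using trop_measurable[of c]
  by (intro measurable_compose[OF _ measurable_ennreal] measurable_compose[OF _ borel_measurable_exp] borel_measurable_uminus)

lemma orthant_ind_measurable: "orthant_ind S \<in> borel_measurable (lborelP (edges G))"
  unfolding orthant_ind_def[abs_def] sign_ind_def
  by (intro borel_measurable_prod_ennreal measurable_compose[OF component_measurable]) auto

lemma min_ind_measurable: "C \<subseteq> edges G \<Longrightarrow> e \<in> edges G \<Longrightarrow> min_ind C e \<in> borel_measurable (lborelP (edges G))"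
  unfolding min_ind_def[abs_def]
proof (rule borel_measurable_prod_ennreal)
  fix f assume "C \<subseteq> edges G" "e \<in> edges G" "f \<in> C - {e}"
  then have "(\<lambda>t. t f - t e :: real) \<in> borel_measurable (lborelP (edges G))"
    by (intro borel_measurable_diff component_measurable) auto
  then show "(\<lambda>t. indicator {0<..} (t f - t e) :: ennreal) \<in> borel_measurable (lborelP (edges G))"
    by (rule measurable_compose) auto
qed

lemma orthant_int_empty:
  assumes "\<And>e. e \<in> edges G \<Longrightarrow> 0 < c (Inl e)"
  shows "orthant_int c {} = ennreal (\<Prod>e\<in>edges G. 1 / c (Inl e))"
proof -
  have "orthant_int c {} = (\<integral>\<^sup>+t. (\<Prod>f\<in>edges G. indicator {..<0} (t f) * ennreal (exp (t f * c (Inl f)))) \<partial>lborelP (edges G))"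
    unfolding orthant_int_def
  proof (intro nn_integral_cong)
    fix t :: "'v set \<Rightarrow> real"
    show "orthant_ind {} t * exp_trop c t = (\<Prod>f\<in>edges G. indicator {..<0} (t f) * ennreal (exp (t f * c (Inl f))))"
    proof (cases "\<forall>f\<in>edges G. t f < 0")
      case True
      then have "trop c t = - (\<Sum>f\<in>edges G. t f * c (Inl f))"
        by (subst trop_nonpos) (auto simp: mult.commute less_imp_le)
      then have "exp_trop c t = (\<Prod>f\<in>edges G. ennreal (exp (t f * c (Inl f))))"
        by (simp add: exp_trop_def exp_sum prod_ennreal)
      then show ?thesis using True by (simp add: orthant_ind_alt)
    next
      case False
      then have "(\<Prod>f\<in>edges G. indicator {..<0} (t f) :: ennreal) = 0"
        unfolding prod_indicator[OF finite] by simp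
      then have "(\<Prod>f\<in>edges G. indicator {..<0} (t f) * ennreal (exp (t f * c (Inl f)))) = 0"
        unfolding prod.distrib by simp
      moreover have "orthant_ind {} t = 0" using False by (simp add: orthant_ind_alt)
      ultimately show ?thesis by simp
    qed
  qed
  also have "\<dots> = (\<Prod>f\<in>edges G. ennreal (1 / c (Inl f)))"
    using assms
    by (subst product_sigma_finite.product_nn_integral_prod[OF product_sigma_finite_lborel])
      (auto simp: nn_integral_exp_neg intro!: prod.cong)
  also have "\<dots> = ennreal (\<Prod>e\<in>edges G. 1 / c (Inl e))"
    using assms by (intro prod_ennreal) (simp add: less_imp_le)
  finally show ?thesis .
qed

text \<open>Here \<open>e\<close> is where \<open>t\<close> is smallest on the component
  \<open>C\<close>; let \<open>s = t e\<close>. Subtracting \<open>s\<close> on \<open>C\<close>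
  splits off \<open>exp (- (s * trop c (ind C)))\<close> and leaves the integrand \<open>k\<close>
  taken at \<open>t e = 0\<close>, so integration over \<open>s > 0\<close> gives
  \<open>1 / trop c (ind C)\<close> times the integral of \<open>k\<close>. For
  \<open>S - {e}\<close> the coordinate \<open>t e\<close> is negative, enters linearly, and gives
  \<open>1 / c (Inl e)\<close> times the same integral. The claim compares the two.\<close>

lemma orthant_int_step:
  assumes S: "S \<noteq> {}" "S \<subseteq> edges G" and e: "e \<in> comp S"
    and X: "0 < trop c (ind (comp S))" and ce: "0 < c (Inl e)"
  shows "(\<integral>\<^sup>+t. orthant_ind S t * min_ind (comp S) e t * exp_trop c t \<partial>lborelP (edges G))
    = ennreal (c (Inl e) / trop c (ind (comp S))) * orthant_int c (S - {e})"
proof -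
  define C where "C = comp S"
  define E' where "E' = edges G - {e}"
  define X where "X = trop c (ind C)"
  have C: "is_comp S C" unfolding C_def by (rule is_comp_comp[OF S])
  then have CS: "C \<subseteq> S" by (auto simp: is_comp_def)
  have eC: "e \<in> C" using e by (simp add: C_def)
  then have eS: "e \<in> S" "e \<in> edges G" using CS S by auto
  have CE: "C \<subseteq> edges G" using CS S by auto
  define F where "F t = orthant_ind S t * min_ind C e t * exp_trop c t" for t
  have Fm: "F \<in> borel_measurable (lborelP (edges G))"
    unfolding F_def[abs_def] by (intro borel_measurable_times_ennreal orthant_ind_measurable min_ind_measurable exp_trop_measurable CE eS)
  define k where "k t = (\<Prod>f\<in>E'. sign_ind S f (t f)) * exp_trop c (t(e := 0))" for t
  have upd_meas: "(\<lambda>t. t(e := s)) \<in> measurable (lborelP E') (lborelP (edges G))" for s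
    using measurable_fun_upd[of "edges G" E' e "\<lambda>t. t" "lborelP E'" "\<lambda>_. lborel" "\<lambda>_. s"] eS
    by (auto simp: E'_def)
  have compm: "f \<in> E' \<Longrightarrow> (\<lambda>t. t f :: real) \<in> borel_measurable (lborelP E')" for f
    using measurable_component_singleton[of f E' "\<lambda>_. lborel :: real measure"] by simp
  have km: "k \<in> borel_measurable (lborelP E')"
    unfolding k_def[abs_def] sign_ind_def
    by (intro borel_measurable_times_ennreal borel_measurable_prod_ennreal measurable_compose[OF compm]
        measurable_compose[OF upd_meas exp_trop_measurable]) auto
  have split_chi: "orthant_ind T t = sign_ind T e (t e) * (\<Prod>f\<in>E'. sign_ind T f (t f))" for T t
    unfolding orthant_ind_def E'_def using eS by (subst prod.remove[of _ e]) auto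
  have pos: "(\<integral>\<^sup>+t. F (t(e := s)) \<partial>lborelP E') = ennreal (exp (- (s * X))) * (\<integral>\<^sup>+t. k t \<partial>lborelP E')"
    if s: "0 < s" for s
  proof -
    \<comment> \<open>Translation by \<open>s\<close> on \<open>C\<close> turns the condition
      \<open>t e < t f\<close> into \<open>0 < t f\<close>; outside \<open>C\<close> nothing
      moves.\<close>
    define tr where "tr t = (\<lambda>f\<in>E'. t f + (if f \<in> C then s else 0))" for t :: "'v set \<Rightarrow> real"
    have tr_distr: "distr (lborelP E') (lborelP E') tr = lborelP E'"
      unfolding tr_def by (rule distr_lborelP_translate) simp
    have trm: "tr \<in> measurable (lborelP E') (lborelP E')"
      unfolding tr_def by (intro measurable_restrict) (auto intro!: compm borel_measurable_add)
    have "(\<integral>\<^sup>+t. F (t(e := s)) \<partial>lborelP E') = (\<integral>\<^sup>+t. F ((tr t)(e := s)) \<partial>lborelP E')"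
      using nn_integral_distr[OF trm, of "\<lambda>t. F (t(e := s))"] measurable_compose[OF upd_meas Fm]
      by (simp add: tr_distr)
    also have "\<dots> = (\<integral>\<^sup>+t. ennreal (exp (- (s * X))) * k t \<partial>lborelP E')"
    proof (intro nn_integral_cong)
      fix t :: "'v set \<Rightarrow> real"
      define u where "u = (tr t)(e := s)"
      have ind_eq: "orthant_ind S u * min_ind C e u = (\<Prod>f\<in>E'. sign_ind S f (t f))"
      proof -
        have "sign_ind S e (u e) = 1" using s eS by (simp add: u_def sign_ind_def)
        moreover have "min_ind C e u = (\<Prod>f\<in>E'. if f \<in> C then indicator {0<..} (t f) else 1)"
          unfolding min_ind_def
        proof (rule prod.mono_neutral_cong_left)
          show "C - {e} \<subseteq> E'" using CE by (auto simp: E'_def)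
        qed (use CE in \<open>auto simp: u_def tr_def E'_def indicator_def\<close>)
        moreover have "(\<Prod>f\<in>E'. sign_ind S f (u f)) * (\<Prod>f\<in>E'. if f \<in> C then indicator {0<..} (t f) else 1) = (\<Prod>f\<in>E'. sign_ind S f (t f))"
          unfolding prod.distrib[symmetric]
          by (intro prod.cong refl) (use s CS in \<open>auto simp: u_def tr_def E'_def sign_ind_def indicator_def\<close>)
        ultimately show ?thesis by (simp add: split_chi)
      qed
      show "F ((tr t)(e := s)) = ennreal (exp (- (s * X))) * k t"
      proof (cases "\<forall>f\<in>E'. t f \<in> (if f \<in> S then {0<..} else {..<0})")
        case False
        then have 0: "(\<Prod>f\<in>E'. sign_ind S f (t f)) = 0"
          unfolding sign_ind_def by (simp only: prod_indicator finite if_False)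
        show ?thesis unfolding F_def u_def[symmetric] ind_eq k_def 0 by simp
      next
        case True
        have supp: "{f \<in> edges G. 0 < u f} = S"
        proof -
          have "0 < u f \<longleftrightarrow> f \<in> S" if "f \<in> edges G" for f
          proof (cases "f = e")
            case False
            then have "f \<in> E'" using that by (simp add: E'_def)
            then show ?thesis using True[rule_format, of f] False s CS
              by (auto simp: u_def tr_def split: if_splits)
          qed (use eS s in \<open>simp add: u_def\<close>)
          then show ?thesis using S by auto
        qed
        have "trop c u = s * trop c (ind C) + trop c (\<lambda>f. if f \<in> C then u f - s else u f)"
        proof (rule trop_component)
          show "is_comp {f \<in> edges G. 0 < u f} C" unfolding supp by (rule C)
          show "s \<le> u f" if "f \<in> C" for f
          proof (cases "f = e")
            case False
            then have "f \<in> E'" "f \<in> S" using that CE CS by (auto simp: E'_def)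
            then show ?thesis using True[rule_format, of f] False that by (simp add: u_def tr_def)
          qed (simp add: u_def)
        qed (use s in simp)
        also have "trop c (\<lambda>f. if f \<in> C then u f - s else u f) = trop c (t(e := 0))"
          by (rule trop_cong) (use eC in \<open>auto simp: u_def tr_def E'_def\<close>)
        finally have "exp_trop c u = ennreal (exp (- (s * X))) * exp_trop c (t(e := 0))"
          by (simp add: exp_trop_def X_def ennreal_mult[symmetric] exp_add[symmetric])
        then show ?thesis using ind_eq unfolding F_def u_def[symmetric] k_def by (simp add: mult_ac)
      qed
    qed
    also have "\<dots> = ennreal (exp (- (s * X))) * (\<integral>\<^sup>+t. k t \<partial>lborelP E')"
      using km by (rule nn_integral_cmult)
    finally show ?thesis .
  qed
  have neg: "(\<integral>\<^sup>+t. orthant_ind (S - {e}) (t(e := s)) * exp_trop c (t(e := s)) \<partial>lborelP E')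
      = indicator {..<0} s * ennreal (exp (s * c (Inl e))) * (\<integral>\<^sup>+t. k t \<partial>lborelP E')" for s
  proof -
    have "orthant_ind (S - {e}) (t(e := s)) * exp_trop c (t(e := s)) = indicator {..<0} s * ennreal (exp (s * c (Inl e))) * k t" for t
    proof -
      have "(\<Prod>f\<in>E'. sign_ind (S - {e}) f ((t(e := s)) f)) = (\<Prod>f\<in>E'. sign_ind S f (t f))"
        by (intro prod.cong) (auto simp: E'_def sign_ind_def)
      moreover have "sign_ind (S - {e}) e ((t(e := s)) e) = indicator {..<0} s" by (simp add: sign_ind_def)
      moreover have "exp_trop c (t(e := s)) = ennreal (exp (s * c (Inl e))) * exp_trop c (t(e := 0))" if "s < 0"
        using trop_update_nonpos[OF eS(2), of s c t] that
        by (simp add: exp_trop_def ennreal_mult[symmetric] exp_add[symmetric] algebra_simps)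
      ultimately show ?thesis
        by (cases "s < 0") (simp_all add: split_chi k_def mult_ac)
    qed
    then show ?thesis using km by (simp add: nn_integral_cmult)
  qed
  have "orthant_int c (S - {e}) = (\<integral>\<^sup>+s. \<integral>\<^sup>+t. orthant_ind (S - {e}) (t(e := s)) * exp_trop c (t(e := s)) \<partial>lborelP E' \<partial>lborel)"
    unfolding orthant_int_def E'_def
    by (rule nn_integral_lborelP_insert_rev) (auto intro!: borel_measurable_times_ennreal orthant_ind_measurable exp_trop_measurable eS)
  also have "\<dots> = (\<integral>\<^sup>+s. indicator {..<0} s * ennreal (exp (s * c (Inl e))) \<partial>lborel) * (\<integral>\<^sup>+t. k t \<partial>lborelP E')"
    unfolding neg by (rule nn_integral_multc) measurable
  finally have 1: "orthant_int c (S - {e}) = ennreal (1 / c (Inl e)) * (\<integral>\<^sup>+t. k t \<partial>lborelP E')"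
    by (simp only: nn_integral_exp_neg[OF ce])
  have "(\<integral>\<^sup>+t. F t \<partial>lborelP (edges G)) = (\<integral>\<^sup>+s. \<integral>\<^sup>+t. F (t(e := s)) \<partial>lborelP E' \<partial>lborel)"
    unfolding E'_def by (rule nn_integral_lborelP_insert_rev) (auto intro!: Fm eS)
  also have "\<dots> = (\<integral>\<^sup>+s. indicator {0<..} s * ennreal (exp (- (s * X))) * (\<integral>\<^sup>+t. k t \<partial>lborelP E') \<partial>lborel)"
  proof (intro nn_integral_cong)
    fix s :: real
    show "(\<integral>\<^sup>+t. F (t(e := s)) \<partial>lborelP E') = indicator {0<..} s * ennreal (exp (- (s * X))) * (\<integral>\<^sup>+t. k t \<partial>lborelP E')"
    proof (cases "0 < s")
      case False
      then have "F (t(e := s)) = 0" for t using eS by (simp add: F_def split_chi sign_ind_def)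
      then show ?thesis using False by simp
    qed (simp add: pos)
  qed
  also have "\<dots> = ennreal (1 / X) * (\<integral>\<^sup>+t. k t \<partial>lborelP E')"
    using assms(4) by (subst nn_integral_multc) (measurable, simp add: nn_integral_exp_pos X_def C_def)
  also have "\<dots> = ennreal (c (Inl e) / X) * orthant_int c (S - {e})"
  proof -
    have "ennreal (c (Inl e) / X) * ennreal (1 / c (Inl e)) = ennreal (1 / X)"
      using ce assms(4) by (subst ennreal_mult[symmetric]) (auto simp: X_def C_def)
    then show ?thesis unfolding 1 by (simp add: mult.assoc[symmetric])
  qed
  finally show ?thesis by (simp add: F_def C_def X_def)
qed

lemma AE_distinct:
  "AE t in lborelP (edges G). (\<forall>f\<in>edges G. t f \<noteq> 0) \<and> (\<forall>e\<in>edges G. \<forall>f\<in>edges G. e \<noteq> f \<longrightarrow> t e \<noteq> t f)"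
proof -
  have "AE t in lborelP (edges G). t f \<noteq> 0" if "f \<in> edges G" for f
    using that by (intro AE_lborelP_neq) auto
  moreover have "AE t in lborelP (edges G). e \<noteq> f \<longrightarrow> t e \<noteq> t f" if "e \<in> edges G" "f \<in> edges G" for e f
  proof (cases "e = f")
    case False
    then have "AE t in lborelP (edges G). t e \<noteq> t f"
      using that component_measurable by (intro AE_lborelP_neq[where h="\<lambda>t. t f"]) auto
    then show ?thesis by simp
  qed simp
  ultimately show ?thesis by (simp add: AE_ball_countable countable_finite)
qed

lemma nested_sum_nonneg:
  fixes W :: "'v set set \<Rightarrow> real"
  assumes "\<And>C. C \<in> conn_edge_sets G \<Longrightarrow> 0 < W C" "S \<subseteq> edges G"
  shows "0 \<le> nested_sum W S"
  using assms(2)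
proof (induction rule: nested_sum_induct)
  case (step S)
  have "0 < W (comp S)" using is_comp_comp[OF step(1,2)] assms(1) by (simp add: is_comp_def)
  then show ?case using step by (simp add: nested_sum_rec sum_nonneg)
qed simp

text \<open>Almost every \<open>t\<close> has a unique smallest coordinate on \<open>comp S\<close>,
  so the indicators \<open>min_ind\<close> add up to 1 and \<open>orthant_int_step\<close> applies
  to each piece. Its factor \<open>c (Inl e)\<close> cancels the \<open>1 / c (Inl e)\<close> that
  \<open>e\<close> acquires on leaving \<open>S\<close>, and the recursion of
  \<open>nested_sum\<close> remains.\<close>

lemma orthant_int_eq:
  assumes X: "\<And>C. C \<in> conn_edge_sets G \<Longrightarrow> 0 < trop c (ind C)"
    and c: "\<And>e. e \<in> edges G \<Longrightarrow> 0 < c (Inl e)" and S: "S \<subseteq> edges G"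
  shows "orthant_int c S = ennreal ((\<Prod>e\<in>edges G - S. 1 / c (Inl e)) * nested_sum (\<lambda>C. trop c (ind C)) S)"
  using S
proof (induction rule: nested_sum_induct)
  case empty
  have "orthant_int c {} = ennreal (\<Prod>e\<in>edges G. 1 / c (Inl e))" by (rule orthant_int_empty) (rule c)
  then show ?case by simp
next
  case (step S)
  define C where "C = comp S"
  have C: "is_comp S C" unfolding C_def using step by (intro is_comp_comp)
  have CS: "C \<subseteq> S" "C \<in> conn_edge_sets G" using C by (auto simp: is_comp_def)
  have CE: "C \<subseteq> edges G" using CS step by auto
  have Cne: "C \<noteq> {}" using conn_edge_setsD(1)[OF CS(2)] .
  define P where "P = (\<Prod>e\<in>edges G - S. 1 / c (Inl e))"
  have P: "0 \<le> P" unfolding P_def using c by (intro prod_nonneg) (simp add: less_imp_le)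
  have part: "(\<Sum>e\<in>C. min_ind C e t) = 1" if d: "\<forall>e\<in>edges G. \<forall>f\<in>edges G. e \<noteq> f \<longrightarrow> t e \<noteq> t f" for t :: "'v set \<Rightarrow> real"
  proof -
    obtain m where m: "m \<in> C" "\<And>f. f \<in> C \<Longrightarrow> t m \<le> t f"
      using that[of "arg_min_on t C"] arg_min_if_finite(1)[of C t] arg_min_least[of C _ t] Cne by auto
    have "min_ind C e t = (if e = m then 1 else 0)" if "e \<in> C" for e
    proof (cases "e = m")
      case True
      have "t m < t f" if "f \<in> C - {m}" for f
        using m that d CE by (metis DiffE insertCI order_le_less subsetD)
      then show ?thesis using True by (simp add: min_ind_alt)
    next
      case False
      then have "\<not> t e < t m" using m(2)[OF that] by simp
      then show ?thesis using False m(1) by (auto simp: min_ind_alt)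
    qed
    then show ?thesis using m(1) by simp
  qed
  have "orthant_int c S = (\<integral>\<^sup>+t. (\<Sum>e\<in>C. orthant_ind S t * min_ind C e t * exp_trop c t) \<partial>lborelP (edges G))"
    unfolding orthant_int_def
  proof (rule nn_integral_cong_AE)
    show "AE t in lborelP (edges G). orthant_ind S t * exp_trop c t = (\<Sum>e\<in>C. orthant_ind S t * min_ind C e t * exp_trop c t)"
      using AE_distinct
    proof eventually_elim
      case (elim t)
      have "(\<Sum>e\<in>C. orthant_ind S t * min_ind C e t * exp_trop c t) = orthant_ind S t * (\<Sum>e\<in>C. min_ind C e t) * exp_trop c t"
        by (simp add: sum_distrib_left sum_distrib_right)
      then show ?case using part[of t] elim by simp
    qed
  qed
  also have "\<dots> = (\<Sum>e\<in>C. \<integral>\<^sup>+t. orthant_ind S t * min_ind C e t * exp_trop c t \<partial>lborelP (edges G))"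
    using CE by (intro nn_integral_sum borel_measurable_times_ennreal orthant_ind_measurable min_ind_measurable exp_trop_measurable) auto
  also have "\<dots> = (\<Sum>e\<in>C. ennreal (P * inverse (trop c (ind C)) * nested_sum (\<lambda>C. trop c (ind C)) (S - {e})))"
  proof (intro sum.cong refl)
    fix e assume e: "e \<in> C"
    then have eE: "e \<in> edges G" "e \<in> S" using CE CS by auto
    have ce: "0 < c (Inl e)" using c eE by simp
    have XC: "0 < trop c (ind C)" using X CS by simp
    have nn: "0 \<le> nested_sum (\<lambda>C. trop c (ind C)) (S - {e})"
      using step by (intro nested_sum_nonneg X) auto
    have "edges G - (S - {e}) = insert e (edges G - S)" using eE by auto
    then have pr: "(\<Prod>f\<in>edges G - (S - {e}). 1 / c (Inl f)) = 1 / c (Inl e) * P"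
      using eE by (simp add: P_def)
    have "(\<integral>\<^sup>+t. orthant_ind S t * min_ind C e t * exp_trop c t \<partial>lborelP (edges G))
        = ennreal (c (Inl e) / trop c (ind C)) * ennreal ((1 / c (Inl e) * P) * nested_sum (\<lambda>C. trop c (ind C)) (S - {e}))"
      using orthant_int_step[of S e c] step(1,2) step(3)[of e] e XC ce by (simp add: C_def pr)
    also have "\<dots> = ennreal (c (Inl e) / trop c (ind C) * ((1 / c (Inl e) * P) * nested_sum (\<lambda>C. trop c (ind C)) (S - {e})))"
      using ce XC P nn by (intro ennreal_mult[symmetric]) auto
    also have "c (Inl e) / trop c (ind C) * ((1 / c (Inl e) * P) * nested_sum (\<lambda>C. trop c (ind C)) (S - {e}))
        = P * inverse (trop c (ind C)) * nested_sum (\<lambda>C. trop c (ind C)) (S - {e})"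
      using ce by (simp add: field_simps)
    finally show "(\<integral>\<^sup>+t. orthant_ind S t * min_ind C e t * exp_trop c t \<partial>lborelP (edges G)) = ennreal \<dots>" .
  qed
  also have "\<dots> = ennreal (\<Sum>e\<in>C. P * inverse (trop c (ind C)) * nested_sum (\<lambda>C. trop c (ind C)) (S - {e}))"
  proof (intro sum_ennreal)
    fix e assume "e \<in> C"
    have "0 < trop c (ind C)" using X CS by simp
    moreover have "0 \<le> nested_sum (\<lambda>C. trop c (ind C)) (S - {e})"
      using step by (intro nested_sum_nonneg X) auto
    ultimately show "0 \<le> P * inverse (trop c (ind C)) * nested_sum (\<lambda>C. trop c (ind C)) (S - {e})"
      using P by simp
  qed
  also have "(\<Sum>e\<in>C. P * inverse (trop c (ind C)) * nested_sum (\<lambda>C. trop c (ind C)) (S - {e}))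
      = P * nested_sum (\<lambda>C. trop c (ind C)) S"
    using step(1,2) by (simp add: nested_sum_rec C_def sum_distrib_left mult.assoc)
  finally show ?case by (simp add: P_def)
qed

lemma nn_integral_trop:
  assumes X: "\<And>C. C \<in> conn_edge_sets G \<Longrightarrow> 0 < trop c (ind C)"
    and c: "\<And>e. e \<in> edges G \<Longrightarrow> 0 < c (Inl e)"
  shows "(\<integral>\<^sup>+t. ennreal (exp (- trop c t)) \<partial>lborelP (edges G))
    = ennreal (\<Sum>S\<in>Pow (edges G). (\<Prod>e\<in>edges G - S. 1 / c (Inl e)) * nested_sum (\<lambda>C. trop c (ind C)) S)"
proof -
  have "(\<integral>\<^sup>+t. exp_trop c t \<partial>lborelP (edges G)) = (\<integral>\<^sup>+t. (\<Sum>S\<in>Pow (edges G). orthant_ind S t * exp_trop c t) \<partial>lborelP (edges G))"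
  proof (rule nn_integral_cong_AE)
    show "AE t in lborelP (edges G). exp_trop c t = (\<Sum>S\<in>Pow (edges G). orthant_ind S t * exp_trop c t)"
      using AE_distinct
    proof eventually_elim
      case (elim t)
      have "orthant_ind S t = (if S = {f \<in> edges G. 0 < t f} then 1 else 0)" if "S \<in> Pow (edges G)" for S
      proof -
        have "(\<forall>f\<in>edges G. if f \<in> S then 0 < t f else t f < 0) \<longleftrightarrow> S = {f \<in> edges G. 0 < t f}"
        proof
          assume "\<forall>f\<in>edges G. if f \<in> S then 0 < t f else t f < 0"
          then show "S = {f \<in> edges G. 0 < t f}" using that by (auto split: if_splits)
        qed (use elim in \<open>auto simp: not_less order_le_less\<close>)
        then show ?thesis by (simp add: orthant_ind_alt)
      qed
      then have "(\<Sum>S\<in>Pow (edges G). orthant_ind S t) = 1" by (simp add: Pow_def)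
      then show ?case by (simp add: sum_distrib_right[symmetric])
    qed
  qed
  also have "\<dots> = (\<Sum>S\<in>Pow (edges G). orthant_int c S)"
    unfolding orthant_int_def
    by (intro nn_integral_sum borel_measurable_times_ennreal orthant_ind_measurable exp_trop_measurable)
  also have "\<dots> = (\<Sum>S\<in>Pow (edges G). ennreal ((\<Prod>e\<in>edges G - S. 1 / c (Inl e)) * nested_sum (\<lambda>C. trop c (ind C)) S))"
    by (intro sum.cong refl orthant_int_eq X c) auto
  also have "\<dots> = ennreal (\<Sum>S\<in>Pow (edges G). (\<Prod>e\<in>edges G - S. 1 / c (Inl e)) * nested_sum (\<lambda>C. trop c (ind C)) S)"
    using X c by (intro sum_ennreal mult_nonneg_nonneg nested_sum_nonneg prod_nonneg) (auto simp: less_imp_le)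
  finally show ?thesis by (simp add: exp_trop_def)
qed

end

section \<open>Maximal tubings of trees\<close>

lemma subgraph_trans: "subgraph A B \<Longrightarrow> subgraph B C \<Longrightarrow> subgraph A C"
  by (auto simp: subgraph_def)

lemma subgraph_antisym: "subgraph A B \<Longrightarrow> subgraph B A \<Longrightarrow> A = B"
  by (auto simp: subgraph_def prod_eq_iff)

lemma connected_subgraphs_trans:
  "H \<in> connected_subgraphs K \<Longrightarrow> subgraph K L \<Longrightarrow> H \<in> connected_subgraphs L"
  by (auto simp: connected_subgraphs_def intro: subgraph_trans)

lemma connected_graph_nonempty: "connected_graph K \<Longrightarrow> verts K \<noteq> {}"
  by (simp add: connected_graph_def)

section \<open>Components described by reachability\<close>

definition reach :: "'v set set \<Rightarrow> 'v \<Rightarrow> 'v set" where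
  "reach S v = {w. (v, w) \<in> (adj S)\<^sup>*}"

text \<open>The component of \<open>v\<close> in the graph with edges \<open>S\<close>; an isolated
  \<open>v\<close> yields the one-vertex graph, so single-vertex tubes are covered.\<close>

definition cgraph :: "'v set set \<Rightarrow> 'v \<Rightarrow> 'v graph" where
  "cgraph S v = (reach S v, {f \<in> S. f \<subseteq> reach S v})"

lemma reach_refl [simp]: "v \<in> reach S v"
  by (simp add: reach_def)

lemma reach_step: "a \<in> reach S v \<Longrightarrow> {a, b} \<in> S \<Longrightarrow> b \<in> reach S v"
  by (auto simp: reach_def adj_def intro: rtrancl_into_rtrancl)

lemma reach_eq: "w \<in> reach S v \<Longrightarrow> reach S w = reach S v"
  using adj_rtrancl_sym[of v w S] by (auto simp: reach_def intro: rtrancl_trans)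

lemma cgraph_eq: "w \<in> reach S v \<Longrightarrow> cgraph S w = cgraph S v"
  by (simp add: cgraph_def reach_eq)

lemma reach_induct [consumes 1, case_names base step]:
  assumes "w \<in> reach S v" "P v" "\<And>a b. a \<in> reach S v \<Longrightarrow> P a \<Longrightarrow> {a, b} \<in> S \<Longrightarrow> P b"
  shows "P w"
proof -
  have "(v, w) \<in> (adj S)\<^sup>*" using assms(1) by (simp add: reach_def)
  then show ?thesis
  proof (induction rule: rtrancl_induct)
    case (step a b)
    then show ?case using assms(3)[of a b] by (simp add: reach_def adj_def)
  qed (rule assms(2))
qed

lemma reach_mono: "S \<subseteq> T \<Longrightarrow> reach S v \<subseteq> reach T v"
  by (auto simp: reach_def intro: adj_rtrancl_mono)

lemma reach_subset: "v \<in> A \<Longrightarrow> \<Union>S \<subseteq> A \<Longrightarrow> reach S v \<subseteq> A"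
  by (auto simp: reach_def intro: adj_rtrancl_Union)

lemma reach_connected:
  assumes "connected_graph K" "v \<in> verts K" "\<Union>(edges K) \<subseteq> verts K"
  shows "reach (edges K) v = verts K"
  using assms reach_subset[of v "verts K" "edges K"] by (auto simp: connected_graph_adj reach_def)

lemma connected_cgraph: "connected_graph (cgraph S v)"
proof -
  define S' where "S' = {f \<in> S. f \<subseteq> reach S v}"
  have "w \<in> reach S' v" if "w \<in> reach S v" for w
    using that
  proof (induction rule: reach_induct)
    case (step a b)
    then have "{a, b} \<in> S'" using reach_step[of a S v b] by (auto simp: S'_def)
    then show ?case by (intro reach_step[OF step.IH])
  qed simp
  then have *: "(v, w) \<in> (adj S')\<^sup>*" if "w \<in> reach S v" for w
    using that by (simp add: reach_def)
  show ?thesis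
    unfolding connected_graph_adj cgraph_def S'_def[symmetric] fst_conv snd_conv
  proof (intro conjI ballI)
    show "reach S v \<noteq> {}" using reach_refl[of v S] by blast
    fix a b assume "a \<in> reach S v" "b \<in> reach S v"
    then show "(a, b) \<in> (adj S')\<^sup>*"
      using rtrancl_trans[OF adj_rtrancl_sym[OF *] *] by blast
  qed
qed

lemma subgraph_cgraph:
  assumes "connected_graph L" "edges L \<subseteq> S" "\<Union>(edges L) \<subseteq> verts L" "v \<in> verts L"
  shows "subgraph L (cgraph S v)"
proof -
  have "verts L \<subseteq> reach S v"
    using reach_connected[OF assms(1,4,3)] reach_mono[OF assms(2)] by blast
  then show ?thesis using assms by (auto simp: subgraph_def cgraph_def)
qed

lemma connected_subgraphsD:
  assumes "H \<in> connected_subgraphs K"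
  shows "verts H \<subseteq> verts K" "edges H \<subseteq> edges K" "\<Union>(edges H) \<subseteq> verts H" "connected_graph H" "verts H \<noteq> {}"
  using assms by (auto simp: connected_subgraphs_def subgraph_def connected_graph_def)

lemma cgraph_in_connected_subgraphs:
  assumes "v \<in> verts K" "S \<subseteq> edges K" "\<Union>(edges K) \<subseteq> verts K"
  shows "cgraph S v \<in> connected_subgraphs K"
  using reach_subset[of v "verts K" S] assms connected_cgraph[of S v]
  by (auto simp: connected_subgraphs_def subgraph_def cgraph_def)

lemma components_of_graph_eq:
  assumes "\<Union>S \<subseteq> V" shows "components_of_graph (V, S) = cgraph S ` V"
proof
  show "components_of_graph (V, S) \<subseteq> cgraph S ` V"
  proof
    fix K assume K: "K \<in> components_of_graph (V, S)"
    then have K': "K \<in> connected_subgraphs (V, S)" by (simp add: components_of_graph_def)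
    note D = connected_subgraphsD[OF K']
    obtain v where v: "v \<in> verts K" using D(5) by blast
    have "cgraph S v \<in> connected_subgraphs (V, S)"
      using v D assms by (intro cgraph_in_connected_subgraphs) auto
    moreover have "subgraph K (cgraph S v)" using D v by (intro subgraph_cgraph) auto
    ultimately have "cgraph S v = K" using K by (auto simp: components_of_graph_def)
    then show "K \<in> cgraph S ` V" using v D by auto
  qed
  show "cgraph S ` V \<subseteq> components_of_graph (V, S)"
  proof
    fix K assume "K \<in> cgraph S ` V"
    then obtain v where v: "v \<in> V" and K: "K = cgraph S v" by blast
    have "L = cgraph S v" if L: "L \<in> connected_subgraphs (V, S)" "subgraph (cgraph S v) L" for L
    proof (rule subgraph_antisym[OF _ L(2)])
      have "v \<in> verts L" using L(2) by (auto simp: subgraph_def cgraph_def)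
      then show "subgraph L (cgraph S v)" using connected_subgraphsD[OF L(1)] by (intro subgraph_cgraph) auto
    qed
    then show "K \<in> components_of_graph (V, S)"
      unfolding K using cgraph_in_connected_subgraphs[of v "(V, S)" S] v assms by (simp add: components_of_graph_def)
  qed
qed

text \<open>If the new step returns to a vertex already visited, the path is cut at that vertex;
  otherwise it is prolonged.\<close>

lemma rtrancl_distinct_path:
  assumes "(u, v) \<in> r\<^sup>*"
  shows "\<exists>xs. xs \<noteq> [] \<and> hd xs = u \<and> last xs = v \<and> distinct xs \<and> (\<forall>i. Suc i < length xs \<longrightarrow> (xs ! i, xs ! Suc i) \<in> r)"
  using assms
proof (induction rule: rtrancl_induct)
  case base
  show ?case by (rule exI[of _ "[u]"]) simp
next
  case (step y z)
  then obtain xs where xs: "xs \<noteq> []" "hd xs = u" "last xs = y" "distinct xs"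
    "\<And>i. Suc i < length xs \<Longrightarrow> (xs ! i, xs ! Suc i) \<in> r" by blast
  show ?case
  proof (cases "z \<in> set xs")
    case True
    then obtain k where k: "k < length xs" "xs ! k = z" by (auto simp: in_set_conv_nth)
    define ys where "ys = take (Suc k) xs"
    have "last ys = z" using k by (simp add: ys_def take_Suc_conv_app_nth)
    moreover have "hd ys = u" "ys \<noteq> []" using xs by (auto simp: ys_def)
    moreover have "distinct ys" using xs by (simp add: ys_def)
    moreover have "(ys ! i, ys ! Suc i) \<in> r" if "Suc i < length ys" for i
      using that xs(5)[of i] by (simp add: ys_def)
    ultimately show ?thesis by blast
  next
    case False
    have "((xs @ [z]) ! i, (xs @ [z]) ! Suc i) \<in> r" if "Suc i < length (xs @ [z])" for i
    proof (cases "Suc i < length xs")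
      case True
      then show ?thesis using xs(5)[of i] by (simp add: nth_append)
    next
      case False
      then have "i = length xs - 1" "Suc i = length xs" using that xs(1) by auto
      then show ?thesis using step(2) xs(1,3) by (simp add: nth_append last_conv_nth)
    qed
    then show ?thesis using xs False by (intro exI[of _ "xs @ [z]"]) auto
  qed
qed

locale forest_graph = simple_graph +
  assumes acyclic: "\<nexists>c. is_cycle G c"
begin

text \<open>A simple path in \<open>S\<close> from \<open>u\<close> to \<open>v\<close> has at least
  three vertices because \<open>{u, v}\<close> is missing from \<open>S\<close>, and the edge
  \<open>{u, v}\<close> closes it to a cycle.\<close>

lemma no_detour:
  assumes "{u, v} \<in> edges G" "u \<noteq> v" "S \<subseteq> edges G" "{u, v} \<notin> S"
  shows "v \<notin> reach S u"
proof
  assume "v \<in> reach S u"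
  then obtain xs where xs: "xs \<noteq> []" "hd xs = u" "last xs = v" "distinct xs"
    "\<And>i. Suc i < length xs \<Longrightarrow> (xs ! i, xs ! Suc i) \<in> adj S"
    using rtrancl_distinct_path[of u v "adj S"] by (auto simp: reach_def)
  have h: "xs ! 0 = u" "xs ! (length xs - 1) = v" using xs by (auto simp: hd_conv_nth last_conv_nth)
  have "length xs \<noteq> 1" using h assms(2) by auto
  moreover have "length xs \<noteq> 2"
  proof
    assume "length xs = 2"
    then have "(u, v) \<in> adj S" using xs(5)[of 0] h by (simp add: numeral_2_eq_2)
    then show False using assms(4) by (simp add: adj_def)
  qed
  ultimately have len: "3 \<le> length xs" using xs(1) by (cases "length xs") auto
  have "is_cycle G xs"
    unfolding is_cycle_def
  proof (intro conjI allI impI len xs(4))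
    fix i assume i: "i < length xs"
    show "{xs ! i, xs ! (Suc i mod length xs)} \<in> edges G"
    proof (cases "Suc i < length xs")
      case True
      then show ?thesis using xs(5)[of i] assms(3) by (auto simp: adj_def)
    next
      case False
      then have "Suc i = length xs" using i by simp
      then have "Suc i mod length xs = 0" "i = length xs - 1" by auto
      then show ?thesis using h assms(1) by (simp add: insert_commute)
    qed
  qed
  then show False using acyclic by blast
qed

text \<open>An edge of \<open>G\<close> missing between two vertices of a connected subgraph would
  be bypassed inside it. Hence in a forest a tube is determined by its vertices, and compatibility
  becomes a condition on vertex sets (\<open>compatible_iff\<close>).\<close>

lemma connected_subgraph_induced:
  assumes "H \<in> connected_subgraphs G" "a \<in> verts H" "b \<in> verts H" "{a, b} \<in> edges G" "a \<noteq> b"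
  shows "{a, b} \<in> edges H"
proof (rule ccontr)
  assume "{a, b} \<notin> edges H"
  moreover have "b \<in> reach (edges H) a"
    using reach_connected[of H a] connected_subgraphsD[OF assms(1)] assms by auto
  ultimately show False using no_detour[OF assms(4,5)] connected_subgraphsD(2)[OF assms(1)] by blast
qed

lemma subgraph_iff_verts:
  assumes "A \<in> connected_subgraphs G" "B \<in> connected_subgraphs G"
  shows "subgraph A B \<longleftrightarrow> verts A \<subseteq> verts B"
proof
  assume le: "verts A \<subseteq> verts B"
  have "f \<in> edges B" if f: "f \<in> edges A" for f
  proof -
    have fG: "f \<in> edges G" using f connected_subgraphsD(2)[OF assms(1)] by blast
    then obtain a b where ab: "a \<noteq> b" "f = {a, b}" using edge_doubleton by blast
    then have "a \<in> verts B" "b \<in> verts B" using f connected_subgraphsD(3)[OF assms(1)] le by auto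
    then show ?thesis using connected_subgraph_induced[OF assms(2), of a b] ab fG by simp
  qed
  then show "subgraph A B" using le connected_subgraphsD(3)[OF assms(1)] by (auto simp: subgraph_def)
qed (simp add: subgraph_def)

lemma verts_inject:
  assumes "A \<in> connected_subgraphs G" "B \<in> connected_subgraphs G" "verts A = verts B"
  shows "A = B"
  using assms subgraph_iff_verts by (intro subgraph_antisym) auto

lemma compatible_iff:
  assumes "A \<in> connected_subgraphs G" "B \<in> connected_subgraphs G"
  shows "compatible_tubes A B \<longleftrightarrow> verts A \<subseteq> verts B \<or> verts B \<subseteq> verts A \<or> verts A \<inter> verts B = {}"
proof -
  have "edges A \<inter> edges B = {}" if d: "verts A \<inter> verts B = {}"
  proof (rule ccontr)
    assume "edges A \<inter> edges B \<noteq> {}"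
    then obtain f where f: "f \<in> edges A" "f \<in> edges B" by blast
    then have "f \<noteq> {}" using edge_nonempty connected_subgraphsD(2)[OF assms(1)] by blast
    then show False using f d connected_subgraphsD(3)[OF assms(1)] connected_subgraphsD(3)[OF assms(2)] by blast
  qed
  then show ?thesis unfolding compatible_tubes_def subgraph_iff_verts[OF assms] subgraph_iff_verts[OF assms(2,1)] by blast
qed

section \<open>Removing an edge from a tube\<close>

definition end1 :: "'a set \<Rightarrow> 'a" where
  "end1 e = (SOME a. a \<in> e)"

definition end2 :: "'a set \<Rightarrow> 'a" where
  "end2 e = (SOME b. b \<in> e - {end1 e})"

lemma ends:
  assumes "e \<in> edges G" shows "e = {end1 e, end2 e}" "end1 e \<noteq> end2 e"
proof -
  obtain a b where ab: "a \<noteq> b" "e = {a, b}" using edge_doubleton[OF assms] by blast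
  have 1: "end1 e \<in> e" unfolding end1_def using ab by (intro someI[of "\<lambda>x. x \<in> e" a]) auto
  then have "e - {end1 e} \<noteq> {}" using ab by auto
  then have 2: "end2 e \<in> e - {end1 e}" unfolding end2_def by (meson all_not_in_conv someI_ex)
  show "e = {end1 e, end2 e}" "end1 e \<noteq> end2 e" using 1 2 ab by auto
qed

definition side1 :: "'a graph \<Rightarrow> 'a set \<Rightarrow> 'a graph" where
  "side1 K e = cgraph (edges K - {e}) (end1 e)"

definition side2 :: "'a graph \<Rightarrow> 'a set \<Rightarrow> 'a graph" where
  "side2 K e = cgraph (edges K - {e}) (end2 e)"

lemma subgraph_KG: "K \<in> connected_subgraphs K' \<Longrightarrow> subgraph K K'"
  by (simp add: connected_subgraphs_def)

lemma tubingsD: "T \<in> tubings K \<Longrightarrow> H \<in> T \<Longrightarrow> H \<in> connected_subgraphs K"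
  unfolding tubings_def by blast

lemma tubings_verts: "T \<in> tubings K \<Longrightarrow> H \<in> T \<Longrightarrow> verts H \<subseteq> verts K"
  by (rule connected_subgraphsD(1)[OF tubingsD])

lemma tubings_G: "T \<in> tubings K \<Longrightarrow> K \<in> connected_subgraphs G \<Longrightarrow> H \<in> T \<Longrightarrow> H \<in> connected_subgraphs G"
  by (rule connected_subgraphs_trans[OF tubingsD subgraph_KG])

context
  fixes K e assumes K: "K \<in> connected_subgraphs G" and e: "e \<in> edges K"
begin

lemma eG: "e \<in> edges G"
  using connected_subgraphsD(2)[OF K] e by blast

lemma ends_in: "end1 e \<in> verts K" "end2 e \<in> verts K"
proof -
  have "e \<subseteq> verts K" using e connected_subgraphsD(3)[OF K] by blast
  then show "end1 e \<in> verts K" "end2 e \<in> verts K" using ends(1)[OF eG] by blast+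
qed

lemma sides_conn: "side1 K e \<in> connected_subgraphs K" "side2 K e \<in> connected_subgraphs K"
  unfolding side1_def side2_def using ends_in connected_subgraphsD(3)[OF K]
  by (intro cgraph_in_connected_subgraphs; auto)+

lemma sides_connG: "side1 K e \<in> connected_subgraphs G" "side2 K e \<in> connected_subgraphs G"
  using sides_conn subgraph_KG[OF K] connected_subgraphs_trans by blast+

lemma sides_disjoint: "verts (side1 K e) \<inter> verts (side2 K e) = {}"
proof (rule ccontr)
  define S where "S = edges K - {e}"
  assume "verts (side1 K e) \<inter> verts (side2 K e) \<noteq> {}"
  then obtain w where w: "w \<in> reach S (end1 e)" "w \<in> reach S (end2 e)" by (auto simp: side1_def side2_def cgraph_def S_def)
  then have "end2 e \<in> reach S (end1 e)" using reach_eq[OF w(1)] reach_eq[OF w(2)] by (metis reach_refl)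
  moreover have "{end1 e, end2 e} \<in> edges G" "{end1 e, end2 e} \<notin> S" "S \<subseteq> edges G"
    using ends(1)[OF eG] eG connected_subgraphsD(2)[OF K] by (auto simp: S_def)
  ultimately show False using no_detour ends(2)[OF eG] by blast
qed

lemma sides_verts: "verts (side1 K e) \<union> verts (side2 K e) = verts K"
proof
  show "verts (side1 K e) \<union> verts (side2 K e) \<subseteq> verts K"
    using connected_subgraphsD(1)[OF sides_conn(1)] connected_subgraphsD(1)[OF sides_conn(2)] by blast
  show "verts K \<subseteq> verts (side1 K e) \<union> verts (side2 K e)"
  proof
    fix w assume "w \<in> verts K"
    then have "w \<in> reach (edges K) (end1 e)"
      using reach_connected[of K "end1 e"] connected_subgraphsD[OF K] ends_in by auto
    then show "w \<in> verts (side1 K e) \<union> verts (side2 K e)"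
    proof (induction rule: reach_induct)
      case base
      show ?case by (simp add: side1_def cgraph_def)
    next
      case (step a b)
      show ?case
      proof (cases "{a, b} = e")
        case True
        then have "b = end1 e \<or> b = end2 e" using ends(1)[OF eG] by (auto simp: doubleton_eq_iff)
        then show ?thesis by (auto simp: side1_def side2_def cgraph_def)
      next
        case False
        then show ?thesis using step(2,3) reach_step[of a "edges K - {e}" _ b]
          by (auto simp: side1_def side2_def cgraph_def)
      qed
    qed
  qed
qed

lemma sides_psubset: "verts (side1 K e) \<subset> verts K" "verts (side2 K e) \<subset> verts K"
  using sides_disjoint sides_verts connected_subgraphsD(5)[OF sides_conn(1)] connected_subgraphsD(5)[OF sides_conn(2)] by blast+

lemma sides_edges: "f \<in> edges K \<Longrightarrow> f \<noteq> e \<Longrightarrow> f \<in> edges (side1 K e) \<or> f \<in> edges (side2 K e)"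
proof -
  assume f: "f \<in> edges K" "f \<noteq> e"
  then obtain a b where ab: "f = {a, b}" using edge_doubleton connected_subgraphsD(2)[OF K] by blast
  then have "a \<in> verts K" using f connected_subgraphsD(3)[OF K] by auto
  then have "a \<in> verts (side1 K e) \<or> a \<in> verts (side2 K e)" using sides_verts by blast
  then show ?thesis
    using f ab reach_step[of a "edges K - {e}" _ b] by (auto simp: side1_def side2_def cgraph_def)
qed

lemma e_notin_K12: "e \<notin> edges (side1 K e)" "e \<notin> edges (side2 K e)"
  by (auto simp: side1_def side2_def cgraph_def)

text \<open>\<open>H\<close> is connected by paths that avoid \<open>e\<close>, so it stays within
  one component of \<open>K\<close> after the removal of \<open>e\<close>.\<close>

lemma avoids_edge:
  assumes H: "H \<in> connected_subgraphs K" "e \<notin> edges H"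
  shows "verts H \<subseteq> verts (side1 K e) \<or> verts H \<subseteq> verts (side2 K e)"
proof -
  note D = connected_subgraphsD[OF H(1)]
  obtain v where v: "v \<in> verts H" using D(5) by blast
  have sub: "verts H \<subseteq> reach (edges K - {e}) v"
    using subgraph_cgraph[OF D(4) _ D(3) v, of "edges K - {e}"] D(2) H(2) by (auto simp: subgraph_def cgraph_def)
  have "v \<in> verts (side1 K e) \<or> v \<in> verts (side2 K e)" using v D(1) sides_verts by blast
  then show ?thesis using sub by (auto simp: side1_def side2_def cgraph_def reach_eq)
qed

lemma tubings_sides:
  assumes "T \<in> tubings K" "i \<in> {side1 K e, side2 K e}"
  shows "{H \<in> T. verts H \<subseteq> verts i} \<in> tubings i"
proof -
  have i: "i \<in> connected_subgraphs G" using assms(2) sides_connG by auto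
  have "H \<in> connected_subgraphs i" if "H \<in> T" "verts H \<subseteq> verts i" for H
  proof -
    have HG: "H \<in> connected_subgraphs G"
      by (rule tubings_G[OF assms(1) K that(1)])
    then have "subgraph H i" using subgraph_iff_verts i that by blast
    then show ?thesis using connected_subgraphsD(4)[OF HG] by (simp add: connected_subgraphs_def)
  qed
  then show ?thesis using assms(1) by (auto simp: tubings_def)
qed

end

section \<open>Gluing and splitting maximal tubings\<close>

lemma tubings_compatible:
  "T \<in> tubings K \<Longrightarrow> A \<in> T \<Longrightarrow> B \<in> T \<Longrightarrow> compatible_tubes A B"
  by (auto simp: tubings_def)

lemma maximal_tubings_tubings: "T \<in> maximal_tubings K \<Longrightarrow> T \<in> tubings K"
  by (simp add: maximal_tubings_def)

lemma self_connected: "K \<in> connected_subgraphs G \<Longrightarrow> K \<in> connected_subgraphs K"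
  by (auto simp: connected_subgraphs_def subgraph_def)

lemma maximal_tubing_self:
  assumes K: "K \<in> connected_subgraphs G" and T: "T \<in> maximal_tubings K" shows "K \<in> T"
proof -
  have Tt: "T \<in> tubings K" using T by (simp add: maximal_tubings_def)
  have "subgraph H K" if "H \<in> insert K T" for H
    using that Tt self_connected[OF K] by (auto simp: tubings_def connected_subgraphs_def)
  then have "insert K T \<in> tubings K"
    using Tt self_connected[OF K] unfolding tubings_def compatible_tubes_def by blast
  then have "insert K T = T" using T by (auto simp: maximal_tubings_def)
  then show ?thesis by blast
qed

lemma glue_tubings:
  assumes K: "K \<in> connected_subgraphs G" and e: "e \<in> edges K"
    and T1: "T1 \<in> tubings (side1 K e)" and T2: "T2 \<in> tubings (side2 K e)"
  shows "insert K (T1 \<union> T2) \<in> tubings K"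
proof -
  have s1: "T1 \<subseteq> connected_subgraphs (side1 K e)" and s2: "T2 \<subseteq> connected_subgraphs (side2 K e)"
    using T1 T2 by (auto simp: tubings_def)
  have sub: "subgraph (side1 K e) K" "subgraph (side2 K e) K"
    using sides_conn[OF K e] by (auto simp: connected_subgraphs_def)
  have inK: "insert K (T1 \<union> T2) \<subseteq> connected_subgraphs K"
    using s1 s2 sub self_connected[OF K] connected_subgraphs_trans by blast
  have inG: "H \<in> connected_subgraphs G" if "H \<in> insert K (T1 \<union> T2)" for H
    by (rule connected_subgraphs_trans[OF subsetD[OF inK that] subgraph_KG[OF K]])
  have "compatible_tubes A B" if A: "A \<in> insert K (T1 \<union> T2)" and B: "B \<in> insert K (T1 \<union> T2)" for A B
  proof -
    have v1: "verts H \<subseteq> verts (side1 K e)" if "H \<in> T1" for H by (rule tubings_verts[OF T1 that])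
    have v2: "verts H \<subseteq> verts (side2 K e)" if "H \<in> T2" for H by (rule tubings_verts[OF T2 that])
    have vK: "verts H \<subseteq> verts K" if "H \<in> insert K (T1 \<union> T2)" for H
      by (rule connected_subgraphsD(1)[OF subsetD[OF inK that]])
    note comp = compatible_iff[OF inG[OF A] inG[OF B]]
    consider "A = K" | "B = K" | "A \<in> T1" "B \<in> T1" | "A \<in> T2" "B \<in> T2" | "A \<in> T1" "B \<in> T2" | "A \<in> T2" "B \<in> T1"
      using A B by blast
    then show ?thesis
    proof cases
      case 1 then show ?thesis using comp vK[OF B] by simp
    next
      case 2 then show ?thesis using comp vK[OF A] by simp
    next
      case 3 then show ?thesis using tubings_compatible[OF T1] by simp
    next
      case 4 then show ?thesis using tubings_compatible[OF T2] by simp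
    next
      case 5 then show ?thesis using comp v1[of A] v2[of B] sides_disjoint[OF K e] by blast
    next
      case 6 then show ?thesis using comp v1[of B] v2[of A] sides_disjoint[OF K e] by blast
    qed
  qed
  then show ?thesis using inK by (auto simp: tubings_def)
qed

text \<open>In a larger tubing, the tubes inside each side are those of \<open>T1\<close> and
  \<open>T2\<close> by maximality there. A tube that contains \<open>e\<close> meets both sides,
  which are tubes themselves, without lying in either; by compatibility it contains both and hence
  equals \<open>K\<close>.\<close>

lemma glue_maximal:
  assumes K: "K \<in> connected_subgraphs G" and e: "e \<in> edges K"
    and T1: "T1 \<in> maximal_tubings (side1 K e)" and T2: "T2 \<in> maximal_tubings (side2 K e)"
  shows "insert K (T1 \<union> T2) \<in> maximal_tubings K"
proof -
  note c1 = sides_connG(1)[OF K e] and c2 = sides_connG(2)[OF K e]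
  have self: "side1 K e \<in> T1" "side2 K e \<in> T2" using maximal_tubing_self[OF c1 T1] maximal_tubing_self[OF c2 T2] .
  have max: "T' = insert K (T1 \<union> T2)" if T': "T' \<in> tubings K" "insert K (T1 \<union> T2) \<subseteq> T'" for T'
  proof
    have "{H \<in> T'. verts H \<subseteq> verts (side1 K e)} = T1" "{H \<in> T'. verts H \<subseteq> verts (side2 K e)} = T2"
    proof -
      have "H \<in> {H \<in> T'. verts H \<subseteq> verts (side1 K e)}" if "H \<in> T1" for H
        using T'(2) that tubings_verts[OF maximal_tubings_tubings[OF T1] that] by blast
      moreover have "H \<in> {H \<in> T'. verts H \<subseteq> verts (side2 K e)}" if "H \<in> T2" for H
        using T'(2) that tubings_verts[OF maximal_tubings_tubings[OF T2] that] by blast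
      ultimately have "T1 \<subseteq> {H \<in> T'. verts H \<subseteq> verts (side1 K e)}" "T2 \<subseteq> {H \<in> T'. verts H \<subseteq> verts (side2 K e)}"
        by (simp_all only: subsetI)
      then show "{H \<in> T'. verts H \<subseteq> verts (side1 K e)} = T1" "{H \<in> T'. verts H \<subseteq> verts (side2 K e)} = T2"
        using tubings_sides[OF K e T'(1)] T1 T2 by (auto simp: maximal_tubings_def)
    qed
    note eqs = this
    show "T' \<subseteq> insert K (T1 \<union> T2)"
    proof
      fix H assume H: "H \<in> T'"
      have HG: "H \<in> connected_subgraphs G" using tubings_G[OF T'(1) K H] .
      have HK: "H \<in> connected_subgraphs K" using H T'(1) by (auto simp: tubings_def)
      show "H \<in> insert K (T1 \<union> T2)"
      proof (cases "e \<in> edges H")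
        case False
        from avoids_edge[OF K e HK False] show ?thesis using eqs H by blast
      next
        case True
        have "e \<subseteq> verts H" using True connected_subgraphsD(3)[OF HG] by blast
        then have ends_H: "end1 e \<in> verts H" "end2 e \<in> verts H" using ends(1)[OF eG[OF K e]] by blast+
        have uv: "end1 e \<in> verts (side1 K e)" "end2 e \<in> verts (side2 K e)" by (auto simp: side1_def side2_def cgraph_def)
        have "compatible_tubes H (side1 K e)" "compatible_tubes H (side2 K e)"
          using T' H self tubings_compatible by blast+
        then have "verts (side1 K e) \<subseteq> verts H" "verts (side2 K e) \<subseteq> verts H"
          unfolding compatible_iff[OF HG c1] compatible_iff[OF HG c2] using ends_H uv sides_disjoint[OF K e] by blast+
        then have "verts H = verts K" using sides_verts[OF K e] connected_subgraphsD(1)[OF HK] by blast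
        then show ?thesis using verts_inject[OF HG K] by simp
      qed
    qed
  qed (rule T'(2))
  show ?thesis
    unfolding maximal_tubings_def
    using glue_tubings[OF K e maximal_tubings_tubings[OF T1] maximal_tubings_tubings[OF T2]] max
    by (intro CollectI conjI ballI impI)
qed

text \<open>If the proper tubes of a tubing covered all edges, then an edge leaving a maximal proper
  tube would be covered by a tube overlapping it.\<close>

lemma uncovered_edge:
  assumes K: "K \<in> connected_subgraphs G" and ne: "edges K \<noteq> {}" and T: "T \<in> tubings K"
  shows "\<exists>e\<in>edges K. \<forall>H\<in>T. H \<noteq> K \<longrightarrow> e \<notin> edges H"
proof (rule ccontr)
  assume "\<not> ?thesis"
  then have cov: "\<And>e. e \<in> edges K \<Longrightarrow> \<exists>H\<in>T. H \<noteq> K \<and> e \<in> edges H" by blast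
  define P where "P = {H \<in> T. H \<noteq> K}"
  obtain e0 where "e0 \<in> edges K" using ne by blast
  from cov[OF this] obtain A0 where "A0 \<in> P" unfolding P_def by blast
  then have "verts ` P \<noteq> {}" by blast
  from finite_has_maximal[OF finite this]
  obtain W where W: "W \<in> verts ` P" "\<And>W'. W' \<in> verts ` P \<Longrightarrow> W \<subseteq> W' \<Longrightarrow> W' = W"
    by metis
  then obtain A where A: "A \<in> P" "W = verts A" by blast
  have AT: "A \<in> T" "A \<noteq> K" using A by (auto simp: P_def)
  have AG: "A \<in> connected_subgraphs G" using tubings_G[OF T K AT(1)] .
  have AK: "verts A \<subseteq> verts K" by (rule tubings_verts[OF T AT(1)])
  then obtain x where x: "x \<in> verts K" "x \<notin> verts A" using verts_inject[OF AG K] AT(2) by blast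
  obtain a where a: "a \<in> verts A" using connected_subgraphsD(5)[OF AG] by blast
  have "x \<in> reach (edges K) a"
    using reach_connected[of K a] connected_subgraphsD[OF K] a AK x by auto
  moreover have "w \<in> verts A" if "w \<in> reach (edges K) a" for w
    using that
  proof (induction rule: reach_induct)
    case (step c d)
    show ?case
    proof (rule ccontr)
      assume d: "d \<notin> verts A"
      obtain B where B: "B \<in> T" "B \<noteq> K" "{c, d} \<in> edges B" using cov step.hyps(2) by blast
      have BG: "B \<in> connected_subgraphs G" using tubings_G[OF T K B(1)] .
      have cd: "c \<in> verts B" "d \<in> verts B" using B(3) connected_subgraphsD(3)[OF BG] by auto
      have "compatible_tubes A B" using tubings_compatible[OF T AT(1) B(1)] .
      then have "verts A \<subseteq> verts B"
        unfolding compatible_iff[OF AG BG] using cd step.IH d by blast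
      then have "verts B = verts A" using W(2)[of "verts B"] B A by (auto simp: P_def)
      then show False using cd d by simp
    qed
  qed (rule a)
  ultimately show False using x by blast
qed

text \<open>A larger tubing on one side glues with the tubes of the other side to a tubing
  containing \<open>T\<close>, so maximality of \<open>T\<close> passes to both sides.\<close>

lemma split_maximal:
  assumes K: "K \<in> connected_subgraphs G" and T: "T \<in> maximal_tubings K"
    and e: "e \<in> edges K" "\<And>H. H \<in> T \<Longrightarrow> H \<noteq> K \<Longrightarrow> e \<notin> edges H"
  defines "T1 \<equiv> {H \<in> T. verts H \<subseteq> verts (side1 K e)}" and "T2 \<equiv> {H \<in> T. verts H \<subseteq> verts (side2 K e)}"
  shows "T1 \<in> maximal_tubings (side1 K e)" "T2 \<in> maximal_tubings (side2 K e)" "T = insert K (T1 \<union> T2)"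
proof -
  have Tt: "T \<in> tubings K" and Tmax: "\<And>T'. T' \<in> tubings K \<Longrightarrow> T \<subseteq> T' \<Longrightarrow> T' = T"
    using T by (auto simp: maximal_tubings_def)
  have t1: "T1 \<in> tubings (side1 K e)" and t2: "T2 \<in> tubings (side2 K e)"
    unfolding T1_def T2_def using tubings_sides[OF K e(1) Tt] by auto
  have sub: "T \<subseteq> insert K (T1 \<union> T2)"
  proof
    fix H assume H: "H \<in> T"
    then have "H \<in> connected_subgraphs K" using Tt by (auto simp: tubings_def)
    then show "H \<in> insert K (T1 \<union> T2)" using avoids_edge[OF K e(1), of H] e(2)[OF H] H by (auto simp: T1_def T2_def)
  qed
  show eq: "T = insert K (T1 \<union> T2)"
    using Tmax[OF glue_tubings[OF K e(1) t1 t2] sub] by simp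
  have notK: "K \<notin> connected_subgraphs (side1 K e)" "K \<notin> connected_subgraphs (side2 K e)"
    using sides_psubset[OF K e(1)] connected_subgraphsD(1) by blast+
  show "T1 \<in> maximal_tubings (side1 K e)"
    unfolding maximal_tubings_def
  proof (intro CollectI conjI t1 ballI impI)
    fix T' assume T': "T' \<in> tubings (side1 K e)" "T1 \<subseteq> T'"
    have "insert K (T' \<union> T2) = T" using Tmax[OF glue_tubings[OF K e(1) T'(1) t2]] T'(2) sub by blast
    then have "T' \<subseteq> T1" using tubings_verts[OF T'(1)] by (auto simp: T1_def)
    then show "T' = T1" using T'(2) by blast
  qed
  show "T2 \<in> maximal_tubings (side2 K e)"
    unfolding maximal_tubings_def
  proof (intro CollectI conjI t2 ballI impI)
    fix T' assume T': "T' \<in> tubings (side2 K e)" "T2 \<subseteq> T'"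
    have "insert K (T1 \<union> T') = T" using Tmax[OF glue_tubings[OF K e(1) t1 T'(1)]] T'(2) sub by blast
    then have "T' \<subseteq> T2" using tubings_verts[OF T'(1)] by (auto simp: T2_def)
    then show "T' = T2" using T'(2) by blast
  qed
qed

lemma glue_disjoint:
  assumes K: "K \<in> connected_subgraphs G" and e: "e \<in> edges K"
    and T1: "T1 \<in> tubings (side1 K e)" and T2: "T2 \<in> tubings (side2 K e)"
  shows "K \<notin> T1 \<union> T2" "T1 \<inter> T2 = {}"
    "T1 = {H \<in> insert K (T1 \<union> T2). verts H \<subseteq> verts (side1 K e)}" "T2 = {H \<in> insert K (T1 \<union> T2). verts H \<subseteq> verts (side2 K e)}"
    "\<And>H. H \<in> T1 \<union> T2 \<Longrightarrow> e \<notin> edges H"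
proof -
  have a: "\<And>H. H \<in> T1 \<Longrightarrow> verts H \<subseteq> verts (side1 K e) \<and> edges H \<subseteq> edges (side1 K e) \<and> verts H \<noteq> {}"
    and b: "\<And>H. H \<in> T2 \<Longrightarrow> verts H \<subseteq> verts (side2 K e) \<and> edges H \<subseteq> edges (side2 K e) \<and> verts H \<noteq> {}"
    using connected_subgraphsD(1,2,5)[OF tubingsD[OF T1]] connected_subgraphsD(1,2,5)[OF tubingsD[OF T2]]
    by blast+
  note d = sides_disjoint[OF K e] sides_psubset[OF K e] e_notin_K12[OF K e]
  show "K \<notin> T1 \<union> T2" using a b d by blast
  show "T1 \<inter> T2 = {}" using a b d by blast
  show "T1 = {H \<in> insert K (T1 \<union> T2). verts H \<subseteq> verts (side1 K e)}" using a b d by blast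
  show "T2 = {H \<in> insert K (T1 \<union> T2). verts H \<subseteq> verts (side2 K e)}" using a b d by blast
  show "\<And>H. H \<in> T1 \<union> T2 \<Longrightarrow> e \<notin> edges H" using a b d by blast
qed

abbreviation splittings :: "'a graph \<Rightarrow> ('a set \<times> 'a graph set \<times> 'a graph set) set" where
  "splittings K \<equiv> SIGMA e:edges K. maximal_tubings (side1 K e) \<times> maximal_tubings (side2 K e)"

text \<open>The edge is recovered from the tubing as the only one in no proper tube: any other edge
  lies in one of the two sides, which are themselves tubes. The two parts are then the tubes inside
  each side.\<close>

lemma maximal_tubings_bij:
  assumes K: "K \<in> connected_subgraphs G" and ne: "edges K \<noteq> {}"
  shows "bij_betw (\<lambda>(e, T1, T2). insert K (T1 \<union> T2))
    (splittings K) (maximal_tubings K)"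
  unfolding bij_betw_def
proof
  show "inj_on (\<lambda>(e, T1, T2). insert K (T1 \<union> T2)) (splittings K)"
  proof (rule inj_onI)
    fix p q
    assume p: "p \<in> splittings K"
      and q: "q \<in> splittings K"
      and pq: "(\<lambda>(e, T1, T2). insert K (T1 \<union> T2)) p = (\<lambda>(e, T1, T2). insert K (T1 \<union> T2)) q"
    obtain e T1 T2 where peq: "p = (e, T1, T2)" by (cases p)
    obtain e' T1' T2' where qeq: "q = (e', T1', T2')" by (cases q)
    have e: "e \<in> edges K" and T: "T1 \<in> maximal_tubings (side1 K e)" "T2 \<in> maximal_tubings (side2 K e)"
      and e': "e' \<in> edges K" and T': "T1' \<in> maximal_tubings (side1 K e')" "T2' \<in> maximal_tubings (side2 K e')"
      using p q by (simp_all add: peq qeq)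
    have eq: "insert K (T1 \<union> T2) = insert K (T1' \<union> T2')" using pq by (simp add: peq qeq)
    have t: "T1 \<in> tubings (side1 K e)" "T2 \<in> tubings (side2 K e)" "T1' \<in> tubings (side1 K e')" "T2' \<in> tubings (side2 K e')"
      using T T' by (auto simp: maximal_tubings_def)
    note g = glue_disjoint[OF K e t(1,2)] and g' = glue_disjoint[OF K e' t(3,4)]
    have eqT: "T1 \<union> T2 = T1' \<union> T2'" using insert_ident[OF g(1) g'(1)] eq by simp
    have self: "side1 K e \<in> T1" "side2 K e \<in> T2"
      using maximal_tubing_self[OF sides_connG(1)[OF K e] T(1)] maximal_tubing_self[OF sides_connG(2)[OF K e] T(2)] .
    have ee: "e = e'"
    proof (rule ccontr)
      assume "e \<noteq> e'"
      then have "e' \<in> edges (side1 K e) \<or> e' \<in> edges (side2 K e)" using sides_edges[OF K e e'] by blast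
      then show False using g'(5)[of "side1 K e"] g'(5)[of "side2 K e"] self eqT by blast
    qed
    have "T1 = T1'" using g(3) g'(3) unfolding eq ee by (rule trans[OF _ sym])
    moreover have "T2 = T2'" using g(4) g'(4) unfolding eq ee by (rule trans[OF _ sym])
    ultimately show "p = q" by (simp add: peq qeq ee)
  qed
  show "(\<lambda>(e, T1, T2). insert K (T1 \<union> T2)) ` (splittings K) = maximal_tubings K"
  proof
    show "(\<lambda>(e, T1, T2). insert K (T1 \<union> T2)) ` (splittings K) \<subseteq> maximal_tubings K"
      using glue_maximal[OF K] by auto
    show "maximal_tubings K \<subseteq> (\<lambda>(e, T1, T2). insert K (T1 \<union> T2)) ` (splittings K)"
    proof
      fix T assume T: "T \<in> maximal_tubings K"
      then obtain e where e: "e \<in> edges K" "\<And>H. H \<in> T \<Longrightarrow> H \<noteq> K \<Longrightarrow> e \<notin> edges H"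
        using uncovered_edge[OF K ne, of T] by (auto simp: maximal_tubings_def)
      note s = split_maximal[OF K T e]
      show "T \<in> (\<lambda>(e, T1, T2). insert K (T1 \<union> T2)) ` (splittings K)"
        using s e(1) by (intro image_eqI[where x="(e, {H \<in> T. verts H \<subseteq> verts (side1 K e)}, {H \<in> T. verts H \<subseteq> verts (side2 K e)})"]) auto
    qed
  qed
qed

lemma tubing_sum_rec:
  assumes K: "K \<in> connected_subgraphs G" and ne: "edges K \<noteq> {}"
  shows "tubing_sum G x y K = inverse (partial_energy G x y K) *
    (\<Sum>e\<in>edges K. tubing_sum G x y (side1 K e) * tubing_sum G x y (side2 K e))"
proof -
  define w where "w H = inverse (partial_energy G x y H)" for H
  have "tubing_sum G x y K = (\<Sum>T\<in>maximal_tubings K. \<Prod>H\<in>T. w H)"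
    by (simp add: tubing_sum_def w_def)
  also have "\<dots> = (\<Sum>(e, T1, T2)\<in>splittings K.
      \<Prod>H\<in>insert K (T1 \<union> T2). w H)"
    unfolding sum.reindex_bij_betw[OF maximal_tubings_bij[OF K ne], symmetric]
    by (intro sum.cong) auto
  also have "\<dots> = (\<Sum>(e, T1, T2)\<in>splittings K.
      w K * ((\<Prod>H\<in>T1. w H) * (\<Prod>H\<in>T2. w H)))"
  proof (intro sum.cong refl, clarify)
    fix e T1 T2 assume h: "e \<in> edges K" "T1 \<in> maximal_tubings (side1 K e)" "T2 \<in> maximal_tubings (side2 K e)"
    then have t: "T1 \<in> tubings (side1 K e)" "T2 \<in> tubings (side2 K e)" by (auto simp: maximal_tubings_def)
    note g = glue_disjoint[OF K h(1) t]
    show "(\<Prod>H\<in>insert K (T1 \<union> T2). w H) = w K * ((\<Prod>H\<in>T1. w H) * (\<Prod>H\<in>T2. w H))"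
      using g(1,2) by (simp add: prod.union_disjoint)
  qed
  also have "\<dots> = (\<Sum>e\<in>edges K. \<Sum>T1\<in>maximal_tubings (side1 K e). \<Sum>T2\<in>maximal_tubings (side2 K e). w K * ((\<Prod>H\<in>T1. w H) * (\<Prod>H\<in>T2. w H)))"
    by (simp add: sum.Sigma split_def)
  also have "\<dots> = w K * (\<Sum>e\<in>edges K. tubing_sum G x y (side1 K e) * tubing_sum G x y (side2 K e))"
  proof -
    have "(\<Sum>T1\<in>maximal_tubings (side1 K e). \<Sum>T2\<in>maximal_tubings (side2 K e). w K * ((\<Prod>H\<in>T1. w H) * (\<Prod>H\<in>T2. w H)))
      = w K * (tubing_sum G x y (side1 K e) * tubing_sum G x y (side2 K e))" for e
      unfolding tubing_sum_def w_def[symmetric] sum_product by (simp add: sum_distrib_left)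
    then show ?thesis by (simp add: sum_distrib_left)
  qed
  finally show ?thesis by (simp add: w_def)
qed

lemma tubing_sum_vertex: "tubing_sum G x y ({v}, {}) = inverse (vertex_energy G x y v)"
proof -
  have cs: "connected_subgraphs ({v}, {}) = {({v}, {})}"
    by (auto simp: connected_subgraphs_def subgraph_def connected_graph_def)
  have "tubings ({v}, {}) = {{}, {({v}, {})}}"
    by (auto simp: tubings_def cs compatible_tubes_def subgraph_def)
  then have "maximal_tubings ({v}, {}) = {{({v}, {})}}"
    by (auto simp: maximal_tubings_def)
  then show ?thesis by (simp add: tubing_sum_def partial_energy_def)
qed

section \<open>Products of tubing sums over components\<close>

definition comps :: "'a set set \<Rightarrow> 'a graph set" where
  "comps S = cgraph S ` verts G"

lemma comps_eq: "S \<subseteq> edges G \<Longrightarrow> components_of_graph (verts G, S) = comps S"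
  unfolding comps_def using edge_verts by (intro components_of_graph_eq) blast

lemma cgraph_cong:
  assumes "T' \<subseteq> T" "T \<subseteq> edges G" "\<And>f. f \<in> T - T' \<Longrightarrow> f \<inter> reach T u = {}"
  shows "cgraph T' u = cgraph T u"
proof -
  have "w \<in> reach T' u" if "w \<in> reach T u" for w
    using that
  proof (induction rule: reach_induct)
    case (step a b)
    then have "{a, b} \<in> T'" using assms(3)[of "{a, b}"] by blast
    then show ?case by (rule reach_step[OF step.IH])
  qed simp
  then have eq: "reach T' u = reach T u" using reach_mono[OF assms(1)] by blast
  have "f \<in> T'" if "f \<in> T" "f \<subseteq> reach T u" for f
    using assms(3)[of f] that edge_nonempty assms(2) by blast
  then show ?thesis using assms(1) by (auto simp: cgraph_def eq)
qed

text \<open>An edge of \<open>S\<close> that touches \<open>\<Union>C\<close> belongs to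
  \<open>C\<close>. Removing an edge of \<open>C\<close> therefore splits \<open>K\<close> into its
  two sides and leaves all other components alone.\<close>

lemma comps_split:
  assumes S: "S \<noteq> {}" "S \<subseteq> edges G"
  defines "K \<equiv> edge_induced (comp S)"
  shows "K \<in> comps S" "K \<in> connected_subgraphs G" "edges K = comp S"
    and "e \<in> comp S \<Longrightarrow> comps (S - {e}) = (comps S - {K}) \<union> {side1 K e, side2 K e}"
    and "e \<in> comp S \<Longrightarrow> side1 K e \<notin> comps S - {K} \<and> side2 K e \<notin> comps S - {K} \<and> side1 K e \<noteq> side2 K e"
proof -
  define C where "C = comp S"
  have C: "is_comp S C" unfolding C_def by (rule is_comp_comp[OF S])
  have CS: "C \<subseteq> S" "C \<in> conn_edge_sets G" using C by (auto simp: is_comp_def)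
  have KC: "K = (\<Union>C, C)" by (simp add: K_def C_def edge_induced_def)
  have UC: "\<Union>C \<subseteq> verts G" using CS S edge_verts by blast
  show KG: "K \<in> connected_subgraphs G"
    using CS UC conn_edge_setsD(2)[OF CS(2)]
    by (auto simp: connected_subgraphs_def subgraph_def KC conn_edge_sets_def edge_induced_def)
  show "edges K = comp S" by (simp add: KC C_def)
  have touch: "f \<in> C" if "f \<in> S" "f \<inter> \<Union>C \<noteq> {}" for f
  proof -
    have "{f} \<in> conn_edge_sets G" using that S by (intro conn_singleton) blast
    moreover have "{f} \<subseteq> S" "\<Union>{f} \<inter> \<Union>C \<noteq> {}" using that by auto
    ultimately have "{f} \<subseteq> C" using C unfolding is_comp_def by blast
    then show ?thesis by blast
  qed
  have reach_in: "reach S w \<subseteq> \<Union>C" if w: "w \<in> \<Union>C" for w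
  proof
    fix z assume "z \<in> reach S w"
    then show "z \<in> \<Union>C"
    proof (induction rule: reach_induct)
      case (step a b)
      then have "{a, b} \<in> C" by (intro touch) auto
      then show ?case by blast
    qed (rule w)
  qed
  have cgK: "cgraph S w = K" if w: "w \<in> \<Union>C" for w
  proof -
    have "subgraph K (cgraph S w)"
      using connected_subgraphsD[OF KG] CS w by (intro subgraph_cgraph) (auto simp: KC)
    moreover have "subgraph (cgraph S w) K"
    proof -
      have "f \<in> C" if f: "f \<in> S" "f \<subseteq> reach S w" for f
      proof (rule touch[OF f(1)])
        have "f \<noteq> {}" using f(1) S by (intro edge_nonempty) blast
        then show "f \<inter> \<Union>C \<noteq> {}" using f(2) reach_in[OF w] by blast
      qed
      then show ?thesis using reach_in[OF w] by (auto simp: subgraph_def cgraph_def KC)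
    qed
    ultimately show ?thesis using subgraph_antisym by blast
  qed
  have out: "w \<in> \<Union>C" if w: "reach S w \<inter> \<Union>C \<noteq> {}" for w
  proof -
    obtain z where z: "z \<in> reach S w" "z \<in> \<Union>C" using w by blast
    have "w \<in> reach S z" using reach_eq[OF z(1)] by simp
    then show ?thesis using reach_in[OF z(2)] by blast
  qed
  have ne: "\<Union>C \<noteq> {}" using connected_subgraphsD(5)[OF KG] by (simp add: KC)
  then show "K \<in> comps S" using cgK UC by (force simp: comps_def)
  have rest: "comps S - {K} = cgraph S ` (verts G - \<Union>C)"
  proof -
    have "cgraph S v \<noteq> K" if "v \<notin> \<Union>C" for v
    proof
      assume "cgraph S v = K"
      then have "reach S v = \<Union>C" by (simp add: cgraph_def KC)
      then show False using that by (metis reach_refl)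
    qed
    then show ?thesis unfolding comps_def using cgK by blast
  qed
  assume e: "e \<in> comp S"
  then have eK: "e \<in> edges K" by (simp add: KC C_def)
  have Ki: "cgraph (S - {e}) v = cgraph (edges K - {e}) v" if v: "v \<in> \<Union>C" for v
  proof (rule cgraph_cong[symmetric])
    fix f assume f: "f \<in> S - {e} - (edges K - {e})"
    then have "f \<inter> \<Union>C = {}" using touch[of f] by (auto simp: KC)
    moreover have "reach (S - {e}) v \<subseteq> \<Union>C" using reach_in[OF v] reach_mono[of "S - {e}" S v] by blast
    ultimately show "f \<inter> reach (S - {e}) v = {}" by blast
  qed (use CS S in \<open>auto simp: KC\<close>)
  have out_eq: "cgraph (S - {e}) v = cgraph S v" if v: "v \<notin> \<Union>C" for v
  proof (rule cgraph_cong)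
    fix f assume "f \<in> S - (S - {e})"
    then have "f \<subseteq> \<Union>C" using e by (auto simp: C_def)
    moreover have "reach S v \<inter> \<Union>C = {}"
    proof (rule ccontr)
      assume "reach S v \<inter> \<Union>C \<noteq> {}"
      from out[OF this] v show False by contradiction
    qed
    ultimately show "f \<inter> reach S v = {}" by blast
  qed (use S in auto)
  have vK: "verts K = \<Union>C" by (simp add: KC)
  have inside: "cgraph (S - {e}) ` \<Union>C = {side1 K e, side2 K e}"
  proof
    show "cgraph (S - {e}) ` \<Union>C \<subseteq> {side1 K e, side2 K e}"
    proof
      fix L assume "L \<in> cgraph (S - {e}) ` \<Union>C"
      then obtain v where v: "v \<in> \<Union>C" "L = cgraph (edges K - {e}) v" using Ki by blast
      then have "v \<in> verts (side1 K e) \<or> v \<in> verts (side2 K e)" using sides_verts[OF KG eK] vK by blast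
      then have "v \<in> reach (edges K - {e}) (end1 e) \<or> v \<in> reach (edges K - {e}) (end2 e)"
        by (simp add: side1_def side2_def cgraph_def)
      then have "L = side1 K e \<or> L = side2 K e"
        unfolding v(2) side1_def side2_def using cgraph_eq[of v "edges K - {e}"] by blast
      then show "L \<in> {side1 K e, side2 K e}" by blast
    qed
    show "{side1 K e, side2 K e} \<subseteq> cgraph (S - {e}) ` \<Union>C"
    proof -
      have "side1 K e = cgraph (S - {e}) (end1 e)" "side2 K e = cgraph (S - {e}) (end2 e)"
        unfolding side1_def side2_def using Ki[of "end1 e"] Ki[of "end2 e"] ends_in[OF KG eK] vK by simp_all
      then show ?thesis using ends_in[OF KG eK] vK by blast
    qed
  qed
  have "comps (S - {e}) = cgraph (S - {e}) ` (verts G - \<Union>C) \<union> cgraph (S - {e}) ` \<Union>C"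
    unfolding comps_def image_Un[symmetric] using UC by (intro arg_cong[where f="image _"]) blast
  also have "cgraph (S - {e}) ` (verts G - \<Union>C) = comps S - {K}"
    unfolding rest by (intro image_cong refl) (simp add: out_eq)
  finally show "comps (S - {e}) = (comps S - {K}) \<union> {side1 K e, side2 K e}" by (simp add: inside)
  have nin: "L \<notin> comps S - {K}" if "verts L \<subseteq> \<Union>C" for L
    unfolding rest
  proof
    assume "L \<in> cgraph S ` (verts G - \<Union>C)"
    then obtain v where v: "v \<notin> \<Union>C" "L = cgraph S v" by blast
    then have "verts L = reach S v" by (simp add: cgraph_def)
    then show False using that reach_refl[of v S] v(1) by blast
  qed
  have "verts (side1 K e) \<subseteq> \<Union>C" "verts (side2 K e) \<subseteq> \<Union>C" using sides_psubset[OF KG eK] vK by auto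
  moreover have "side1 K e \<noteq> side2 K e"
    using sides_disjoint[OF KG eK] connected_subgraphsD(5)[OF sides_conn(1)[OF KG eK]] by auto
  ultimately show "side1 K e \<notin> comps S - {K} \<and> side2 K e \<notin> comps S - {K} \<and> side1 K e \<noteq> side2 K e"
    using nin by blast
qed

text \<open>The recursion of \<open>nested_sum\<close> and the splitting
  \<open>tubing_sum_rec\<close> of one factor both run over the edges of \<open>comp S\<close>,
  while the product \<open>R\<close> over the other components is carried along. At
  \<open>S = {}\<close> all components are single vertices, which accounts for the vertex
  energies.\<close>

lemma prod_tubing_sum:
  assumes "S \<subseteq> edges G"
  shows "(\<Prod>K\<in>comps S. tubing_sum G x y K) =
    (\<Prod>v\<in>verts G. inverse (vertex_energy G x y v)) * nested_sum (\<lambda>C. partial_energy G x y (edge_induced C)) S"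
  using assms
proof (induction rule: nested_sum_induct)
  case empty
  have "reach {} v = {v}" for v :: 'a by (auto simp: reach_def adj_def)
  then have cg: "cgraph {} v = ({v}, {})" for v :: 'a by (simp add: cgraph_def)
  have "comps {} = (\<lambda>v. ({v}, {} :: 'a set set)) ` verts G" unfolding comps_def cg ..
  moreover have "inj_on (\<lambda>v. ({v}, {} :: 'a set set)) (verts G)" by (auto simp: inj_on_def)
  ultimately show ?case by (simp add: prod.reindex tubing_sum_vertex)
next
  case (step S)
  define K where "K = edge_induced (comp S)"
  note s = comps_split[OF step(1,2), folded K_def]
  define R where "R = (\<Prod>L\<in>comps S - {K}. tubing_sum G x y L)"
  have ne: "edges K \<noteq> {}"
    using is_comp_comp[OF step(1,2)] unfolding s(3) is_comp_def conn_edge_sets_def by blast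
  have "(\<Prod>L\<in>comps S. tubing_sum G x y L) = tubing_sum G x y K * R"
    unfolding R_def using s(1) by (intro prod.remove) auto
  also have "\<dots> = inverse (partial_energy G x y K) * (\<Sum>e\<in>comp S. tubing_sum G x y (side1 K e) * tubing_sum G x y (side2 K e) * R)"
    unfolding tubing_sum_rec[OF s(2) ne] s(3) by (simp add: sum_distrib_right mult.assoc)
  also have "(\<Sum>e\<in>comp S. tubing_sum G x y (side1 K e) * tubing_sum G x y (side2 K e) * R)
      = (\<Sum>e\<in>comp S. \<Prod>L\<in>comps (S - {e}). tubing_sum G x y L)"
  proof (intro sum.cong refl)
    fix e assume e: "e \<in> comp S"
    have "(\<Prod>L\<in>comps (S - {e}). tubing_sum G x y L) = R * (\<Prod>L\<in>{side1 K e, side2 K e}. tubing_sum G x y L)"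
      unfolding s(4)[OF e] R_def using s(5)[OF e] by (intro prod.union_disjoint) auto
    then show "tubing_sum G x y (side1 K e) * tubing_sum G x y (side2 K e) * R = (\<Prod>L\<in>comps (S - {e}). tubing_sum G x y L)"
      using s(5)[OF e] by (simp add: mult_ac)
  qed
  also have "\<dots> = (\<Sum>e\<in>comp S. (\<Prod>v\<in>verts G. inverse (vertex_energy G x y v)) * nested_sum (\<lambda>C. partial_energy G x y (edge_induced C)) (S - {e}))"
    using step(3) by simp
  finally show ?case
    using step(1,2) by (simp add: nested_sum_rec K_def sum_distrib_left[symmetric] mult_ac)
qed

text \<open>Each removed edge adds one component, and the whole of \<open>G\<close> is one
  component.\<close>

lemma card_comps:
  assumes conn: "connected_graph G" and "S \<subseteq> edges G"
  shows "card (comps S) = card (edges G - S) + 1"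
proof -
  have rec: "card (comps (S - {e})) = card (comps S) + 1" if S: "S \<noteq> {}" "S \<subseteq> edges G" and e: "e \<in> comp S" for S e
  proof -
    define K where "K = edge_induced (comp S)"
    note s = comps_split[OF S, folded K_def]
    have "card (comps (S - {e})) = card (comps S - {K}) + card {side1 K e, side2 K e}"
      unfolding s(4)[OF e] using s(5)[OF e] by (intro card_Un_disjoint) auto
    moreover have "card (comps S) = Suc (card (comps S - {K}))"
      by (rule card.remove[OF finite s(1)])
    ultimately show ?thesis using s(5)[OF e] by simp
  qed
  have full: "card (comps S) + card S = card (comps {})" if "S \<subseteq> edges G" for S
    using that
  proof (induction rule: nested_sum_induct)
    case (step S)
    have "is_comp S (comp S)" by (rule is_comp_comp[OF step(1,2)])
    then have "comp S \<noteq> {}" "comp S \<subseteq> S" by (auto simp: is_comp_def conn_edge_sets_def)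
    then obtain e where e: "e \<in> comp S" "e \<in> S" by blast
    have "card S = Suc (card (S - {e}))" by (rule card.remove[OF finite e(2)])
    then show ?case using rec[OF step(1,2) e(1)] step(3)[OF e(1)] by simp
  qed simp
  obtain v where v: "v \<in> verts G" using connected_graph_nonempty[OF conn] by blast
  have "cgraph (edges G) w = cgraph (edges G) v" if w: "w \<in> verts G" for w
  proof (rule cgraph_eq)
    have "(v, w) \<in> (adj (edges G))\<^sup>*" using conn v w unfolding connected_graph_adj by blast
    then show "w \<in> reach (edges G) v" by (simp add: reach_def)
  qed
  then have "comps (edges G) \<subseteq> {cgraph (edges G) v}" unfolding comps_def by blast
  moreover have "cgraph (edges G) v \<in> comps (edges G)" unfolding comps_def using v by (rule imageI)
  ultimately have "comps (edges G) = {cgraph (edges G) v}" by blast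
  then have "1 + card (edges G) = card (comps {})" using full[of "edges G"] by simp
  moreover have "card (edges G - S) = card (edges G) - card S" "card S \<le> card (edges G)"
    using assms(2) by (auto simp: card_Diff_subset card_mono)
  ultimately show ?thesis using full[OF assms(2)] by linarith
qed

end

section \<open>Partial energies as facet variables\<close>

lemma sum_Pow_split:
  assumes "finite N" "e \<in> N"
  shows "(\<Sum>J\<in>Pow N. F J) = (\<Sum>J\<in>Pow (N - {e}). F J + F (insert e J))"
proof -
  have N: "Pow N = Pow (N - {e}) \<union> insert e ` Pow (N - {e})"
    using Pow_insert[of e "N - {e}"] assms(2) by (simp add: insert_absorb)
  have "(\<Sum>J\<in>Pow N. F J) = (\<Sum>J\<in>Pow (N - {e}). F J) + (\<Sum>J\<in>insert e ` Pow (N - {e}). F J)"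
    unfolding N using assms(1) by (intro sum.union_disjoint) auto
  also have "(\<Sum>J\<in>insert e ` Pow (N - {e}). F J) = (\<Sum>J\<in>Pow (N - {e}). F (insert e J))"
    by (subst sum.reindex) (auto simp: inj_on_def insert_eq_iff o_def)
  finally show ?thesis by (simp add: sum.distrib)
qed

lemma sum_Pow_alternating:
  assumes "finite N"
  shows "(\<Sum>J\<in>Pow N. (- 1) ^ card J) = (if N = {} then 1 else (0 :: 'a::ring_1))"
proof (cases "N = {}")
  case False
  then obtain e where e: "e \<in> N" by blast
  have "(- 1 :: 'a) ^ card J + (- 1) ^ card (insert e J) = 0" if "J \<in> Pow (N - {e})" for J
    using that assms by (subst card_insert_disjoint) (auto intro: finite_subset)
  then show ?thesis using False sum_Pow_split[OF assms e, of "\<lambda>J. (- 1 :: 'a) ^ card J"] by simp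
qed simp

lemma sum_Pow_alternating_mem:
  assumes "finite N" "e \<in> N"
  shows "(\<Sum>J\<in>Pow N. (- 1) ^ card J * (if e \<in> J then 1 else 0)) = (if N = {e} then - 1 else (0 :: 'a::ring_1))"
proof -
  have "(\<Sum>J\<in>Pow N. (- 1) ^ card J * (if e \<in> J then 1 else 0)) = (\<Sum>J\<in>Pow (N - {e}). - ((- 1 :: 'a) ^ card J))"
    unfolding sum_Pow_split[OF assms]
  proof (intro sum.cong refl)
    fix J assume J: "J \<in> Pow (N - {e})"
    then have "e \<notin> J" "finite J" using assms(1) by (auto intro: finite_subset)
    then show "(- 1) ^ card J * (if e \<in> J then 1 else 0) + (- 1) ^ card (insert e J) * (if e \<in> insert e J then 1 else 0)
      = - ((- 1 :: 'a) ^ card J)" by simp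
  qed
  also have "\<dots> = (if N = {e} then - 1 else 0)"
    using sum_Pow_alternating[of "N - {e}", where 'a='a] assms by (auto simp: sum_negf)
  finally show ?thesis .
qed

text \<open>Over all subsets of \<open>N\<close>, toggling one edge cancels both parts almost
  completely: the count survives only if \<open>N\<close> is a single edge, the inclusion term only
  if \<open>N \<inter> I\<close> is empty. Passing to sizes at least 2 removes the value -1 at
  \<open>{}\<close> and the value 0 at singletons. The exception \<open>card N = 1\<close> is the
  star of a leaf.\<close>

lemma star_sum:
  fixes N I :: "'b set"
  assumes N: "finite N"
  shows "(\<Sum>J\<in>{J \<in> Pow N. 2 \<le> card J}. (- 1) ^ card J * (of_nat (card (J \<inter> I)) - (if J \<subseteq> I then 1 else 0)))
    = (if N \<inter> I = {} \<or> card N = 1 then 0 else (1 :: 'a::comm_ring_1))"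
proof -
  define F where "F J = ((- 1) ^ card J * (of_nat (card (J \<inter> I)) - (if J \<subseteq> I then 1 else 0)) :: 'a)" for J
  have F1: "F J = 0" if J: "J \<in> Pow N" "card J = 1" for J
  proof -
    obtain e where "J = {e}" using card_1_singletonE[OF J(2)] .
    then show ?thesis by (auto simp: F_def)
  qed
  have "(\<Sum>J\<in>Pow N. F J) = F {} + (\<Sum>J\<in>Pow N - {{}}. F J)"
    using N by (subst sum.remove[of _ "{}"]) auto
  also have "(\<Sum>J\<in>Pow N - {{}}. F J) = (\<Sum>J\<in>{J \<in> Pow N. 2 \<le> card J}. F J)"
  proof (rule sum.mono_neutral_right)
    show "\<forall>J\<in>Pow N - {{}} - {J \<in> Pow N. 2 \<le> card J}. F J = 0"
    proof
      fix J assume J: "J \<in> Pow N - {{}} - {J \<in> Pow N. 2 \<le> card J}"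
      then have "finite J" "J \<noteq> {}" using N by (auto intro: finite_subset)
      then have "card J \<noteq> 0" by simp
      then have "card J = 1" using J by auto
      then show "F J = 0" using F1 J by auto
    qed
  qed (use N in auto)
  finally have 1: "(\<Sum>J\<in>{J \<in> Pow N. 2 \<le> card J}. F J) = (\<Sum>J\<in>Pow N. F J) + 1"
    by (simp add: F_def)
  have "(\<Sum>J\<in>Pow N. (- 1) ^ card J * of_nat (card (J \<inter> I)))
      = (\<Sum>J\<in>Pow N. \<Sum>e\<in>N \<inter> I. (- 1 :: 'a) ^ card J * (if e \<in> J then 1 else 0))"
  proof (intro sum.cong refl)
    fix J assume "J \<in> Pow N"
    then have "(\<Sum>e\<in>N \<inter> I. if e \<in> J then 1 else 0) = (of_nat (card (J \<inter> I)) :: 'a)"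
      using N by (subst sum.If_cases) (auto intro!: arg_cong[where f="\<lambda>A. of_nat (card A)"])
    then show "(- 1) ^ card J * of_nat (card (J \<inter> I)) = (\<Sum>e\<in>N \<inter> I. (- 1 :: 'a) ^ card J * (if e \<in> J then 1 else 0))"
      by (simp only: sum_distrib_left[symmetric])
  qed
  also have "\<dots> = (\<Sum>e\<in>N \<inter> I. if N = {e} then - 1 else 0)"
    using N by (subst sum.swap) (auto intro!: sum.cong simp: sum_Pow_alternating_mem)
  also have "\<dots> = (if card N = 1 \<and> N \<inter> I \<noteq> {} then - 1 else 0)"
  proof (cases "card N = 1")
    case True
    then obtain a where "N = {a}" by (rule card_1_singletonE)
    then show ?thesis by auto
  qed (auto intro!: sum.neutral)
  finally have 2: "(\<Sum>J\<in>Pow N. (- 1) ^ card J * of_nat (card (J \<inter> I))) = (if card N = 1 \<and> N \<inter> I \<noteq> {} then - 1 else (0 :: 'a))" .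
  have "(\<Sum>J\<in>Pow N. (- 1) ^ card J * (if J \<subseteq> I then 1 else 0)) = (\<Sum>J\<in>Pow (N \<inter> I). (- 1 :: 'a) ^ card J)"
    using N by (intro sum.mono_neutral_cong_right) auto
  also have "\<dots> = (if N \<inter> I = {} then 1 else 0)"
    using N by (intro sum_Pow_alternating) simp
  finally have 3: "(\<Sum>J\<in>Pow N. (- 1) ^ card J * (if J \<subseteq> I then 1 else 0)) = (if N \<inter> I = {} then 1 else (0 :: 'a))" .
  have "(\<Sum>J\<in>Pow N. F J) = (if card N = 1 \<and> N \<inter> I \<noteq> {} then - 1 else 0) - (if N \<inter> I = {} then 1 else 0)"
    unfolding F_def right_diff_distrib sum_subtractf 2 3 ..
  then show ?thesis using 1 by (simp add: F_def)
qed

context simple_graph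
begin

lemma Max_card_tpol:
  assumes "J \<noteq> {}"
  shows "real (Max {card (J' \<inter> I) |J'. J' \<subset> J}) = tpol (Inr J) (ind I)"
proof -
  have ne: "{card (J' \<inter> I) |J'. J' \<subset> J} \<noteq> {}" using assms by blast
  have fin: "finite {card (J' \<inter> I) |J'. J' \<subset> J}"
    using finite_imageI[of "{J'. J' \<subset> J}" "\<lambda>J'. card (J' \<inter> I)"] by (simp add: setcompr_eq_image)
  have "(\<Sum>e\<in>K. ind I e) = real (card (K \<inter> I))" for K
    by (simp add: ind_def sum.If_cases Int_def)
  then have "(\<lambda>K. \<Sum>e\<in>K. ind I e) ` Monom (Inr J) = real ` {card (J' \<inter> I) |J'. J' \<subset> J}"
    by (auto simp: Monom_def)
  then show ?thesis
    unfolding tpol_def by (simp add: mono_Max_commute[OF _ fin ne] mono_def)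
qed

lemma edge_inter_unique:
  assumes "J \<subseteq> incident G v" "J \<subseteq> incident G w" "2 \<le> card J"
  shows "v = w"
proof (rule ccontr)
  assume vw: "v \<noteq> w"
  have "e = {v, w}" if "e \<in> J" for e
  proof -
    have "e \<in> edges G" "v \<in> e" "w \<in> e" using that assms by (auto simp: incident_def)
    then show ?thesis using edge_doubleton[of e] vw by auto
  qed
  then have "J \<subseteq> {{v, w}}" by blast
  then have "card J \<le> card {{v, w}}" by (intro card_mono) auto
  then show False using assms(3) by simp
qed

text \<open>Two edges determine their common vertex, so at most one summand is nonzero. Written as a
  sum over vertices, the coefficient can be summed over \<open>J\<close> star by star.\<close>

lemma phys_beta_sum:
  assumes "2 \<le> card J"
  shows "phys_beta G x y J = (\<Sum>v\<in>verts G. if J \<subseteq> incident G v then (- 1) ^ card J * vertex_energy G x y v else 0)"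
proof (cases "\<exists>v\<in>verts G. J \<subseteq> incident G v")
  case True
  then obtain v where v: "v \<in> verts G" "J \<subseteq> incident G v" by blast
  have uniq: "w = v" if "J \<subseteq> incident G w" for w using edge_inter_unique[OF that v(2) assms] .
  have "(THE v. v \<in> verts G \<and> J \<subseteq> incident G v) = v"
    by (rule the_equality) (use v in blast, elim conjE, rule uniq)
  moreover have "(\<Sum>w\<in>verts G. if J \<subseteq> incident G w then (- 1) ^ card J * vertex_energy G x y w else 0)
      = (\<Sum>w\<in>verts G. if w = v then (- 1) ^ card J * vertex_energy G x y v else 0)"
  proof (intro sum.cong refl)
    fix w
    have "J \<subseteq> incident G w \<longleftrightarrow> w = v" using uniq v(2) by blast
    then show "(if J \<subseteq> incident G w then (- 1) ^ card J * vertex_energy G x y w else 0)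
      = (if w = v then (- 1) ^ card J * vertex_energy G x y v else 0)"
      by (cases "w = v") simp_all
  qed
  ultimately show ?thesis using True v by (simp add: phys_beta_def)
next
  case False
  then show ?thesis by (auto simp: phys_beta_def intro!: sum.neutral)
qed

text \<open>For each vertex of \<open>I\<close> that is not a leaf of \<open>G\<close>, the star sum
  yields its energy once. A leaf has too small a star for any \<open>\<beta>\<close>; its energy
  comes from \<open>\<alpha>\<close> of its only edge. Edge energies are subtracted once in
  \<open>\<alpha>\<close> and once in the facet variable, whence the factor 2.\<close>

lemma facet_variable_phys:
  assumes I: "I \<in> conn_edge_sets G"
  shows "facet_variable G y (phys_alpha G x y) (phys_beta G x y) I = partial_energy G x y (edge_induced I)"
proof -
  define p where "p = vertex_energy G x y"
  define m where "m J = (of_nat (card (J \<inter> I)) - (if J \<subseteq> I then 1 else 0) :: complex)" for J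
  have IE: "I \<subseteq> edges G" using conn_edge_setsD(2)[OF I] .
  have touch: "incident G v \<inter> I \<noteq> {} \<longleftrightarrow> v \<in> \<Union>I" for v using IE by (auto simp: incident_def)
  have max: "of_nat (Max {card (J' \<inter> I) |J'. J' \<subset> J}) = m J" if "J \<in> big_conn_edge_sets G" for J
  proof -
    have J: "J \<noteq> {}" using that by (auto simp: big_conn_edge_sets_def conn_edge_sets_def)
    define k where "k = Max {card (J' \<inter> I) |J'. J' \<subset> J}"
    have "real k = real (card (J \<inter> I)) - (if J \<subseteq> I then 1 else 0)"
      unfolding k_def Max_card_tpol[OF J] tpol_ind[OF J] ..
    then have "complex_of_real (real k) = of_real (real (card (J \<inter> I)) - (if J \<subseteq> I then 1 else 0))"
      by (rule arg_cong)
    then have "of_nat k = m J" by (cases "J \<subseteq> I") (simp_all add: m_def)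
    then show ?thesis unfolding k_def .
  qed
  have "(\<Sum>J\<in>big_conn_edge_sets G. phys_beta G x y J * of_nat (Max {card (J' \<inter> I) |J'. J' \<subset> J}))
      = (\<Sum>J\<in>big_conn_edge_sets G. \<Sum>v\<in>verts G. if J \<subseteq> incident G v then p v * ((- 1) ^ card J * m J) else 0)"
  proof (intro sum.cong refl)
    fix J assume J: "J \<in> big_conn_edge_sets G"
    then have "2 \<le> card J" by (simp add: big_conn_edge_sets_def)
    then show "phys_beta G x y J * of_nat (Max {card (J' \<inter> I) |J'. J' \<subset> J})
      = (\<Sum>v\<in>verts G. if J \<subseteq> incident G v then p v * ((- 1) ^ card J * m J) else 0)"
      unfolding max[OF J] phys_beta_sum[OF \<open>2 \<le> card J\<close>] sum_distrib_right p_def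
      by (intro sum.cong) auto
  qed
  also have "\<dots> = (\<Sum>v\<in>verts G. \<Sum>J\<in>big_conn_edge_sets G. if J \<subseteq> incident G v then p v * ((- 1) ^ card J * m J) else 0)"
    by (rule sum.swap)
  also have "\<dots> = (\<Sum>v\<in>verts G. p v * (if incident G v \<inter> I = {} \<or> card (incident G v) = 1 then 0 else 1))"
  proof (intro sum.cong refl)
    fix v
    have "(\<Sum>J\<in>big_conn_edge_sets G. if J \<subseteq> incident G v then p v * ((- 1) ^ card J * m J) else 0)
        = (\<Sum>J\<in>{J \<in> Pow (incident G v). 2 \<le> card J}. p v * ((- 1) ^ card J * m J))"
    proof (rule sum.mono_neutral_cong_right)
      show "{J \<in> Pow (incident G v). 2 \<le> card J} \<subseteq> big_conn_edge_sets G"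
        by (auto simp: big_conn_edge_sets_def intro!: conn_star[of _ v])
    qed (auto simp: big_conn_edge_sets_def)
    also have "\<dots> = p v * (if incident G v \<inter> I = {} \<or> card (incident G v) = 1 then 0 else 1)"
      unfolding sum_distrib_left[symmetric] m_def by (subst star_sum) auto
    finally show "(\<Sum>J\<in>big_conn_edge_sets G. if J \<subseteq> incident G v then p v * ((- 1) ^ card J * m J) else 0)
      = p v * (if incident G v \<inter> I = {} \<or> card (incident G v) = 1 then 0 else 1)" .
  qed
  also have "\<dots> = (\<Sum>v\<in>\<Union>I. if card (incident G v) = 1 then 0 else p v)"
    using touch edge_verts IE by (intro sum.mono_neutral_cong_right) auto
  finally have beta: "(\<Sum>J\<in>big_conn_edge_sets G. phys_beta G x y J * of_nat (Max {card (J' \<inter> I) |J'. J' \<subset> J}))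
    = (\<Sum>v\<in>\<Union>I. if card (incident G v) = 1 then 0 else p v)" .
  have "(\<Sum>e\<in>I. \<Sum>r\<in>{r \<in> e. card (incident G r) = 1}. p r)
      = (\<Sum>e\<in>I. \<Sum>v\<in>\<Union>I. if v \<in> e \<and> card (incident G v) = 1 then p v else 0)"
    by (intro sum.cong refl sum.mono_neutral_cong_left) auto
  also have "\<dots> = (\<Sum>v\<in>\<Union>I. \<Sum>e\<in>I. if v \<in> e \<and> card (incident G v) = 1 then p v else 0)"
    by (rule sum.swap)
  also have "\<dots> = (\<Sum>v\<in>\<Union>I. if card (incident G v) = 1 then p v else 0)"
  proof (intro sum.cong refl)
    fix v assume v: "v \<in> \<Union>I"
    show "(\<Sum>e\<in>I. if v \<in> e \<and> card (incident G v) = 1 then p v else 0) = (if card (incident G v) = 1 then p v else 0)"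
    proof (cases "card (incident G v) = 1")
      case True
      then obtain f where f: "incident G v = {f}" by (rule card_1_singletonE)
      have "f \<in> I" using v touch[of v] f by auto
      have "v \<in> e \<longleftrightarrow> e = f" if "e \<in> I" for e
        using f that IE by (auto simp: incident_def)
      then have "(\<Sum>e\<in>I. if v \<in> e \<and> card (incident G v) = 1 then p v else 0) = (\<Sum>e\<in>I. if e = f then p v else 0)"
        using True by (intro sum.cong) auto
      then show ?thesis using \<open>f \<in> I\<close> True by simp
    qed simp
  qed
  finally have alpha: "(\<Sum>e\<in>I. phys_alpha G x y e) = (\<Sum>v\<in>\<Union>I. if card (incident G v) = 1 then p v else 0) - (\<Sum>e\<in>I. y e)"
    by (simp add: phys_alpha_def sum_subtractf p_def)
  have "(\<Sum>v\<in>\<Union>I. if card (incident G v) = 1 then p v else 0) + (\<Sum>v\<in>\<Union>I. if card (incident G v) = 1 then 0 else p v)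
      = (\<Sum>v\<in>\<Union>I. p v)"
    unfolding sum.distrib[symmetric] by (intro sum.cong) auto
  then show ?thesis
    unfolding facet_variable_def alpha beta partial_energy_def edge_induced_def
    by (simp add: p_def algebra_simps)
qed

end

section \<open>The stringy integral\<close>

lemma prod_one_plus:
  fixes f :: "'b \<Rightarrow> 'a::comm_semiring_1"
  assumes "finite I" shows "(\<Prod>e\<in>I. 1 + f e) = (\<Sum>K\<in>Pow I. \<Prod>e\<in>K. f e)"
  using prod_add[OF assms, of f "\<lambda>_. 1"] by (simp add: add.commute)

context simple_graph
begin

definition rays :: "('v set \<Rightarrow> real) set" where
  "rays = negE ` edges G \<union> ind ` conn_edge_sets G"

lemma trop_pos_iff:
  "(\<forall>r\<in>rays. 0 < trop c r) \<longleftrightarrow> (\<forall>C\<in>conn_edge_sets G. 0 < trop c (ind C)) \<and> (\<forall>e\<in>edges G. 0 < c (Inl e))"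
  by (auto simp: rays_def trop_negE ball_Un)

sublocale monomial_rays "edges G" polys Monom rays
proof
  show "finite rays" by (simp add: rays_def)
  show "r e \<in> \<int>" if "r \<in> rays" for r e
    using that by (auto simp: rays_def negE_def ind_def)
  show "(\<integral>\<^sup>+t. ennreal (exp (- trop c t)) \<partial>lborelP (edges G)) < \<infinity>"
    if "\<And>r. r \<in> rays \<Longrightarrow> 0 < trop c r" for c
  proof -
    have "\<forall>r\<in>rays. 0 < trop c r" using that by blast
    then have "\<And>C. C \<in> conn_edge_sets G \<Longrightarrow> 0 < trop c (ind C)" "\<And>e. e \<in> edges G \<Longrightarrow> 0 < c (Inl e)"
      unfolding trop_pos_iff by blast+
    then have "(\<integral>\<^sup>+t. ennreal (exp (- trop c t)) \<partial>lborelP (edges G))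
      = ennreal (\<Sum>S\<in>Pow (edges G). (\<Prod>e\<in>edges G - S. 1 / c (Inl e)) * nested_sum (\<lambda>C. trop c (ind C)) S)"
      by (rule nn_integral_trop)
    then show ?thesis by simp
  qed
  \<comment> \<open>Witness: \<open>y = 1 / 2\<close> and all other parameters 1. The factors
    \<open>1 + w_e\<close> alone contribute \<open>card C\<close> to \<open>trop c (ind C)\<close>,
    against \<open>card C / 2\<close> from \<open>y\<close>, and the remaining polynomials
    contribute nothing negative.\<close>
  define c :: "'v set + ('v set + 'v set set) \<Rightarrow> real" where "c k = (case k of Inl e \<Rightarrow> 1 / 2 | Inr b \<Rightarrow> 1)" for k
  have "0 < trop c (ind C)" if C: "C \<in> conn_edge_sets G" for C
  proof -
    have CE: "C \<subseteq> edges G" "C \<noteq> {}" using conn_edge_setsD[OF C] by auto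
    have nonneg: "0 \<le> tpol b (ind C)" if b: "b \<in> polys" for b
    proof -
      obtain K where "K \<in> Monom b" "tpol b (ind C) = (\<Sum>e\<in>K. ind C e)" using tpol_attained[OF b] by blast
      then show ?thesis by (simp add: sum_nonneg ind_def)
    qed
    have "real (card C) = (\<Sum>e\<in>C. tpol (Inl e) (ind C))" by (simp add: tpol_Inl ind_def)
    also have "\<dots> = (\<Sum>b\<in>Inl ` C. tpol b (ind C))" by (simp add: sum.reindex)
    also have "\<dots> \<le> (\<Sum>b\<in>polys. tpol b (ind C))"
      using CE nonneg by (intro sum_mono2) (auto simp: polys_def)
    also have "\<dots> = (\<Sum>b\<in>polys. c (Inr b) * tpol b (ind C))" by (simp add: c_def)
    finally have "real (card C) \<le> \<dots>" .
    moreover have "(\<Sum>e\<in>edges G. c (Inl e) * ind C e) = real (card C) / 2"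
    proof -
      have "(\<Sum>e\<in>edges G. c (Inl e) * ind C e) = (\<Sum>e\<in>C. 1 / 2)"
        using CE by (intro sum.mono_neutral_cong_right) (auto simp: ind_def c_def)
      then show ?thesis by simp
    qed
    moreover have "0 < card C" using CE by (simp add: card_gt_0_iff)
    ultimately show ?thesis by (simp add: trop_def)
  qed
  moreover have "\<forall>e\<in>edges G. 0 < c (Inl e)" by (simp add: c_def)
  ultimately show "\<exists>c. \<forall>r\<in>rays. 0 < trop c r" unfolding trop_pos_iff by blast
qed

section \<open>Translation of the parameters and of the integral\<close>

lemma rv_params:
  "of_real_vec (\<lambda>k. case k of Inl e \<Rightarrow> y e | Inr (Inl e) \<Rightarrow> \<alpha> e | Inr (Inr I) \<Rightarrow> \<beta> I)
    = params (\<lambda>e. of_real (y e)) (\<lambda>e. of_real (\<alpha> e)) (\<lambda>I. of_real (\<beta> I))"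
  by (auto simp: of_real_vec_def params_def vec_eq_iff split: sum.splits)

lemma sum_polys: "(\<Sum>b\<in>polys. F b) = (\<Sum>e\<in>edges G. F (Inl e)) + (\<Sum>J\<in>big_conn_edge_sets G. F (Inr J))"
proof -
  have "(\<Sum>b\<in>polys. F b) = (\<Sum>b\<in>Inl ` edges G. F b) + (\<Sum>b\<in>Inr ` big_conn_edge_sets G. F b)"
    unfolding polys_def by (intro sum.union_disjoint) auto
  then show ?thesis by (simp add: sum.reindex)
qed

lemma X_ind_params:
  assumes I: "I \<in> conn_edge_sets G"
  shows "X (ind I) (params y \<alpha> \<beta>) = facet_variable G y \<alpha> \<beta> I"
proof -
  have IE: "I \<subseteq> edges G" using conn_edge_setsD(2)[OF I] .
  have ind_sum: "(\<Sum>e\<in>edges G. f e * complex_of_real (ind I e)) = (\<Sum>e\<in>I. f e)" for f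
    using IE by (intro sum.mono_neutral_cong_right) (auto simp: ind_def)
  have 1: "(\<Sum>e\<in>edges G. params y \<alpha> \<beta> $ Inr (Inl e) * complex_of_real (tpol (Inl e) (ind I))) = (\<Sum>e\<in>I. \<alpha> e)"
  proof -
    have "tpol (Inl e) (ind I) = ind I e" for e by (simp add: tpol_Inl ind_def)
    then show ?thesis by (simp add: params_def ind_sum)
  qed
  have 2: "(\<Sum>J\<in>big_conn_edge_sets G. params y \<alpha> \<beta> $ Inr (Inr J) * complex_of_real (tpol (Inr J) (ind I)))
      = (\<Sum>J\<in>big_conn_edge_sets G. \<beta> J * of_nat (Max {card (J' \<inter> I) |J'. J' \<subset> J}))"
  proof (intro sum.cong refl)
    fix J assume J: "J \<in> big_conn_edge_sets G"
    then have ne: "J \<noteq> {}" by (auto simp: big_conn_edge_sets_def conn_edge_sets_def)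
    show "params y \<alpha> \<beta> $ Inr (Inr J) * complex_of_real (tpol (Inr J) (ind I)) = \<beta> J * of_nat (Max {card (J' \<inter> I) |J'. J' \<subset> J})"
      unfolding Max_card_tpol[OF ne, symmetric] of_real_of_nat_eq by (simp add: params_def)
  qed
  have 3: "(\<Sum>e\<in>edges G. params y \<alpha> \<beta> $ Inl e * complex_of_real (ind I e)) = (\<Sum>e\<in>I. y e)"
    by (simp add: params_def ind_sum)
  show ?thesis
    unfolding X_def sum_polys 1 2 3 facet_variable_def by (rule refl)
qed

lemma X_negE: "e \<in> edges G \<Longrightarrow> X (negE e) z = z $ Inl e"
proof -
  assume e: "e \<in> edges G"
  have "tpol b (negE e) = 0" if "b \<in> polys" for b
    using that by (rule tpol_nonpos) (simp add: negE_def)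
  moreover have "(\<Sum>f\<in>edges G. z $ Inl f * complex_of_real (negE e f)) = (\<Sum>f\<in>edges G. if f = e then - z $ Inl e else 0)"
    by (intro sum.cong) (auto simp: negE_def)
  ultimately show ?thesis using e by (simp add: X_def)
qed

lemma pol_Inl: "pol (Inl e) t = 1 + exp (t e)"
  by (simp add: pol_def Monom_def Pow_insert)

lemma pol_Inr: "pol (Inr I) t = F_poly I (\<lambda>e. exp (t e))"
proof -
  have "Pow I = insert I {K. K \<subset> I}" by auto
  then have "(\<Sum>K\<in>Pow I. \<Prod>e\<in>K. exp (t e)) = (\<Prod>e\<in>I. exp (t e)) + (\<Sum>K\<in>{K. K \<subset> I}. \<Prod>e\<in>K. exp (t e))"
    by simp
  then show ?thesis
    by (simp add: pol_def Monom_def F_poly_def prod_one_plus exp_sum)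
qed

text \<open>The indicator of the positive orthant and the factors \<open>1 / w\<close> form the
  density in \<open>integral_lborelP_exp\<close>; the rest of the integrand becomes
  \<open>phi\<close> on inserting \<open>w = exp t\<close>.\<close>

lemma stringy_integral_eq:
  fixes y \<alpha> :: "'v set \<Rightarrow> real" and \<beta> :: "'v set set \<Rightarrow> real"
  assumes a: "0 < a"
  defines "c \<equiv> (\<lambda>k. a * (case k of Inl e \<Rightarrow> y e | Inr (Inl e) \<Rightarrow> \<alpha> e | Inr (Inr I) \<Rightarrow> \<beta> I))"
  assumes c: "\<And>r. r \<in> rays \<Longrightarrow> 0 < trop c r"
  shows "complex_of_real (stringy_integral G a y \<alpha> \<beta>) = of_real a ^ card (edges G) * N (of_real_vec c)"
proof -
  define h where "h w = (\<Prod>e\<in>edges G. w e powr (a * y e)) * (\<Prod>e\<in>edges G. (1 + w e) powr (- (a * \<alpha> e))) *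
        (\<Prod>I\<in>big_conn_edge_sets G. F_poly I w powr (- (a * \<beta> I)))" for w :: "'v set \<Rightarrow> real"
  have cm: "(\<lambda>w. w e :: real) \<in> borel_measurable (lborelP (edges G))" if "e \<in> edges G" for e
    using component_measurable[OF that] .
  have Fm: "F_poly I \<in> borel_measurable (lborelP (edges G))" if "I \<in> big_conn_edge_sets G" for I
  proof -
    have "I \<subseteq> edges G" using that by (auto simp: big_conn_edge_sets_def conn_edge_sets_def)
    then show ?thesis unfolding F_poly_def[abs_def]
      by (intro borel_measurable_diff borel_measurable_prod borel_measurable_add borel_measurable_const cm) auto
  qed
  have hm: "h \<in> borel_measurable (lborelP (edges G))"
    unfolding h_def[abs_def]
    by (intro borel_measurable_times borel_measurable_prod powr_real_measurable borel_measurable_add borel_measurable_const cm Fm)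
  have "stringy_integral G a y \<alpha> \<beta> = a ^ card (edges G) *
     (\<integral>w. (\<Prod>e\<in>edges G. indicator {0<..} (w e) / w e) * h w \<partial>lborelP (edges G))"
    unfolding stringy_integral_def set_lebesgue_integral_def
  proof (intro arg_cong2[where f="(*)"] refl Bochner_Integration.integral_cong)
    fix w :: "'v set \<Rightarrow> real" assume w: "w \<in> space (lborelP (edges G))"
    have "indicat_real (edges G \<rightarrow>\<^sub>E {0<..}) w = (\<Prod>e\<in>edges G. indicator {0<..} (w e))"
    proof (cases "\<forall>e\<in>edges G. 0 < w e")
      case True
      then have "w \<in> edges G \<rightarrow>\<^sub>E {0<..}" using w by (auto simp: space_PiM PiE_def Pi_def)
      then show ?thesis using True by simp
    next
      case False
      then have "w \<notin> edges G \<rightarrow>\<^sub>E {0<..}" by (auto simp: PiE_def Pi_def)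
      moreover have "(\<Prod>e\<in>edges G. indicat_real {0<..} (w e)) = 0" using False by (auto simp: indicator_def)
      ultimately show ?thesis by simp
    qed
    then show "indicat_real (edges G \<rightarrow>\<^sub>E {0<..}) w *\<^sub>R ((\<Prod>e\<in>edges G. 1 / w e) * (\<Prod>e\<in>edges G. w e powr (a * y e)) *
        (\<Prod>e\<in>edges G. (1 + w e) powr (- (a * \<alpha> e))) * (\<Prod>I\<in>big_conn_edge_sets G. F_poly I w powr (- (a * \<beta> I))))
      = (\<Prod>e\<in>edges G. indicator {0<..} (w e) / w e) * h w"
      by (simp add: h_def prod_dividef mult.assoc)
  qed
  also have "(\<integral>w. (\<Prod>e\<in>edges G. indicator {0<..} (w e) / w e) * h w \<partial>lborelP (edges G))
      = (\<integral>t. h (\<lambda>e\<in>edges G. exp (t e)) \<partial>lborelP (edges G))"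
    by (rule integral_lborelP_exp[OF _ hm]) simp
  finally have 1: "stringy_integral G a y \<alpha> \<beta> = a ^ card (edges G) * (\<integral>t. h (\<lambda>e\<in>edges G. exp (t e)) \<partial>lborelP (edges G))" .
  have phi: "phi (of_real_vec c) t = of_real (h (\<lambda>e\<in>edges G. exp (t e)))" for t
  proof -
    have "(\<Sum>k\<in>UNIV. c k * L k t) = (\<Sum>e\<in>edges G. a * y e * t e)
      + (\<Sum>e\<in>edges G. - (a * \<alpha> e) * ln (pol (Inl e) t)) + (\<Sum>J\<in>big_conn_edge_sets G. - (a * \<beta> J) * ln (pol (Inr J) t))"
      using sum_L[of c t] by (simp add: c_def sum_polys sum_negf)
    then have "exp (\<Sum>k\<in>UNIV. c k * L k t) = (\<Prod>e\<in>edges G. exp (a * y e * t e))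
      * (\<Prod>e\<in>edges G. exp (- (a * \<alpha> e) * ln (pol (Inl e) t))) * (\<Prod>J\<in>big_conn_edge_sets G. exp (- (a * \<beta> J) * ln (pol (Inr J) t)))"
      by (simp only: exp_add exp_sum finite)
    also have "\<dots> = h (\<lambda>e\<in>edges G. exp (t e))"
      unfolding h_def
    proof (intro arg_cong2[where f="(*)"] prod.cong refl)
      fix e assume e: "e \<in> edges G"
      show "exp (a * y e * t e) = (\<lambda>e\<in>edges G. exp (t e)) e powr (a * y e)"
        using e by (simp add: powr_def)
      have "0 < 1 + exp (t e)" by (simp add: add_pos_pos)
      then show "exp (- (a * \<alpha> e) * ln (pol (Inl e) t)) = (1 + (\<lambda>e\<in>edges G. exp (t e)) e) powr (- (a * \<alpha> e))"
        using e by (simp add: powr_def pol_Inl)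
    next
      fix J assume J: "J \<in> big_conn_edge_sets G"
      then have JE: "J \<subseteq> edges G" by (auto simp: big_conn_edge_sets_def conn_edge_sets_def)
      have "F_poly J (\<lambda>e\<in>edges G. exp (t e)) = pol (Inr J) t"
        unfolding pol_Inr F_poly_def using JE by (intro arg_cong2[where f="(-)"] prod.cong refl) auto
      moreover have "0 < pol (Inr J) t" using J by (intro pol_pos) (simp add: polys_def)
      ultimately show "exp (- (a * \<beta> J) * ln (pol (Inr J) t)) = F_poly J (\<lambda>e\<in>edges G. exp (t e)) powr (- (a * \<beta> J))"
        by (simp add: powr_def)
    qed
    finally have "exp (\<Sum>k\<in>UNIV. c k * L k t) = h (\<lambda>e\<in>edges G. exp (t e))" .
    moreover have "phi (of_real_vec c) t = of_real (exp (\<Sum>k\<in>UNIV. c k * L k t))"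
      by (simp add: phi_def of_real_vec_def flip: exp_of_real)
    ultimately show ?thesis by simp
  qed
  have "N (of_real_vec c) = of_real (\<integral>t. h (\<lambda>e\<in>edges G. exp (t e)) \<partial>lborelP (edges G))"
    unfolding N_def phi by simp
  then show ?thesis by (simp add: 1)
qed

text \<open>\<open>trop c r\<close> is the upper bound \<open>hr\<close> for the polytope in the
  direction \<open>r\<close> minus the value at \<open>y\<close>. A relative interior point can be
  moved a little further in that direction inside the polytope, so the inequality at
  \<open>y\<close> is strict.\<close>

lemma convergence_domain_trop_pos:
  fixes y \<alpha> :: "'v set \<Rightarrow> real" and \<beta> :: "'v set set \<Rightarrow> real"
  assumes cd: "convergence_domain G y \<alpha> \<beta>" and r: "r \<in> rays"
  defines "c \<equiv> (\<lambda>k. case k of Inl e \<Rightarrow> y e | Inr (Inl e) \<Rightarrow> \<alpha> e | Inr (Inr I) \<Rightarrow> \<beta> I)"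
  shows "0 < trop c r"
proof -
  define P where "P = newton_polytope G \<alpha> \<beta>"
  define Y :: "real ^ 'v set" where "Y = (\<chi> e. if e \<in> edges G then y e else 0)"
  define rr :: "real ^ 'v set" where "rr = (\<chi> e. if e \<in> edges G then r e else 0)"
  define hr where "hr = (\<Sum>b\<in>polys. c (Inr b) * tpol b r)"
  have pos: "\<And>e. e \<in> edges G \<Longrightarrow> 0 < \<alpha> e" "\<And>I. I \<in> big_conn_edge_sets G \<Longrightarrow> 0 < \<beta> I"
    and Y: "Y \<in> rel_interior P"
    using cd by (auto simp: convergence_domain_def Y_def P_def)
  have elem: "\<exists>s q. z = (\<Sum>e\<in>edges G. \<alpha> e *\<^sub>R s e) + (\<Sum>I\<in>big_conn_edge_sets G. \<beta> I *\<^sub>R q I)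
      \<and> (\<forall>e\<in>edges G. s e \<in> closed_segment 0 (axis e 1)) \<and> (\<forall>I\<in>big_conn_edge_sets G. q I \<in> Q_polytope I)"
    if z: "z \<in> P" for z
  proof -
    obtain u v where uv: "z = u + v" "u \<in> (\<Sum>e\<in>edges G. (*\<^sub>R) (\<alpha> e) ` closed_segment 0 (axis e 1))"
      "v \<in> (\<Sum>I\<in>big_conn_edge_sets G. (*\<^sub>R) (\<beta> I) ` Q_polytope I)"
      using z unfolding P_def newton_polytope_def by (rule set_plus_elim)
    obtain s where s: "u = (\<Sum>e\<in>edges G. s e)" "\<And>e. e \<in> edges G \<Longrightarrow> s e \<in> (*\<^sub>R) (\<alpha> e) ` closed_segment 0 (axis e 1)"
      using uv(2) by (auto simp: set_sum_alt)
    obtain q where q: "v = (\<Sum>I\<in>big_conn_edge_sets G. q I)" "\<And>I. I \<in> big_conn_edge_sets G \<Longrightarrow> q I \<in> (*\<^sub>R) (\<beta> I) ` Q_polytope I"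
      using uv(3) by (auto simp: set_sum_alt)
    obtain s' where s': "\<And>e. e \<in> edges G \<Longrightarrow> s e = \<alpha> e *\<^sub>R s' e \<and> s' e \<in> closed_segment 0 (axis e 1)"
      using s(2) unfolding image_iff by metis
    obtain q' where q': "\<And>I. I \<in> big_conn_edge_sets G \<Longrightarrow> q I = \<beta> I *\<^sub>R q' I \<and> q' I \<in> Q_polytope I"
      using q(2) unfolding image_iff by metis
    have "z = (\<Sum>e\<in>edges G. \<alpha> e *\<^sub>R s' e) + (\<Sum>I\<in>big_conn_edge_sets G. \<beta> I *\<^sub>R q' I)"
      unfolding uv(1) s(1) q(1) using s' q' by (intro arg_cong2[where f="(+)"] sum.cong) auto
    then show ?thesis using s' q' by blast
  qed
  have support: "rr \<bullet> z \<le> hr" if "z \<in> P" for z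
  proof -
    obtain s q where sq: "z = (\<Sum>e\<in>edges G. \<alpha> e *\<^sub>R s e) + (\<Sum>I\<in>big_conn_edge_sets G. \<beta> I *\<^sub>R q I)"
      "\<And>e. e \<in> edges G \<Longrightarrow> s e \<in> closed_segment 0 (axis e 1)" "\<And>I. I \<in> big_conn_edge_sets G \<Longrightarrow> q I \<in> Q_polytope I"
      using elem[OF \<open>z \<in> P\<close>] by blast
    have 1: "rr \<bullet> s e \<le> tpol (Inl e) r" if e: "e \<in> edges G" for e
    proof -
      obtain u where u: "0 \<le> u" "u \<le> 1" "s e = u *\<^sub>R axis e 1"
        using sq(2)[OF e] by (auto simp: closed_segment_def)
      have "rr \<bullet> s e = u * r e" using e by (simp add: u(3) inner_axis rr_def)
      also have "\<dots> \<le> max 0 (r e)"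
        using u by (cases "0 \<le> r e") (auto simp: mult_left_le_one_le mult_nonneg_nonpos intro: le_max_iff_disj[THEN iffD2])
      finally show ?thesis by (simp add: tpol_Inl)
    qed
    have 2: "rr \<bullet> q I \<le> tpol (Inr I) r" if I: "I \<in> big_conn_edge_sets G" for I
    proof -
      have IE: "I \<subseteq> edges G" using I by (auto simp: big_conn_edge_sets_def conn_edge_sets_def)
      have "convex {z. rr \<bullet> z \<le> tpol (Inr I) r}" by (rule convex_halfspace_le)
      moreover have "{\<Sum>e\<in>J. axis e 1 |J. J \<subset> I} \<subseteq> {z. rr \<bullet> z \<le> tpol (Inr I) r}"
      proof
        fix w :: "real ^ 'v set" assume "w \<in> {\<Sum>e\<in>J. axis e 1 |J. J \<subset> I}"
        then obtain J where J: "J \<subset> I" and w: "w = (\<Sum>e\<in>J. axis e 1)" by blast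
        have "rr \<bullet> (\<Sum>e\<in>J. axis e 1) = (\<Sum>e\<in>J. r e)"
          unfolding inner_sum_right using J IE by (intro sum.cong) (auto simp: inner_axis rr_def)
        also have "\<dots> \<le> tpol (Inr I) r" using J by (intro tpol_ge) (simp add: Monom_def)
        finally show "w \<in> {z. rr \<bullet> z \<le> tpol (Inr I) r}" by (simp add: w)
      qed
      ultimately have "Q_polytope I \<subseteq> {z. rr \<bullet> z \<le> tpol (Inr I) r}"
        unfolding Q_polytope_def by (intro hull_minimal)
      then show ?thesis using sq(3)[OF I] by blast
    qed
    have "rr \<bullet> z = (\<Sum>e\<in>edges G. \<alpha> e * (rr \<bullet> s e)) + (\<Sum>I\<in>big_conn_edge_sets G. \<beta> I * (rr \<bullet> q I))"
      by (simp add: sq(1) inner_add_right inner_sum_right)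
    also have "\<dots> \<le> (\<Sum>e\<in>edges G. \<alpha> e * tpol (Inl e) r) + (\<Sum>I\<in>big_conn_edge_sets G. \<beta> I * tpol (Inr I) r)"
      using pos 1 2 by (intro add_mono sum_mono mult_left_mono) (auto simp: less_imp_le)
    also have "\<dots> = hr" by (simp add: hr_def sum_polys c_def)
    finally show ?thesis .
  qed
  have zeroQ: "0 \<in> Q_polytope I" if "I \<in> big_conn_edge_sets G" for I
  proof -
    have "{} \<subset> I" using that by (auto simp: big_conn_edge_sets_def conn_edge_sets_def)
    then have "(0 :: real ^ 'v set) \<in> {\<Sum>e\<in>J. axis e 1 |J. J \<subset> I}" by (auto intro!: exI[of _ "{}"])
    then show ?thesis unfolding Q_polytope_def by (rule hull_inc)
  qed
  have inP: "(\<Sum>e\<in>edges G. \<alpha> e *\<^sub>R s e) \<in> P" if s: "\<And>e. e \<in> edges G \<Longrightarrow> s e \<in> closed_segment 0 (axis e 1)" for s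
  proof -
    have "(\<Sum>e\<in>edges G. \<alpha> e *\<^sub>R s e) \<in> (\<Sum>e\<in>edges G. (*\<^sub>R) (\<alpha> e) ` closed_segment 0 (axis e 1))"
      unfolding set_sum_alt[OF finite] using s by blast
    moreover have "(\<Sum>I\<in>big_conn_edge_sets G. \<beta> I *\<^sub>R 0) \<in> (\<Sum>I\<in>big_conn_edge_sets G. (*\<^sub>R) (\<beta> I) ` Q_polytope I)"
      unfolding set_sum_alt[OF finite] using zeroQ by blast
    ultimately show ?thesis
      unfolding P_def newton_polytope_def using set_plus_intro by fastforce
  qed
  have zP: "0 \<in> P" using inP[of "\<lambda>_. 0"] by simp
  \<comment> \<open>Positivity of \<open>\<alpha>\<close> puts all coordinate directions of edges
    into the span of \<open>P\<close>, so \<open>rr\<close> is an admissible direction for the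
    relative interior.\<close>
  have axis_span: "axis e 1 \<in> span P" if e: "e \<in> edges G" for e
  proof -
    have "(\<Sum>f\<in>edges G. \<alpha> f *\<^sub>R (if f = e then axis e 1 else 0)) \<in> P"
      by (intro inP) auto
    also have "(\<Sum>f\<in>edges G. \<alpha> f *\<^sub>R (if f = e then axis e 1 else 0)) = \<alpha> e *\<^sub>R (axis e 1 :: real ^ 'v set)"
      using e by (simp add: if_distrib cong: if_cong)
    finally have "(1 / \<alpha> e) *\<^sub>R (\<alpha> e *\<^sub>R axis e 1) \<in> span P" by (intro span_mul span_base)
    then show ?thesis using pos(1)[OF e] by simp
  qed
  have "rr = (\<Sum>e\<in>edges G. r e *\<^sub>R axis e 1)"
  proof -
    have "(\<Sum>e\<in>edges G. r e *\<^sub>R axis e (1::real)) $ f = rr $ f" for f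
    proof -
      have "(\<Sum>e\<in>edges G. r e *\<^sub>R axis e (1::real)) $ f = (\<Sum>e\<in>edges G. if e = f then r f else 0)"
        unfolding sum_component by (intro sum.cong refl) (auto simp: axis_def)
      then show ?thesis by (simp add: rr_def)
    qed
    then show ?thesis by (simp add: vec_eq_iff)
  qed
  then have rr_span: "rr \<in> span P" using axis_span by (auto intro!: span_sum span_mul)
  have aff: "affine hull P = span P" using affine_hull_span_0[of P] hull_inc[OF zP] by blast
  obtain \<epsilon> where \<epsilon>: "0 < \<epsilon>" "ball Y \<epsilon> \<inter> affine hull P \<subseteq> P"
    using Y by (auto simp: mem_rel_interior_ball)
  have YP: "Y \<in> P" using Y rel_interior_subset by blast
  define n where "n = norm rr + 1"
  have n: "0 < n" by (simp add: n_def add_nonneg_pos)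
  define \<delta> where "\<delta> = \<epsilon> / (2 * n)"
  have d: "0 < \<delta>" using \<epsilon> n by (simp add: \<delta>_def)
  have "\<delta> * norm rr < \<epsilon>"
  proof -
    have "\<delta> * norm rr \<le> \<delta> * n" using d by (intro mult_left_mono) (auto simp: n_def)
    also have "\<dots> = \<epsilon> / 2" using n by (simp add: \<delta>_def)
    finally show ?thesis using \<epsilon>(1) by simp
  qed
  then have "Y + \<delta> *\<^sub>R rr \<in> ball Y \<epsilon>" using d by (simp add: dist_norm)
  moreover have "Y + \<delta> *\<^sub>R rr \<in> affine hull P"
    unfolding aff using YP rr_span by (intro span_add span_mul) (auto intro: span_base)
  ultimately have "rr \<bullet> (Y + \<delta> *\<^sub>R rr) \<le> hr" using \<epsilon>(2) support by blast
  then have "rr \<bullet> Y + \<delta> * (rr \<bullet> rr) \<le> hr" by (simp add: inner_add_right)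
  moreover have "rr \<noteq> 0"
  proof -
    obtain f where "f \<in> edges G" "r f \<noteq> 0"
    proof -
      from r consider e where "e \<in> edges G" "r = negE e" | I where "I \<in> conn_edge_sets G" "r = ind I"
        by (auto simp: rays_def)
      then show thesis
      proof cases
        case 1
        then show thesis using that[of e] by (simp add: negE_def)
      next
        case 2
        then obtain e where "e \<in> I" "e \<in> edges G" using conn_edge_setsD(1,2)[of I] by blast
        then show thesis using that[of e] 2 by (simp add: ind_def)
      qed
    qed
    then have "rr $ f \<noteq> 0" by (simp add: rr_def)
    then show ?thesis by auto
  qed
  then have "0 < \<delta> * (rr \<bullet> rr)" using d by simp
  moreover have "rr \<bullet> Y = (\<Sum>e\<in>edges G. c (Inl e) * r e)"
    unfolding inner_vec_def by (intro sum.mono_neutral_cong_right) (auto simp: rr_def Y_def c_def)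
  ultimately show ?thesis by (simp add: trop_def hr_def)
qed

text \<open>The tropical integral as a rational function of complex parameters; \<open>S\<close>
  stands for the set of positive coordinates of \<open>t\<close>.\<close>

definition limit_value :: "complex ^ ('v set + ('v set + 'v set set)) \<Rightarrow> complex" where
  "limit_value z = (\<Sum>S\<in>Pow (edges G). (\<Prod>e\<in>edges G - S. 1 / z $ Inl e) * nested_sum (\<lambda>C. X (ind C) z) S)"

lemma nested_sum_cong:
  assumes "\<And>C. C \<in> conn_edge_sets G \<Longrightarrow> W C = W' C" "S \<subseteq> edges G"
  shows "nested_sum W S = nested_sum W' S"
  using assms(2)
proof (induction rule: nested_sum_induct)
  case (step S)
  have "comp S \<in> conn_edge_sets G" using is_comp_comp[OF step(1,2)] by (simp add: is_comp_def)
  then show ?case using step by (simp add: nested_sum_rec assms(1))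
qed simp

lemma nested_sum_of_real:
  assumes "S \<subseteq> edges G"
  shows "of_real (nested_sum W S) = nested_sum (\<lambda>C. complex_of_real (W C)) S"
  using assms by (induction rule: nested_sum_induct) (simp_all add: nested_sum_rec)

lemma nested_sum_scale:
  fixes W :: "'v set set \<Rightarrow> complex"
  assumes "S \<subseteq> edges G" "a \<noteq> 0"
  shows "nested_sum (\<lambda>C. a * W C) S = nested_sum W S / a ^ card S"
  using assms(1)
proof (induction rule: nested_sum_induct)
  case (step S)
  have "nested_sum (\<lambda>C. a * W C) (S - {e}) = a * (nested_sum W (S - {e}) / a ^ card S)" if "e \<in> comp S" for e
  proof -
    have "e \<in> S" using that is_comp_comp[OF step(1,2)] by (auto simp: is_comp_def)
    then have "card S = Suc (card (S - {e}))" by (rule card.remove[OF finite])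
    then show ?thesis using step(3)[OF that] assms(2) by simp
  qed
  then have "(\<Sum>e\<in>comp S. nested_sum (\<lambda>C. a * W C) (S - {e})) = a * ((\<Sum>e\<in>comp S. nested_sum W (S - {e})) / a ^ card S)"
    by (simp add: sum_distrib_left sum_divide_distrib)
  then show ?case using step(1,2) assms(2)
    by (simp add: nested_sum_rec)
qed simp

lemma holomorphic_nd_nested_sum:
  assumes "S \<subseteq> edges G"
  shows "holomorphic_nd (\<lambda>z. nested_sum (\<lambda>C. X (ind C) z) S) {z. \<forall>r\<in>rays. X r z \<noteq> 0}"
  using assms
proof (induction rule: nested_sum_induct)
  case (step S)
  have C: "ind (comp S) \<in> rays" using is_comp_comp[OF step(1,2)] by (simp add: is_comp_def rays_def)
  have "holomorphic_nd (\<lambda>z. (1 / X (ind (comp S)) z) * (\<Sum>e\<in>comp S. nested_sum (\<lambda>C. X (ind C) z) (S - {e})))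
     {z. \<forall>r\<in>rays. X r z \<noteq> 0}"
    using C step(3) by (intro holomorphic_nd_mult holomorphic_nd_sum holomorphic_nd_divide holomorphic_nd_X) auto
  then show ?case using step(1,2) by (simp add: nested_sum_rec inverse_eq_divide)
qed simp

lemma holomorphic_nd_limit_value: "holomorphic_nd limit_value {z. \<forall>r\<in>rays. X r z \<noteq> 0}"
  unfolding limit_value_def[abs_def]
proof (intro holomorphic_nd_sum holomorphic_nd_mult holomorphic_nd_prod holomorphic_nd_divide)
  fix S e and z :: "complex ^ ('v set + ('v set + 'v set set))"
  assume "e \<in> edges G - S" "z \<in> {z. \<forall>r\<in>rays. X r z \<noteq> 0}"
  moreover from this have "negE e \<in> rays" by (simp add: rays_def)
  ultimately show "z $ Inl e \<noteq> 0" using X_negE[of e z] by force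
qed (auto intro: holomorphic_nd_nested_sum)

lemma V_eq_limit_value:
  assumes "\<And>r. r \<in> rays \<Longrightarrow> 0 < trop c r"
  shows "of_real (V c) = limit_value (of_real_vec c)"
proof -
  have "\<forall>r\<in>rays. 0 < trop c r" using assms by blast
  then have pos: "\<And>C. C \<in> conn_edge_sets G \<Longrightarrow> 0 < trop c (ind C)" "\<And>e. e \<in> edges G \<Longrightarrow> 0 < c (Inl e)"
    unfolding trop_pos_iff by blast+
  have eq: "(\<integral>\<^sup>+t. ennreal (exp (- trop c t)) \<partial>lborelP (edges G))
    = ennreal (\<Sum>S\<in>Pow (edges G). (\<Prod>e\<in>edges G - S. 1 / c (Inl e)) * nested_sum (\<lambda>C. trop c (ind C)) S)"
    using pos by (rule nn_integral_trop)
  have rv_nth: "of_real_vec c $ k = of_real (c k)" for k by (simp add: of_real_vec_def)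
  have "V c = (\<Sum>S\<in>Pow (edges G). (\<Prod>e\<in>edges G - S. 1 / c (Inl e)) * nested_sum (\<lambda>C. trop c (ind C)) S)"
    unfolding V_def eq using pos by (intro enn2real_ennreal sum_nonneg mult_nonneg_nonneg nested_sum_nonneg prod_nonneg) (auto simp: less_imp_le)
  then show ?thesis
    unfolding limit_value_def
    by (auto simp: nested_sum_of_real X_rv rv_nth intro!: sum.cong)
qed

lemma limit_value_scale:
  assumes "a \<noteq> 0" shows "limit_value (a *s z) = limit_value z / a ^ card (edges G)"
  unfolding limit_value_def sum_divide_distrib
proof (intro sum.cong refl)
  fix S assume S: "S \<in> Pow (edges G)"
  have "(\<Prod>e\<in>edges G - S. 1 / (a *s z) $ Inl e) = (\<Prod>e\<in>edges G - S. (1 / a) * (1 / z $ Inl e))"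
    by (intro prod.cong) auto
  also have "\<dots> = (1 / a) ^ card (edges G - S) * (\<Prod>e\<in>edges G - S. 1 / z $ Inl e)"
    by (simp only: prod.distrib prod_constant)
  finally have 1: "(\<Prod>e\<in>edges G - S. 1 / (a *s z) $ Inl e) = (1 / a) ^ card (edges G - S) * (\<Prod>e\<in>edges G - S. 1 / z $ Inl e)" .
  have 2: "nested_sum (\<lambda>C. X (ind C) (a *s z)) S = nested_sum (\<lambda>C. X (ind C) z) S / a ^ card S"
    unfolding X_scale using S assms by (intro nested_sum_scale) auto
  have "card (edges G - S) + card S = card (edges G)"
    using S card_mono[of "edges G" S] by (simp add: card_Diff_subset)
  then have 3: "a ^ card (edges G) = a ^ card (edges G - S) * a ^ card S" by (simp add: power_add[symmetric])
  show "(\<Prod>e\<in>edges G - S. 1 / (a *s z) $ Inl e) * nested_sum (\<lambda>C. X (ind C) (a *s z)) S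
    = (\<Prod>e\<in>edges G - S. 1 / z $ Inl e) * nested_sum (\<lambda>C. X (ind C) z) S / a ^ card (edges G)"
    unfolding 1 2 3 by (simp add: power_divide)
qed

text \<open>In \<open>limit_Nc\<close> this makes the degree \<open>card R - n\<close> a true
  difference.\<close>

lemma card_edges_le_rays: "card (edges G) \<le> card rays"
proof -
  have "inj_on negE (edges G)"
    by (intro inj_onI) (metis negE_def zero_neq_neg_one)
  then have "card (edges G) = card (negE ` edges G)" by (simp add: card_image)
  also have "\<dots> \<le> card rays" by (intro card_mono) (auto simp: rays_def)
  finally show ?thesis .
qed

end

text \<open>The deleted edges \<open>I\<close> play the role of the negative coordinates:
  \<open>S = edges G - I\<close> matches the two sums term by term. Each term has
  \<open>card I + 1\<close> components against \<open>card I\<close> edge factors, which leaves a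
  single 2.\<close>

lemma (in forest_graph) correlator_eq_limit_value:
  assumes conn: "connected_graph G"
  shows "correlator G x y = 2 / (\<Prod>v\<in>verts G. vertex_energy G x y v) *
    limit_value (params y (phys_alpha G x y) (phys_beta G x y))"
proof -
  define P where "P = (\<Prod>v\<in>verts G. vertex_energy G x y v)"
  define g where "g S = nested_sum (\<lambda>C. partial_energy G x y (edge_induced C)) S" for S
  have summand: "(\<Prod>K\<in>components_of_graph (delete_edges G I). 2 * tubing_sum G x y K) / (\<Prod>e\<in>I. 2 * y e)
      = 2 / P * ((\<Prod>e\<in>I. 1 / y e) * g (edges G - I))" if I: "I \<in> Pow (edges G)" for I
  proof -
    have "card (edges G - (edges G - I)) = card I" using I by (simp add: double_diff)
    then have card: "card (comps (edges G - I)) = Suc (card I)" using card_comps[OF conn, of "edges G - I"] by simp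
    have "(\<Prod>K\<in>components_of_graph (delete_edges G I). 2 * tubing_sum G x y K)
        = 2 ^ Suc (card I) * (\<Prod>K\<in>comps (edges G - I). tubing_sum G x y K)"
      unfolding delete_edges_def by (subst comps_eq) (auto simp: prod.distrib card)
    also have "(\<Prod>K\<in>comps (edges G - I). tubing_sum G x y K) = inverse P * g (edges G - I)"
      unfolding g_def P_def by (subst prod_tubing_sum) (auto simp: prod_inversef[symmetric] o_def)
    finally have 1: "(\<Prod>K\<in>components_of_graph (delete_edges G I). 2 * tubing_sum G x y K) = 2 ^ Suc (card I) * (inverse P * g (edges G - I))" .
    have 2: "(\<Prod>e\<in>I. 2 * y e) = 2 ^ card I * (\<Prod>e\<in>I. y e)" by (simp add: prod.distrib)
    have 3: "(\<Prod>e\<in>I. 1 / y e) = 1 / (\<Prod>e\<in>I. y e)" by (simp add: prod_dividef)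
    show ?thesis unfolding 1 2 3 by (simp add: divide_inverse)
  qed
  have "correlator G x y = (\<Sum>I\<in>Pow (edges G). 2 / P * ((\<Prod>e\<in>I. 1 / y e) * g (edges G - I)))"
    unfolding correlator_def by (intro sum.cong refl summand)
  also have "\<dots> = 2 / P * (\<Sum>I\<in>Pow (edges G). (\<Prod>e\<in>I. 1 / y e) * g (edges G - I))"
    by (simp only: sum_distrib_left)
  also have "(\<Sum>I\<in>Pow (edges G). (\<Prod>e\<in>I. 1 / y e) * g (edges G - I))
      = (\<Sum>S\<in>Pow (edges G). (\<Prod>e\<in>edges G - S. 1 / y e) * g S)"
    by (rule sum.reindex_bij_witness[of _ "\<lambda>S. edges G - S" "\<lambda>S. edges G - S"]) (auto simp: double_diff)
  also have "\<dots> = limit_value (params y (phys_alpha G x y) (phys_beta G x y))"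
    unfolding limit_value_def
  proof (intro sum.cong refl arg_cong2[where f="(*)"])
    fix S assume S: "S \<in> Pow (edges G)"
    show "(\<Prod>e\<in>edges G - S. 1 / y e) = (\<Prod>e\<in>edges G - S. 1 / params y (phys_alpha G x y) (phys_beta G x y) $ Inl e)"
      by (simp add: params_def)
    show "g S = nested_sum (\<lambda>C. X (ind C) (params y (phys_alpha G x y) (phys_beta G x y))) S"
      unfolding g_def using S by (intro nested_sum_cong) (auto simp: X_ind_params facet_variable_phys)
  qed
  finally show ?thesis by (simp add: P_def)
qed

theorem mainTheorem14:
  fixes G :: "('v::finite) graph"
    and x :: "'v \<Rightarrow> complex"
    and y :: "'v set \<Rightarrow> complex"
  assumes "finite_tree G"
  shows "(\<forall>I\<in>conn_edge_sets G.
            facet_variable G y (phys_alpha G x y) (phys_beta G x y) I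
            = partial_energy G x y (edge_induced I)) \<and>
         (generic_energies G x y \<longrightarrow>
          (\<exists>M. (\<forall>a>0. continues_stringy_integral G a (M a)) \<and>
               (\<forall>\<^sub>F a in at_right 0.
                  regular_at (M a) (params y (phys_alpha G x y) (phys_beta G x y))) \<and>
               (\<exists>L. ((\<lambda>a. M a (params y (phys_alpha G x y) (phys_beta G x y))) \<longlongrightarrow> L)
                       (at_right 0) \<and>
                    correlator G x y
                    = 2 / (\<Prod>v\<in>verts G. vertex_energy G x y v) * L)))"
proof -
  interpret forest_graph G
    using assms by unfold_locales (auto simp: finite_tree_def)
  have conn: "connected_graph G" using assms by (simp add: finite_tree_def)
  define p where "p = params y (phys_alpha G x y) (phys_beta G x y)"
  define M where "M a z = complex_of_real a ^ card (edges G) * Nc (of_real a *s z)" for a :: real and z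
  \<comment> \<open>At the physical point the forms are the \<open>y e\<close> and the partial
    energies of edge-induced subgraphs, so genericity keeps it off all polar hyperplanes through the
    origin.\<close>
  have Xp: "X r p \<noteq> 0" if gen: "generic_energies G x y" and r: "r \<in> rays" for r
  proof -
    from r consider e where "e \<in> edges G" "r = negE e" | I where "I \<in> conn_edge_sets G" "r = ind I"
      by (auto simp: rays_def)
    then show ?thesis
    proof cases
      case 1
      then show ?thesis using gen by (simp add: X_negE p_def params_def generic_energies_def)
    next
      case 2
      have "edge_induced I \<in> connected_subgraphs G"
        using 2(1) edge_verts by (fastforce simp: connected_subgraphs_def subgraph_def edge_induced_def conn_edge_sets_def)
      then show ?thesis
        using gen 2 by (simp add: p_def X_ind_params facet_variable_phys generic_energies_def)
    qed
  qed
  have cont: "continues_stringy_integral G a (M a)" if a: "0 < a" for a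
    unfolding continues_stringy_integral_def
  proof (intro conjI allI impI)
    show "meromorphic_nd (M a)"
      unfolding M_def using a by (intro meromorphic_nd_Nc) simp
    fix y' \<alpha> \<beta> assume cd: "convergence_domain G y' \<alpha> \<beta>"
    define c where "c = (\<lambda>k. case k of Inl e \<Rightarrow> y' e | Inr (Inl e) \<Rightarrow> \<alpha> e | Inr (Inr I) \<Rightarrow> \<beta> I)"
    have "trop (\<lambda>k. a * c k) r = a * trop c r" for r
      by (simp add: trop_def sum_distrib_left right_diff_distrib mult.assoc)
    then have pos: "0 < trop (\<lambda>k. a * c k) r" if "r \<in> rays" for r
      using convergence_domain_trop_pos[OF cd that] a by (simp add: c_def)
    have "of_real a *s of_real_vec c = of_real_vec (\<lambda>k. a * c k)" by (simp add: of_real_vec_def vec_eq_iff)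
    moreover have "Nc (of_real_vec (\<lambda>k. a * c k)) = N (of_real_vec (\<lambda>k. a * c k))"
      using pos by (intro Nc_eq_N) (simp add: rv_in_D0)
    ultimately have "M a (of_real_vec c) = of_real a ^ card (edges G) * N (of_real_vec (\<lambda>k. a * c k))"
      by (simp add: M_def)
    also have "\<dots> = of_real (stringy_integral G a y' \<alpha> \<beta>)"
      using stringy_integral_eq[OF a, of y' \<alpha> \<beta>] pos unfolding c_def by simp
    finally show "M a (params (\<lambda>e. of_real (y' e)) (\<lambda>e. of_real (\<alpha> e)) (\<lambda>I. of_real (\<beta> I)))
      = of_real (stringy_integral G a y' \<alpha> \<beta>)"
      unfolding rv_params[symmetric] c_def .
  qed
  have reg: "\<forall>\<^sub>F a in at_right 0. regular_at (M a) p" if "generic_energies G x y"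
    unfolding M_def[abs_def] by (rule regular_at_Nc) (rule Xp[OF that])
  have lim: "((\<lambda>a. M a p) \<longlongrightarrow> limit_value p) (at_right 0)" if gen: "generic_energies G x y"
    unfolding M_def
  proof (rule limit_Nc[OF holomorphic_nd_limit_value])
    show "of_real (V c) = limit_value (of_real_vec c)" if "\<And>r. r \<in> rays \<Longrightarrow> 0 < trop c r" for c
      using that by (rule V_eq_limit_value)
    show "limit_value (a *s z) = limit_value z / a ^ card (edges G)" if "a \<noteq> 0" for a z
      using that by (rule limit_value_scale)
    show "X r p \<noteq> 0" if "r \<in> rays" for r
      using gen that by (rule Xp)
  qed (rule card_edges_le_rays)
  have corr: "correlator G x y = 2 / (\<Prod>v\<in>verts G. vertex_energy G x y v) * limit_value p"
    unfolding p_def by (rule correlator_eq_limit_value[OF conn])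
  show ?thesis
    using facet_variable_phys cont reg lim corr unfolding p_def by blast
qed

end
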